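(* Let $M=(M,g)$ be a semi-Riemannian manifold of finite volume and $G$ a connected Lie group with Lie algebra $\mathfrak{g}$ acting isometrically and locally effectively on $M$. Then there is a $G$-invariant non-empty open subset $U\subseteq M$ such that for any $X,Y\in\mathfrak{g}$, $|g(\widetilde{X},\widetilde{Y})(x)|\le C$ for all $x\in U$, where $C$ is a constant depending only on $X,Y$.
   Context: Manifolds are connected, smooth and without boundary; Lie groups are real and finite-dimensional; actions are smooth. Volume is with respect to the Lebesgue measure defined by the metric. An isometric action is locally effective if the kernel of the homomorphism $G\to\mathrm{Isom}(M)$ is discrete. For $X\in\mathfrak g$, $\widetilde X$ is the complete Killing vector field $\widetilde X(x)=\frac{\partial}{\partial t}(\exp(tX)\cdot x)|_{t=0}$. *)

theory Defs
  imports "HOL-Analysis.Analysis" "HOL-Algebra.Group_Action"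
begin

section \<open>Finite-dimensional model spaces\<close>

text \<open>
  Unlike \<^class>\<open>euclidean_space\<close>, this class also contains the zero-dimensional space, so that
  points and trivial groups count as manifolds and Lie groups.
\<close>

class finite_dim_normed = real_normed_vector +
  assumes ex_finite_spanning: "\<exists>B. finite B \<and> (\<forall>x. \<exists>c. x = (\<Sum>b\<in>B. c b *\<^sub>R b))"

instance euclidean_space \<subseteq> finite_dim_normed
proof
  have "\<forall>x::'a. \<exists>c. x = (\<Sum>b\<in>Basis. c b *\<^sub>R b)"
    using euclidean_representation[symmetric] by (intro allI exI)
  then show "\<exists>B::'a set. finite B \<and> (\<forall>x. \<exists>c. x = (\<Sum>b\<in>B. c b *\<^sub>R b))"
    using finite_Basis by blast
qed

definition std_basis :: "'e::finite_dim_normed set" where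
  "std_basis = (SOME B. independent B \<and> span B = UNIV)"

lemma std_basis:
  "independent (std_basis :: 'e::finite_dim_normed set)"
  "span (std_basis :: 'e set) = UNIV"
  "finite (std_basis :: 'e set)"
proof -
  have *: "\<exists>B :: 'e set. independent B \<and> span B = UNIV"
    using maximal_independent_subset[of "UNIV :: 'e set"] top.extremum_uniqueI by metis
  show 1: "independent (std_basis :: 'e set)" and "span (std_basis :: 'e set) = UNIV"
    unfolding std_basis_def using someI_ex[OF *] by auto
  show "finite (std_basis :: 'e set)"
  proof -
    obtain B :: "'e set" where B: "finite B" "\<forall>x. \<exists>c. x = (\<Sum>b\<in>B. c b *\<^sub>R b)"
      using ex_finite_spanning by blast
    have "x \<in> span B" for x
    proof -
      obtain c where "x = (\<Sum>b\<in>B. c b *\<^sub>R b)" using B(2) by blast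
      then show ?thesis by (auto intro: span_sum span_scale span_base)
    qed
    then show ?thesis
      using independent_span_bound[OF B(1) 1] by blast
  qed
qed

text \<open>Lebesgue measure normalised by the standard basis; compare \<open>lborel_eq\<close>.\<close>

definition std_lborel :: "'e::finite_dim_normed measure" where
  "std_lborel = distr (\<Pi>\<^sub>M b\<in>std_basis. (lborel :: real measure)) borel
                  (\<lambda>c. \<Sum>b\<in>std_basis. c b *\<^sub>R b)"

text \<open>
  Determinant of the Gram matrix of a bilinear form in the standard basis, by the Leibniz formula
  as in \<open>det_def\<close>.
\<close>

definition gram_det :: "('e::finite_dim_normed \<Rightarrow> 'e \<Rightarrow> real) \<Rightarrow> real" where
  "gram_det h = (\<Sum>p | p permutes (std_basis :: 'e set).
                   of_int (sign p) * (\<Prod>b\<in>std_basis. h b (p b)))"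

text \<open>
  In finite dimension, existence and continuity of all iterated directional derivatives up to
  order \<open>k\<close> is the usual notion of being \<open>k\<close> times continuously differentiable.  Used only for
  open \<open>S\<close>.
\<close>

primrec higher_differentiable_on ::
  "nat \<Rightarrow> 'a::real_normed_vector set \<Rightarrow> ('a \<Rightarrow> 'b::real_normed_vector) \<Rightarrow> bool" where
  "higher_differentiable_on 0 S f \<longleftrightarrow> continuous_on S f"
| "higher_differentiable_on (Suc k) S f \<longleftrightarrow>
     (\<forall>x\<in>S. f differentiable (at x)) \<and>
     (\<forall>v. higher_differentiable_on k S (\<lambda>x. frechet_derivative f (at x) v))"

definition smooth_on :: "'a::real_normed_vector set \<Rightarrow> ('a \<Rightarrow> 'b::real_normed_vector) \<Rightarrow> bool" where
  "smooth_on S f \<longleftrightarrow> (\<forall>k. higher_differentiable_on k S f)"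

section \<open>Smooth manifolds\<close>

text \<open>
  A chart is its domain together with the coordinate map, whose values outside the domain are
  irrelevant.  The underlying set of a manifold is the whole type.  Atlases need not be maximal.
\<close>

type_synonym ('m, 'e) chart = "'m set \<times> ('m \<Rightarrow> 'e)"

definition chart_inv :: "('m, 'e) chart \<Rightarrow> 'e \<Rightarrow> 'm" where
  "chart_inv c = inv_into (fst c) (snd c)"

locale smooth_manifold =
  fixes A :: "('m::{t2_space,second_countable_topology}, 'e::finite_dim_normed) chart set"
  assumes open_domain: "\<And>c. c \<in> A \<Longrightarrow> open (fst c)"
    and open_range: "\<And>c. c \<in> A \<Longrightarrow> open (snd c ` fst c)"
    and chart_homeomorphism:
      "\<And>c. c \<in> A \<Longrightarrow> homeomorphism (fst c) (snd c ` fst c) (snd c) (chart_inv c)"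
    and charts_cover: "(\<Union>c\<in>A. fst c) = UNIV"
    and charts_compatible:
      "\<And>c d. c \<in> A \<Longrightarrow> d \<in> A \<Longrightarrow> smooth_on (snd c ` (fst c \<inter> fst d)) (snd d \<circ> chart_inv c)"

definition smooth_map ::
  "('m::topological_space, 'e::real_normed_vector) chart set \<Rightarrow>
   ('n::topological_space, 'f::real_normed_vector) chart set \<Rightarrow> ('m \<Rightarrow> 'n) \<Rightarrow> bool" where
  "smooth_map A B f \<longleftrightarrow> continuous_on UNIV f \<and>
     (\<forall>c\<in>A. \<forall>d\<in>B. smooth_on (snd c ` (fst c \<inter> f -` fst d)) (snd d \<circ> f \<circ> chart_inv c))"

definition prod_atlas ::
  "('m, 'e) chart set \<Rightarrow> ('n, 'f) chart set \<Rightarrow> ('m \<times> 'n, 'e \<times> 'f) chart set" where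
  "prod_atlas A B = {(fst c \<times> fst d, map_prod (snd c) (snd d)) | c d. c \<in> A \<and> d \<in> B}"

definition real_atlas :: "(real, real) chart set" where
  "real_atlas = {(UNIV, id)}"

text \<open>
  A tangent vector at \<open>p\<close> is the family of its coordinate expressions in the charts around \<open>p\<close>
  (related by the derivatives of the chart changes), set to \<open>0\<close> at all other arguments.  The vector
  space operations are pointwise.
\<close>

type_synonym ('m, 'e) tangent = "('m, 'e) chart \<Rightarrow> 'e"

definition tangent_space ::
  "('m, 'e::real_normed_vector) chart set \<Rightarrow> 'm \<Rightarrow> ('m, 'e) tangent set" where
  "tangent_space A p = {X.
     (\<forall>c. \<not> (c \<in> A \<and> p \<in> fst c) \<longrightarrow> X c = 0) \<and>
     (\<forall>c\<in>A. \<forall>d\<in>A. p \<in> fst c \<inter> fst d \<longrightarrow>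
        X d = frechet_derivative (snd d \<circ> chart_inv c) (at (snd c p)) (X c))}"

text \<open>The tangent vector at \<open>p\<close> with coordinates \<open>v\<close> in the chart \<open>c\<close>.\<close>

definition coord_vector ::
  "('m, 'e::real_normed_vector) chart set \<Rightarrow> ('m, 'e) chart \<Rightarrow> 'm \<Rightarrow> 'e \<Rightarrow> ('m, 'e) tangent" where
  "coord_vector A c p v = (\<lambda>d. if d \<in> A \<and> p \<in> fst d
     then frechet_derivative (snd d \<circ> chart_inv c) (at (snd c p)) v else 0)"

definition velocity ::
  "('m, 'e::real_normed_vector) chart set \<Rightarrow> (real \<Rightarrow> 'm) \<Rightarrow> real \<Rightarrow> ('m, 'e) tangent" where
  "velocity A \<gamma> t = (\<lambda>c. if c \<in> A \<and> \<gamma> t \<in> fst c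
     then vector_derivative (snd c \<circ> \<gamma>) (at t) else 0)"

text \<open>On tangent vectors the result does not depend on the chart selected around \<open>p\<close>.\<close>

definition differential ::
  "('m, 'e::real_normed_vector) chart set \<Rightarrow> ('n, 'f::real_normed_vector) chart set \<Rightarrow>
   ('m \<Rightarrow> 'n) \<Rightarrow> 'm \<Rightarrow> ('m, 'e) tangent \<Rightarrow> ('n, 'f) tangent" where
  "differential A B f p X = (\<lambda>d. if d \<in> B \<and> f p \<in> fst d
     then (let c = (SOME c. c \<in> A \<and> p \<in> fst c)
           in frechet_derivative (snd d \<circ> f \<circ> chart_inv c) (at (snd c p)) (X c))
     else 0)"

section \<open>Semi-Riemannian metrics\<close>

type_synonym ('m, 'e) metric_field = "'m \<Rightarrow> ('m, 'e) tangent \<Rightarrow> ('m, 'e) tangent \<Rightarrow> real"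

definition metric_coords ::
  "('m, 'e::real_normed_vector) chart set \<Rightarrow> ('m, 'e) metric_field \<Rightarrow> ('m, 'e) chart \<Rightarrow>
   'm \<Rightarrow> 'e \<Rightarrow> 'e \<Rightarrow> real" where
  "metric_coords A g c p v w = g p (coord_vector A c p v) (coord_vector A c p w)"

text \<open>
  For a chart \<open>c\<close> around \<open>p\<close>, \<open>coord_vector A c p\<close> is a linear isomorphism onto the tangent space
  at \<open>p\<close>, so the conditions below say that \<open>g\<close> is a smooth field of nondegenerate symmetric
  bilinear forms on the tangent spaces.  The index is then locally constant, hence constant on a
  connected manifold.
\<close>

locale semi_riemannian_manifold = smooth_manifold A
  for A :: "('m::{t2_space,second_countable_topology}, 'e::finite_dim_normed) chart set" +
  fixes g :: "('m, 'e) metric_field"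
  assumes metric_bilinear:
      "\<And>c p. c \<in> A \<Longrightarrow> p \<in> fst c \<Longrightarrow> bilinear (metric_coords A g c p)"
    and metric_symmetric:
      "\<And>c p v w. c \<in> A \<Longrightarrow> p \<in> fst c \<Longrightarrow> metric_coords A g c p v w = metric_coords A g c p w v"
    and metric_nondegenerate:
      "\<And>c p v. c \<in> A \<Longrightarrow> p \<in> fst c \<Longrightarrow> (\<forall>w. metric_coords A g c p v w = 0) \<Longrightarrow> v = 0"
    and metric_smooth:
      "\<And>c v w. c \<in> A \<Longrightarrow> smooth_on (snd c ` fst c) (\<lambda>y. metric_coords A g c (chart_inv c y) v w)"

text \<open>
  The measure \<open>\<mu>\<close> defined by the metric, with density \<open>\<surd>\<bar>det (g\<^sub>i\<^sub>j)\<bar>\<close> in every chart.  These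
  conditions determine it uniquely among Borel measures.
\<close>

definition is_metric_volume ::
  "('m::topological_space, 'e::finite_dim_normed) chart set \<Rightarrow> ('m, 'e) metric_field \<Rightarrow>
   'm measure \<Rightarrow> bool" where
  "is_metric_volume A g \<mu> \<longleftrightarrow> sets \<mu> = sets borel \<and>
     (\<forall>c\<in>A. \<forall>S\<in>sets borel. S \<subseteq> fst c \<longrightarrow>
        emeasure \<mu> S =
          (\<integral>\<^sup>+y. ennreal (sqrt \<bar>gram_det (metric_coords A g c (chart_inv c y))\<bar>) *
                 indicator (snd c ` S) y \<partial>std_lborel))"

definition isometry ::
  "('m::topological_space, 'e::real_normed_vector) chart set \<Rightarrow> ('m, 'e) metric_field \<Rightarrow>
   ('m \<Rightarrow> 'm) \<Rightarrow> bool" where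
  "isometry A g f \<longleftrightarrow> bij f \<and> smooth_map A A f \<and> smooth_map A A (inv_into UNIV f) \<and>
     (\<forall>p. \<forall>X\<in>tangent_space A p. \<forall>Y\<in>tangent_space A p.
        g (f p) (differential A A f p X) (differential A A f p Y) = g p X Y)"

section \<open>Lie groups and their actions\<close>

locale lie_group = group G + smooth_manifold A
  for G :: "'g::{t2_space,second_countable_topology} monoid" (structure)
    and A :: "('g, 'e::finite_dim_normed) chart set" +
  assumes carrier_UNIV: "carrier G = UNIV"
    and mult_smooth: "smooth_map (prod_atlas A A) A (\<lambda>(x, y). x \<otimes>\<^bsub>G\<^esub> y)"
    and inv_smooth: "smooth_map A A (\<lambda>x. inv\<^bsub>G\<^esub> x)"

definition lie_algebra ::
  "'g monoid \<Rightarrow> ('g, 'e::real_normed_vector) chart set \<Rightarrow> ('g, 'e) tangent set" where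
  "lie_algebra G A = tangent_space A \<one>\<^bsub>G\<^esub>"

definition one_parameter_subgroup ::
  "'g::topological_space monoid \<Rightarrow> ('g, 'e::real_normed_vector) chart set \<Rightarrow> (real \<Rightarrow> 'g) \<Rightarrow> bool"
  where "one_parameter_subgroup G A \<gamma> \<longleftrightarrow>
     smooth_map real_atlas A \<gamma> \<and> (\<forall>s t. \<gamma> (s + t) = \<gamma> s \<otimes>\<^bsub>G\<^esub> \<gamma> t)"

definition lie_exp ::
  "'g::topological_space monoid \<Rightarrow> ('g, 'e::real_normed_vector) chart set \<Rightarrow>
   ('g, 'e) tangent \<Rightarrow> 'g" where
  "lie_exp G A X = (THE \<gamma>. one_parameter_subgroup G A \<gamma> \<and> velocity A \<gamma> 0 = X) 1"

locale smooth_action =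
  lie_group G B + smooth_manifold A + group_action G UNIV \<Phi>
  for G :: "'g::{t2_space,second_countable_topology} monoid" (structure)
    and B :: "('g, 'f::finite_dim_normed) chart set"
    and A :: "('m::{t2_space,second_countable_topology}, 'e::finite_dim_normed) chart set"
    and \<Phi> :: "'g \<Rightarrow> 'm \<Rightarrow> 'm" +
  assumes action_smooth: "smooth_map (prod_atlas B A) A (\<lambda>(h, x). \<Phi> h x)"

definition locally_effective ::
  "'g::topological_space monoid \<Rightarrow> ('g \<Rightarrow> 'm \<Rightarrow> 'm) \<Rightarrow> bool" where
  "locally_effective G \<Phi> \<longleftrightarrow> discrete (kernel G (BijGroup UNIV) \<Phi>)"

definition fundamental_field ::
  "'g::topological_space monoid \<Rightarrow> ('g, 'f::real_normed_vector) chart set \<Rightarrow>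
   ('m, 'e::real_normed_vector) chart set \<Rightarrow> ('g \<Rightarrow> 'm \<Rightarrow> 'm) \<Rightarrow>
   ('g, 'f) tangent \<Rightarrow> 'm \<Rightarrow> ('m, 'e) tangent" where
  "fundamental_field G B A \<Phi> X x = velocity A (\<lambda>t. \<Phi> (lie_exp G B (\<lambda>c. t *\<^sub>R X c)) x) 0"

end

theory Submission
  imports Defs
begin

text \<open>Write \<open>X\<^sup>~\<close> for the fundamental field of \<open>X\<close> and put
  \<open>f\<^sub>X\<^sub>Y(x) = g(X\<^sup>~, Y\<^sup>~)(x)\<close>.  Three facts carry the proof.

  First, \<open>X\<^sup>~(x)\<close> is the derivative at the identity of the orbit map \<open>k \<mapsto> k \<cdot> x\<close>, applied to \<open>X\<close>.
  So \<open>f\<^sub>X\<^sub>Y\<close> is bilinear in \<open>X\<close> and \<open>Y\<close>, continuous on the manifold, and, since the group acts by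
  isometries, \<open>f\<^sub>X\<^sub>Y(h \<cdot> x) = f\<^sub>V\<^sub>W(x)\<close> with \<open>V = Ad(h\<^sup>-\<^sup>1) X\<close> and \<open>W = Ad(h\<^sup>-\<^sup>1) Y\<close>
  (\<open>field_product_equivariant\<close>).  Hence the functions \<open>f\<^sub>X\<^sub>Y\<close> span a finite-dimensional space of
  continuous functions that is invariant under the group.  This step needs the exponential map to be
  what its name says, that is, existence and uniqueness of one-parameter subgroups with given
  velocity: they are the integral curves of left-invariant fields through the identity.

  Second, isometries preserve the volume, by the change of variables formula, and non-empty open sets
  have positive volume (\<open>volume_isometry_image\<close>, \<open>volume_open_pos\<close>).

  Third, in a finite-dimensional invariant space of continuous functions on a space with a finite
  invariant measure of full support, every orbit is bounded
  (\<open>invariant_function_space_orbit_bound\<close>).  Let \<open>f\<close> be one of the functions and write its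
  translate by \<open>h\<close> as \<open>t u\<close>, where the coefficients of \<open>u\<close> in a basis form a unit vector.  By
  compactness of the unit sphere there are \<open>\<eta>\<close>, \<open>\<delta> > 0\<close>, not depending on \<open>h\<close>, such that \<open>\<bar>u\<bar> > \<eta>\<close> on a set of measure at least \<open>\<delta>\<close>.  By
  invariance \<open>\<bar>f\<bar> > t \<eta>\<close> on a set of measure at least \<open>\<delta>\<close>, and because the measure is finite this
  bounds \<open>t\<close>.

  So \<open>\<bar>f\<^sub>X\<^sub>Y(h \<cdot> x)\<bar>\<close> is at most a constant times a fixed continuous function of \<open>x\<close>, for all \<open>h\<close>.
  The union of all translates of a non-empty open set on which this function is bounded is then an
  open invariant set on which every \<open>f\<^sub>X\<^sub>Y\<close> is bounded.\<close>

section \<open>Coordinates on finite-dimensional normed spaces\<close>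

text \<open>The change of variables theorem for \<^typ>\<open>real ^ 'n\<close> needs a finite well-ordered index type, so the
  elements of the standard basis are made into one.  Types being non-empty, the zero-dimensional
  space gets the dummy index \<open>0\<close>; there \<open>of_vec\<close> below is not injective.\<close>

typedef (overloaded) ('e::finite_dim_normed) basis_index =
  "if (std_basis :: 'e set) = {} then {0} else (std_basis :: 'e set)"
  by auto

lemma finite_basis_index: "finite (UNIV :: ('e::finite_dim_normed) basis_index set)"
proof -
  have "finite (if (std_basis :: 'e set) = {} then {0} else (std_basis :: 'e set))"
    using std_basis(3) by auto
  then show ?thesis
    using type_definition.univ[OF type_definition_basis_index] by (metis finite_imageI)
qed

instance basis_index :: (finite_dim_normed) finite
  by standard (rule finite_basis_index)

text \<open>Any well-order of the finite index set serves; this one is pulled back from the natural numbers.\<close>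

instantiation basis_index :: (finite_dim_normed) wellorder
begin

definition less_eq_basis_index :: "'a basis_index \<Rightarrow> 'a basis_index \<Rightarrow> bool" where
  "less_eq_basis_index x y \<longleftrightarrow> to_nat_on UNIV x \<le> to_nat_on UNIV y"

definition less_basis_index :: "'a basis_index \<Rightarrow> 'a basis_index \<Rightarrow> bool" where
  "less_basis_index x y \<longleftrightarrow> to_nat_on UNIV x < to_nat_on UNIV y"

instance
proof
  have inj: "inj (to_nat_on (UNIV :: 'a basis_index set))"
    using inj_on_to_nat_on[of "UNIV :: 'a basis_index set"] finite_basis_index countable_finite by blast
  fix x y z :: "'a basis_index"
  show "(x < y) = (x \<le> y \<and> \<not> y \<le> x)" by (auto simp: less_eq_basis_index_def less_basis_index_def)
  show "x \<le> x" by (simp add: less_eq_basis_index_def)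
  show "x \<le> y \<Longrightarrow> y \<le> z \<Longrightarrow> x \<le> z" by (simp add: less_eq_basis_index_def)
  show "x \<le> y \<Longrightarrow> y \<le> x \<Longrightarrow> x = y" 
    using inj by (simp add: less_eq_basis_index_def inj_def)
  show "x \<le> y \<or> y \<le> x" by (auto simp: less_eq_basis_index_def)
next
  fix P :: "'a basis_index \<Rightarrow> bool" and a :: "'a basis_index"
  assume *: "\<And>x. (\<And>y. y < x \<Longrightarrow> P y) \<Longrightarrow> P x"
  show "P a"
    by (rule measure_induct[where f="to_nat_on (UNIV :: 'a basis_index set)"])
       (use * in \<open>auto simp: less_basis_index_def\<close>)
qed

end

definition basis_elem :: "'e basis_index \<Rightarrow> 'e::finite_dim_normed" where
  "basis_elem = Rep_basis_index"

lemma inj_basis_elem: "inj basis_elem"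
  by (simp add: basis_elem_def inj_def Rep_basis_index_inject)

lemma range_basis_elem:
  assumes "(std_basis :: 'e::finite_dim_normed set) \<noteq> {}"
  shows "range (basis_elem :: 'e basis_index \<Rightarrow> 'e) = std_basis"
proof -
  have "range (Rep_basis_index :: 'e basis_index \<Rightarrow> 'e) = (if (std_basis :: 'e set) = {} then {0} else std_basis)"
    by (rule type_definition.Rep_range[OF type_definition_basis_index])
  with assms show ?thesis by (simp add: basis_elem_def)
qed

definition coord :: "'e::finite_dim_normed \<Rightarrow> 'e \<Rightarrow> real" where
  "coord b x = representation std_basis x b"

lemma coord_sum: "(\<Sum>b\<in>std_basis. coord b x *\<^sub>R b) = x"
  unfolding coord_def
  using real_vector.sum_representation_eq[OF std_basis(1), of x std_basis]
  by (auto simp: std_basis)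

lemma linear_coord: "linear (coord b)"
  by (rule linearI)
     (auto simp: coord_def std_basis real_vector.representation_add real_vector.representation_scale)

lemma coord_basis: "b \<in> std_basis \<Longrightarrow> c \<in> std_basis \<Longrightarrow> coord b c = (if b = c then 1 else 0)"
  by (auto simp: coord_def std_basis real_vector.representation_basis)

definition of_vec :: "real ^ ('e basis_index) \<Rightarrow> 'e::finite_dim_normed" where
  "of_vec c = (\<Sum>i\<in>UNIV. c $ i *\<^sub>R basis_elem i)"

definition to_vec :: "'e::finite_dim_normed \<Rightarrow> real ^ ('e basis_index)" where
  "to_vec x = (\<chi> i. coord (basis_elem i) x)"

lemma linear_of_vec: "linear of_vec"
  by (rule linearI) (auto simp: of_vec_def algebra_simps sum.distrib scaleR_sum_right)

lemma linear_to_vec: "linear to_vec"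
  by (rule linearI)
     (auto simp: to_vec_def vec_eq_iff linear_add[OF linear_coord] linear_scale[OF linear_coord])

lemma sum_basis_elem:
  fixes h :: "'e::finite_dim_normed \<Rightarrow> 'b::comm_monoid_add"
  assumes "(std_basis :: 'e set) \<noteq> {}"
  shows "(\<Sum>i\<in>UNIV. h (basis_elem i)) = (\<Sum>b\<in>std_basis. h b)"
  using sum.reindex[OF inj_basis_elem, of h] range_basis_elem[OF assms] by (simp add: comp_def)

lemma trivial_space: "(std_basis :: 'e::finite_dim_normed set) = {} \<Longrightarrow> (x::'e) = 0"
  using coord_sum[of x] by simp

lemma of_vec_to_vec: "of_vec (to_vec x) = (x :: 'e::finite_dim_normed)"
proof (cases "(std_basis :: 'e set) = {}")
  case True
  show ?thesis by (metis trivial_space[OF True])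
next
  case False
  show ?thesis
    unfolding of_vec_def to_vec_def vec_lambda_beta
    using sum_basis_elem[OF False, of "\<lambda>b. coord b x *\<^sub>R b"] by (simp add: coord_sum)
qed

lemma to_vec_of_vec:
  fixes c :: "real ^ ('e::finite_dim_normed basis_index)"
  assumes "(std_basis :: 'e set) \<noteq> {}"
  shows "to_vec (of_vec c) = c"
proof -
  have be: "basis_elem i \<in> (std_basis :: 'e set)" for i
    using range_basis_elem[OF assms] by blast
  have "coord (basis_elem i) (of_vec c) = c $ i" for i
  proof -
    have "coord (basis_elem i) (of_vec c) = (\<Sum>j\<in>UNIV. c $ j * coord (basis_elem i) (basis_elem j))"
      by (simp add: of_vec_def linear_sum[OF linear_coord] linear_scale[OF linear_coord])
    also have "\<dots> = (\<Sum>j\<in>UNIV. if j = i then c $ j else 0)"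
      by (intro sum.cong) (auto simp: coord_basis be inj_eq[OF inj_basis_elem])
    also have "\<dots> = c $ i" by simp
    finally show ?thesis .
  qed
  then show ?thesis by (simp add: to_vec_def vec_eq_iff)
qed

lemma bounded_linear_of_vec: "bounded_linear of_vec"
  using linear_of_vec linear_conv_bounded_linear by blast

text \<open>Equivalence of norms: the norm pulled back to the Euclidean space attains a positive minimum on
  the compact unit sphere.\<close>

lemma bounded_linear_to_vec: "bounded_linear (to_vec :: 'e::finite_dim_normed \<Rightarrow> _)"
proof (cases "(std_basis :: 'e set) = {}")
  case True
  have "to_vec = (\<lambda>x::'e. 0)"
    using trivial_space[OF True] linear_0[OF linear_to_vec] by (metis (full_types))
  then show ?thesis by (metis bounded_linear_zero)
next
  case False
  let ?S = "sphere (0 :: real ^ ('e basis_index)) 1"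
  have cont: "continuous_on ?S (\<lambda>c. norm (of_vec c))"
    by (intro continuous_intros bounded_linear.continuous_on[OF bounded_linear_of_vec])
  obtain c0 where c0: "c0 \<in> ?S" "\<And>c. c \<in> ?S \<Longrightarrow> norm (of_vec c0) \<le> norm (of_vec c)"
    using continuous_attains_inf[OF compact_sphere _ cont] by (auto simp: )
  define m where "m = norm (of_vec c0)"
  have "of_vec c0 \<noteq> 0"
  proof
    assume "of_vec c0 = 0"
    then have "c0 = 0" using to_vec_of_vec[OF False, of c0] linear_0[OF linear_to_vec] by metis
    then show False using c0(1) by simp
  qed
  then have m: "m > 0" by (simp add: m_def)
  have bound: "m * norm c \<le> norm (of_vec c)" for c :: "real ^ ('e basis_index)"
  proof (cases "c = 0")
    case False
    then have "m \<le> norm (of_vec (c /\<^sub>R norm c))"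
      unfolding m_def by (intro c0(2)) simp
    then show ?thesis using False
      by (simp add: linear_scale[OF linear_of_vec] field_simps)
  qed (simp add: linear_0[OF linear_of_vec])
  show ?thesis
  proof (rule bounded_linear_intro[where K="1/m"])
    fix x y :: 'e and r :: real
    show "to_vec (x + y) = to_vec x + to_vec y" by (rule linear_add[OF linear_to_vec])
    show "to_vec (r *\<^sub>R x) = r *\<^sub>R to_vec x" by (rule linear_scale[OF linear_to_vec])
    show "norm (to_vec x) \<le> norm x * (1/m)"
      using bound[of "to_vec x"] m by (simp add: of_vec_to_vec field_simps)
  qed
qed

lemma finite_dim_bounded_linear:
  fixes f :: "'e::finite_dim_normed \<Rightarrow> 'b::real_normed_vector"
  assumes "linear f"
  shows "bounded_linear f"
proof -
  have "linear (\<lambda>c. f (of_vec c))"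
    using linear_compose[OF linear_of_vec assms] by (simp add: comp_def)
  then have "bounded_linear (\<lambda>c. f (of_vec c))"
    using linear_conv_bounded_linear by blast
  from bounded_linear_compose[OF this bounded_linear_to_vec]
  show ?thesis by (simp add: of_vec_to_vec)
qed

lemma bounded_linear_coord: "bounded_linear (coord b)"
  by (rule finite_dim_bounded_linear[OF linear_coord])

instance finite_dim_normed \<subseteq> heine_borel
proof
  fix f :: "nat \<Rightarrow> 'a"
  assume "bounded (range f)"
  then have "bounded (to_vec ` range f)"
    by (rule bounded_linear_image[OF _ bounded_linear_to_vec])
  then have "bounded (range (\<lambda>n. to_vec (f n)))" by (simp add: image_image)
  then obtain l and r :: "nat \<Rightarrow> nat" where r: "strict_mono r"
    and l: "((\<lambda>n. to_vec (f n)) \<circ> r) \<longlonglongrightarrow> l"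
    using bounded_imp_convergent_subsequence by blast
  have "(\<lambda>n. of_vec (((\<lambda>n. to_vec (f n)) \<circ> r) n)) \<longlonglongrightarrow> of_vec l"
    by (rule bounded_linear.tendsto[OF bounded_linear_of_vec l])
  then have "(f \<circ> r) \<longlonglongrightarrow> of_vec l" by (simp add: of_vec_to_vec comp_def)
  with r show "\<exists>l r. strict_mono r \<and> (f \<circ> r) \<longlonglongrightarrow> l" by blast
qed

instance finite_dim_normed \<subseteq> banach
  by standard

instance prod :: (finite_dim_normed, finite_dim_normed) finite_dim_normed
proof
  let ?B = "(\<lambda>a. (a, 0)) ` std_basis \<union> (\<lambda>b. (0, b)) ` std_basis :: ('a \<times> 'b) set"
  have "x \<in> span ?B" for x
  proof -
    have 1: "(fst x, 0) \<in> span ?B"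
    proof -
      have "(fst x, 0::'b) = (\<Sum>a\<in>std_basis. coord a (fst x) *\<^sub>R (a, 0))"
        using coord_sum[of "fst x"]
        by (simp add: prod_eq_iff fst_sum snd_sum)
      also have "\<dots> \<in> span ?B" by (intro span_sum span_scale span_base) auto
      finally show ?thesis .
    qed
    have 2: "(0, snd x) \<in> span ?B"
    proof -
      have "(0::'a, snd x) = (\<Sum>a\<in>std_basis. coord a (snd x) *\<^sub>R (0, a))"
        using coord_sum[of "snd x"]
        by (simp add: prod_eq_iff fst_sum snd_sum)
      also have "\<dots> \<in> span ?B" by (intro span_sum span_scale span_base) auto
      finally show ?thesis .
    qed
    have "x = (fst x, 0) + (0, snd x)" by simp
    also have "\<dots> \<in> span ?B" using 1 2 span_add by blast
    finally show ?thesis .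
  qed
  moreover have fin: "finite ?B" by (simp add: std_basis(3))
  ultimately have "\<forall>x. \<exists>c. x = (\<Sum>b\<in>?B. c b *\<^sub>R b)"
    using span_finite[OF fin] by (auto simp: image_def) 
  with fin show "\<exists>B::('a \<times> 'b) set. finite B \<and> (\<forall>x. \<exists>c. x = (\<Sum>b\<in>B. c b *\<^sub>R b))" by blast
qed

section \<open>Calculus of k times differentiable maps\<close>

abbreviation (input) dir_deriv :: "('a::real_normed_vector \<Rightarrow> 'b::real_normed_vector) \<Rightarrow> 'a \<Rightarrow> 'a \<Rightarrow> 'b" where
  "dir_deriv f v x \<equiv> frechet_derivative f (at x) v"

lemma frechet_derivative_cong_open:
  assumes "open S" "x \<in> S" "\<And>y. y \<in> S \<Longrightarrow> f y = g y"
  shows "frechet_derivative f (at x) = frechet_derivative g (at x)"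
proof -
  have "(f has_derivative D) (at x) \<longleftrightarrow> (g has_derivative D) (at x)" for D
    using assms has_derivative_transform_within_open[of f D x UNIV S g]
      has_derivative_transform_within_open[of g D x UNIV S f] by auto
  then show ?thesis by (simp add: frechet_derivative_def)
qed

lemma differentiable_cong_open:
  assumes "open S" "x \<in> S" "\<And>y. y \<in> S \<Longrightarrow> f y = g y" "f differentiable (at x)"
  shows "g differentiable (at x)"
  using assms has_derivative_transform_within_open[of f _ x UNIV S g]
  unfolding differentiable_def by blast

lemma higher_differentiable_on_cong:
  assumes "open S" "\<And>y. y \<in> S \<Longrightarrow> f y = g y" "higher_differentiable_on k S f"
  shows "higher_differentiable_on k S g"
  using assms(2,3)
proof (induction k arbitrary: f g)
  case 0
  then show ?case by (simp cong: continuous_on_cong)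
next
  case (Suc k)
  have "frechet_derivative f (at x) = frechet_derivative g (at x)" if "x \<in> S" for x
    using frechet_derivative_cong_open[OF assms(1) that] Suc.prems(1) by blast
  moreover have "g differentiable (at x)" if "x \<in> S" for x
    using differentiable_cong_open[OF assms(1) that Suc.prems(1)] Suc.prems(2) that by simp
  ultimately show ?case
    using Suc.prems(2) Suc.IH[of "\<lambda>x. frechet_derivative f (at x) v" "\<lambda>x. frechet_derivative g (at x) v" for v]
    by simp
qed

lemma higher_differentiable_on_continuous:
  "higher_differentiable_on k S f \<Longrightarrow> continuous_on S f"
  by (cases k) (auto intro!: continuous_at_imp_continuous_on differentiable_imp_continuous_within)

lemma higher_differentiable_on_SucD:
  "higher_differentiable_on (Suc k) S f \<Longrightarrow> higher_differentiable_on k S f"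
proof (induction k arbitrary: f)
  case 0
  then show ?case using higher_differentiable_on_continuous by fastforce
next
  case (Suc k)
  then show ?case by (metis higher_differentiable_on.simps(2))
qed

lemma higher_differentiable_on_subset:
  "higher_differentiable_on k S f \<Longrightarrow> T \<subseteq> S \<Longrightarrow> higher_differentiable_on k T f"
  by (induction k arbitrary: f) (auto intro: continuous_on_subset)

text \<open>Differentiability is imposed at points and continuity is local on open sets, so the notion can be
  checked near each point.\<close>

lemma higher_differentiable_on_local:
  assumes "\<And>x. x \<in> S \<Longrightarrow> \<exists>T. open T \<and> x \<in> T \<and> higher_differentiable_on k T f"
  shows "higher_differentiable_on k S f"
  using assms
proof (induction k arbitrary: f)
  case 0
  have "isCont f x" if x: "x \<in> S" for x
    using 0(1)[OF x] by (auto simp: continuous_on_eq_continuous_at)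
  then show ?case by (simp add: continuous_at_imp_continuous_on)
next
  case (Suc k)
  have "f differentiable (at x)" if "x \<in> S" for x
    using Suc.prems[OF that] by auto
  moreover have "higher_differentiable_on k S (dir_deriv f v)" for v
  proof (rule Suc.IH)
    fix x assume "x \<in> S"
    then show "\<exists>T. open T \<and> x \<in> T \<and> higher_differentiable_on k T (dir_deriv f v)"
      using Suc.prems[of x] by auto
  qed
  ultimately show ?case by simp
qed

lemma higher_differentiable_on_const: "higher_differentiable_on k S (\<lambda>x. c)"
  by (induction k arbitrary: c) (auto simp: frechet_derivative_const)

lemma higher_differentiable_on_add:
  assumes "open S" "higher_differentiable_on k S f" "higher_differentiable_on k S g"
  shows "higher_differentiable_on k S (\<lambda>x. f x + g x)"
  using assms(2,3)
proof (induction k arbitrary: f g)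
  case 0
  then show ?case by (auto intro: continuous_intros)
next
  case (Suc k)
  have der: "((\<lambda>x. f x + g x) has_derivative (\<lambda>v. dir_deriv f v y + dir_deriv g v y)) (at y)"
    if "y \<in> S" for y
    using that Suc.prems by (intro has_derivative_add) (auto simp: frechet_derivative_works)
  have "higher_differentiable_on k S (dir_deriv (\<lambda>x. f x + g x) v)" for v
  proof (rule higher_differentiable_on_cong[OF assms(1)])
    show "higher_differentiable_on k S (\<lambda>x. dir_deriv f v x + dir_deriv g v x)"
      using Suc by simp
    show "dir_deriv f v y + dir_deriv g v y = dir_deriv (\<lambda>x. f x + g x) v y" if "y \<in> S" for y
      using frechet_derivative_at[OF der[OF that]] by metis
  qed
  then show ?case using Suc.prems by simp
qed

lemma higher_differentiable_on_scaleR: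
  fixes r :: "'a::real_normed_vector \<Rightarrow> real"
  assumes "open S" "higher_differentiable_on k S r" "higher_differentiable_on k S f"
  shows "higher_differentiable_on k S (\<lambda>x. r x *\<^sub>R f x)"
  using assms(2,3)
proof (induction k arbitrary: r f)
  case 0
  then show ?case by (auto intro: continuous_intros)
next
  case (Suc k)
  have der: "((\<lambda>x. r x *\<^sub>R f x) has_derivative (\<lambda>v. r y *\<^sub>R dir_deriv f v y + dir_deriv r v y *\<^sub>R f y)) (at y)"
    if "y \<in> S" for y
    using that Suc.prems
    by (intro has_derivative_scaleR) (auto simp: frechet_derivative_works)
  have "higher_differentiable_on k S (dir_deriv (\<lambda>x. r x *\<^sub>R f x) v)" for v
  proof (rule higher_differentiable_on_cong[OF assms(1)])
    show "higher_differentiable_on k S (\<lambda>y. r y *\<^sub>R dir_deriv f v y + dir_deriv r v y *\<^sub>R f y)"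
    proof (intro higher_differentiable_on_add[OF assms(1)] Suc.IH)
      show "higher_differentiable_on k S r" "higher_differentiable_on k S f"
        using Suc.prems by (blast intro: higher_differentiable_on_SucD)+
      show "higher_differentiable_on k S (dir_deriv f v)" "higher_differentiable_on k S (dir_deriv r v)"
        using Suc.prems by simp_all
    qed
    show "r y *\<^sub>R dir_deriv f v y + dir_deriv r v y *\<^sub>R f y = dir_deriv (\<lambda>x. r x *\<^sub>R f x) v y" if "y \<in> S" for y
      using frechet_derivative_at[OF der[OF that]] by metis
  qed
  then show ?case using der by (auto simp: differentiable_def)
qed

lemma higher_differentiable_on_bounded_linear:
  assumes "open S" "bounded_linear L" "higher_differentiable_on k S f"
  shows "higher_differentiable_on k S (\<lambda>x. L (f x))"
  using assms(3)
proof (induction k arbitrary: f)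
  case 0
  then show ?case using bounded_linear.continuous_on[OF assms(2)] by auto
next
  case (Suc k)
  have der: "((\<lambda>x. L (f x)) has_derivative (\<lambda>v. L (dir_deriv f v y))) (at y)" if "y \<in> S" for y
    using that Suc.prems
    by (intro bounded_linear.has_derivative[OF assms(2)]) (auto simp: frechet_derivative_works)
  have "higher_differentiable_on k S (dir_deriv (\<lambda>x. L (f x)) v)" for v
  proof (rule higher_differentiable_on_cong[OF assms(1)])
    show "higher_differentiable_on k S (\<lambda>y. L (dir_deriv f v y))" using Suc by auto
    show "L (dir_deriv f v y) = dir_deriv (\<lambda>x. L (f x)) v y" if "y \<in> S" for y
      using frechet_derivative_at[OF der[OF that]] by metis
  qed
  then show ?case using der by (auto simp: differentiable_def)
qed

lemma higher_differentiable_on_id: "open S \<Longrightarrow> higher_differentiable_on k S (\<lambda>x. x)"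
proof (cases k)
  case (Suc n)
  assume "open S"
  then show ?thesis using Suc higher_differentiable_on_const[of n S]
    by (auto simp: frechet_derivative_ident)
qed auto

lemma higher_differentiable_on_linear:
  "open S \<Longrightarrow> bounded_linear L \<Longrightarrow> higher_differentiable_on k S L"
  using higher_differentiable_on_bounded_linear[OF _ _ higher_differentiable_on_id] by blast

lemma higher_differentiable_on_sum:
  assumes "open S" "\<And>i. i \<in> I \<Longrightarrow> higher_differentiable_on k S (f i)"
  shows "higher_differentiable_on k S (\<lambda>x. \<Sum>i\<in>I. f i x)"
  using assms(2)
  by (induction I rule: infinite_finite_induct)
     (auto simp: higher_differentiable_on_const intro!: higher_differentiable_on_add[OF assms(1)])

lemma higher_differentiable_on_Pair:
  assumes "open S" "higher_differentiable_on k S f" "higher_differentiable_on k S g"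
  shows "higher_differentiable_on k S (\<lambda>x. (f x, g x))"
proof -
  have "higher_differentiable_on k S (\<lambda>x. (f x, 0) + (0, g x))"
    by (intro higher_differentiable_on_add assms
        higher_differentiable_on_bounded_linear[where L="\<lambda>y. (y, 0)"]
        higher_differentiable_on_bounded_linear[where L="\<lambda>y. (0, y)"]
        bounded_linear_Pair bounded_linear_ident bounded_linear_zero)
  then show ?thesis by simp
qed

lemma frechet_derivative_coord_sum:
  fixes f :: "'a::finite_dim_normed \<Rightarrow> 'b::real_normed_vector"
  assumes "f differentiable (at x)"
  shows "dir_deriv f v x = (\<Sum>b\<in>std_basis. coord b v *\<^sub>R dir_deriv f b x)"
proof -
  have lin: "linear (frechet_derivative f (at x))"
    using assms linear_frechet_derivative by blast
  have "dir_deriv f v x = dir_deriv f (\<Sum>b\<in>std_basis. coord b v *\<^sub>R b) x" by (simp add: coord_sum)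
  also have "\<dots> = (\<Sum>b\<in>std_basis. coord b v *\<^sub>R dir_deriv f b x)"
    by (simp add: linear_sum[OF lin] linear_scale[OF lin])
  finally show ?thesis .
qed

text \<open>Expanding the chain rule in coordinates of the intermediate space reduces the derivative
  of a composite to sums of products of maps of one order less.\<close>

lemma higher_differentiable_on_compose:
  fixes f :: "'a::finite_dim_normed \<Rightarrow> 'b::real_normed_vector"
    and g :: "'c::real_normed_vector \<Rightarrow> 'a"
  assumes "open S" "open T" "g ` S \<subseteq> T"
    and "higher_differentiable_on k T f" "higher_differentiable_on k S g"
  shows "higher_differentiable_on k S (\<lambda>x. f (g x))"
  using assms(4,5)
proof (induction k arbitrary: f)
  case 0
  then show ?case using assms(3) by (auto intro: continuous_on_compose2)
next
  case (Suc k)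
  have der: "((\<lambda>x. f (g x)) has_derivative (\<lambda>v. dir_deriv f (dir_deriv g v y) (g y))) (at y)" if "y \<in> S" for y
  proof -
    have "(g has_derivative frechet_derivative g (at y)) (at y)"
      using Suc.prems that by (auto simp: frechet_derivative_works)
    moreover have "(f has_derivative frechet_derivative f (at (g y))) (at (g y))"
      using Suc.prems that assms(3) by (auto simp: frechet_derivative_works)
    ultimately show ?thesis using diff_chain_at by (fastforce simp: comp_def)
  qed
  have "higher_differentiable_on k S (dir_deriv (\<lambda>x. f (g x)) v)" for v
  proof (rule higher_differentiable_on_cong[OF assms(1)])
    show "higher_differentiable_on k S (\<lambda>y. \<Sum>b\<in>std_basis. coord b (dir_deriv g v y) *\<^sub>R dir_deriv f b (g y))"
    proof (intro higher_differentiable_on_sum higher_differentiable_on_scaleR assms(1)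
          higher_differentiable_on_bounded_linear[OF assms(1) bounded_linear_coord])
      show "higher_differentiable_on k S (dir_deriv g v)" using Suc.prems by simp
      show "higher_differentiable_on k S (\<lambda>y. dir_deriv f b (g y))" for b
        using Suc.prems higher_differentiable_on_SucD by (intro Suc.IH) auto
    qed
    show "(\<Sum>b\<in>std_basis. coord b (dir_deriv g v y) *\<^sub>R dir_deriv f b (g y)) = dir_deriv (\<lambda>x. f (g x)) v y"
      if "y \<in> S" for y
    proof -
      have "f differentiable (at (g y))" using Suc.prems assms(3) that by auto
      then show ?thesis
        using frechet_derivative_at[OF der[OF that]]
          frechet_derivative_coord_sum[of f "g y" "dir_deriv g v y"] by metis
    qed
  qed
  then show ?case using der by (auto simp: differentiable_def)
qed

lemma smooth_on_cong:
  assumes "open S" "\<And>y. y \<in> S \<Longrightarrow> f y = g y" "smooth_on S f"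
  shows "smooth_on S g"
  using assms(3) higher_differentiable_on_cong[OF assms(1,2)] by (simp add: smooth_on_def)

lemma smooth_on_subset: "smooth_on S f \<Longrightarrow> T \<subseteq> S \<Longrightarrow> smooth_on T f"
  by (auto simp: smooth_on_def intro: higher_differentiable_on_subset)

lemma smooth_on_local:
  assumes "\<And>x. x \<in> S \<Longrightarrow> \<exists>T. open T \<and> x \<in> T \<and> smooth_on T f"
  shows "smooth_on S f"
  unfolding smooth_on_def
proof (intro allI higher_differentiable_on_local)
  fix k x assume "x \<in> S"
  then show "\<exists>T. open T \<and> x \<in> T \<and> higher_differentiable_on k T f"
    using assms[of x] by (auto simp: smooth_on_def)
qed

lemma smooth_on_compose:
  fixes f :: "'a::finite_dim_normed \<Rightarrow> 'b::real_normed_vector"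
  assumes "open S" "open T" "g ` S \<subseteq> T" "smooth_on T f" "smooth_on S g"
  shows "smooth_on S (\<lambda>x. f (g x))"
  using assms(4,5) by (auto simp: smooth_on_def intro: higher_differentiable_on_compose[OF assms(1-3)])

lemma smooth_on_Pair:
  "open S \<Longrightarrow> smooth_on S f \<Longrightarrow> smooth_on S g \<Longrightarrow> smooth_on S (\<lambda>x. (f x, g x))"
  by (simp add: smooth_on_def higher_differentiable_on_Pair)

lemma smooth_on_const: "smooth_on S (\<lambda>x. c)"
  by (simp add: smooth_on_def higher_differentiable_on_const)

lemma smooth_on_id: "open S \<Longrightarrow> smooth_on S (\<lambda>x. x)"
  by (simp add: smooth_on_def higher_differentiable_on_id)

lemma smooth_on_add: "open S \<Longrightarrow> smooth_on S f \<Longrightarrow> smooth_on S g \<Longrightarrow> smooth_on S (\<lambda>x. f x + g x)"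
  by (simp add: smooth_on_def higher_differentiable_on_add)

lemma smooth_on_linear: "open S \<Longrightarrow> bounded_linear L \<Longrightarrow> smooth_on S L"
  by (simp add: smooth_on_def higher_differentiable_on_linear)

lemma smooth_on_continuous: "smooth_on S f \<Longrightarrow> continuous_on S f"
  by (auto simp: smooth_on_def intro: higher_differentiable_on_continuous)

lemma smooth_on_differentiable:
  assumes "smooth_on S f" "x \<in> S"
  shows "f differentiable (at x)"
proof -
  have "higher_differentiable_on (Suc 0) S f" using assms(1) by (simp only: smooth_on_def)
  then show ?thesis using assms(2) by simp
qed

lemma smooth_on_has_derivative:
  "smooth_on S f \<Longrightarrow> x \<in> S \<Longrightarrow> (f has_derivative frechet_derivative f (at x)) (at x)"
  using smooth_on_differentiable frechet_derivative_works by blast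

lemma smooth_on_derivative:
  assumes "smooth_on S f"
  shows "smooth_on S (dir_deriv f v)"
  unfolding smooth_on_def
proof
  fix k
  have "higher_differentiable_on (Suc k) S f" using assms by (simp only: smooth_on_def)
  then show "higher_differentiable_on k S (dir_deriv f v)" by simp
qed

text \<open>The partial derivatives are bounded on a compact ball.\<close>

lemma smooth_on_locally_lipschitz:
  fixes f :: "'a::finite_dim_normed \<Rightarrow> 'b::real_normed_vector"
  assumes "open S" "smooth_on S f" "x \<in> S"
  obtains r K where "r > 0" "K > 0" "cball x r \<subseteq> S"
    "\<And>y z. y \<in> cball x r \<Longrightarrow> z \<in> cball x r \<Longrightarrow> norm (f y - f z) \<le> K * norm (y - z)"
proof -
  obtain r where r: "r > 0" "cball x r \<subseteq> S"
    using assms(1,3) open_contains_cball by blast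
  have "\<exists>M. \<forall>y\<in>cball x r. norm (dir_deriv f b y) \<le> M" for b
  proof -
    have "continuous_on (cball x r) (dir_deriv f b)"
      using smooth_on_continuous[OF smooth_on_derivative[OF assms(2)]] r(2) continuous_on_subset by blast
    then have "compact (dir_deriv f b ` cball x r)"
      using compact_continuous_image[OF _ compact_cball] by blast
    then have "bounded (dir_deriv f b ` cball x r)" by (rule compact_imp_bounded)
    then show ?thesis by (auto simp: bounded_iff)
  qed
  then obtain M where M: "\<And>b y. y \<in> cball x r \<Longrightarrow> norm (dir_deriv f b y) \<le> M b" by metis
  have "\<exists>c>0. \<forall>v. norm (coord b v) \<le> norm v * c" for b :: 'a
    using bounded_linear.pos_bounded[OF bounded_linear_coord] by blast
  then obtain c where c: "\<And>b. c b > 0" "\<And>b v :: 'a. norm (coord b v) \<le> norm v * c b" by metis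
  define K where "K = (\<Sum>b\<in>std_basis. c b * \<bar>M b\<bar>) + 1"
  have K: "K > 0" unfolding K_def
    using c(1) by (intro add_nonneg_pos sum_nonneg mult_nonneg_nonneg) (auto intro: less_imp_le)
  have on: "onorm (frechet_derivative f (at y)) \<le> K" if y: "y \<in> cball x r" for y
  proof (rule onorm_bound)
    fix v
    have "f differentiable (at y)" using smooth_on_differentiable assms(2) r(2) y by blast
    then have "norm (dir_deriv f v y) = norm (\<Sum>b\<in>std_basis. coord b v *\<^sub>R dir_deriv f b y)"
      using frechet_derivative_coord_sum by metis
    also have "\<dots> \<le> (\<Sum>b\<in>std_basis. norm v * c b * \<bar>M b\<bar>)"
    proof (rule sum_norm_le)
      fix b :: 'a
      have "norm (coord b v *\<^sub>R dir_deriv f b y) \<le> (norm v * c b) * \<bar>M b\<bar>"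
        unfolding norm_scaleR real_norm_def[symmetric]
        using c(2)[of b v] c(1)[of b] M[OF y, of b] by (intro mult_mono) auto
      then show "norm (coord b v *\<^sub>R dir_deriv f b y) \<le> norm v * c b * \<bar>M b\<bar>" .
    qed
    also have "\<dots> \<le> K * norm v"
      unfolding K_def by (simp add: algebra_simps sum_distrib_left)
    finally show "norm (dir_deriv f v y) \<le> K * norm v" .
  qed (use K in simp)
  show ?thesis
  proof (rule that[OF r(1) K r(2)])
    fix y z assume yz: "y \<in> cball x r" "z \<in> cball x r"
    show "norm (f y - f z) \<le> K * norm (y - z)"
    proof (rule differentiable_bound[OF convex_cball _ on yz])
      fix u assume "u \<in> cball x r"
      then show "(f has_derivative frechet_derivative f (at u)) (at u within cball x r)"
        using smooth_on_has_derivative[OF assms(2)] r(2) has_derivative_at_withinI by blast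
    qed
  qed
qed

section \<open>Ordinary differential equations with Lipschitz right-hand side\<close>

lemma norm_le_of_derivative_bound:
  fixes u :: "real \<Rightarrow> 'a::real_normed_vector"
  assumes "\<And>t. t \<in> {-a..a} \<Longrightarrow> (u has_vector_derivative u' t) (at t within {-a..a})"
    and "\<And>t. t \<in> {-a..a} \<Longrightarrow> norm (u' t) \<le> B" and "u 0 = 0" and "t \<in> {-a..a}"
  shows "norm (u t) \<le> B * \<bar>t\<bar>"
proof -
  have 0: "0 \<in> {-a..a}" using assms(4) by auto
  have "norm (u t - u 0) \<le> B * norm (t - 0)"
  proof (rule differentiable_bound[of "{-a..a}" u "\<lambda>t h. h *\<^sub>R u' t"])
    fix s assume s: "s \<in> {-a..a}"
    show "(u has_derivative (\<lambda>h. h *\<^sub>R u' s)) (at s within {-a..a})"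
      using assms(1)[OF s] by (simp add: has_vector_derivative_def)
    show "onorm (\<lambda>h. h *\<^sub>R u' s) \<le> B"
    proof (rule onorm_bound)
      show "0 \<le> B" using assms(2)[OF s] norm_ge_zero[of "u' s"] by linarith
      show "norm (h *\<^sub>R u' s) \<le> B * norm h" for h :: real
        using mult_left_mono[OF assms(2)[OF s], of "\<bar>h\<bar>"] by (simp add: mult.commute)
    qed
  qed (use assms(4) 0 in auto)
  then show ?thesis using assms(3) by simp
qed

text \<open>The integral operator is a contraction on the bounded continuous functions from the whole line
  into the ball, where times outside \<open>[-a, a]\<close> are clamped.\<close>

lemma picard_local_solution:
  fixes F :: "'a::banach \<Rightarrow> 'a"
  assumes r: "r > 0" and K: "K > 0"
    and lip: "\<And>y z. y \<in> cball y0 r \<Longrightarrow> z \<in> cball y0 r \<Longrightarrow> norm (F y - F z) \<le> K * norm (y - z)"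
  obtains a y where "a > 0" "y 0 = y0" "\<And>t. t \<in> {-a..a} \<Longrightarrow> y t \<in> cball y0 r"
    "\<And>t. t \<in> {-a<..<a} \<Longrightarrow> (y has_vector_derivative F (y t)) (at t)"
proof -
  define M where "M = norm (F y0) + K * r + 1"
  have M: "M > 0" unfolding M_def using r K by (intro add_nonneg_pos add_nonneg_nonneg) auto
  have FM: "norm (F y) \<le> M" if "y \<in> cball y0 r" for y
  proof -
    have "norm (F y) \<le> norm (F y0) + norm (F y - F y0)" by (metis add.commute diff_add_cancel norm_triangle_ineq)
    also have "norm (F y - F y0) \<le> K * norm (y - y0)" using lip[OF that] r by simp
    also have "K * norm (y - y0) \<le> K * r" using that K by (simp add: dist_norm norm_minus_commute)
    finally show ?thesis unfolding M_def by simp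
  qed
  \<comment> \<open>the first bound keeps solutions in the ball, the second makes the operator a contraction\<close>
  define a where "a = min (r / M) (1 / (2 * K))"
  have a: "a > 0" "M * a \<le> r" "K * a \<le> 1/2"
    using r K M by (auto simp: a_def min_def field_simps)
  have contF: "continuous_on (cball y0 r) F"
  proof (rule continuous_on_iff[THEN iffD2], intro ballI allI impI)
    fix x and e :: real assume x: "x \<in> cball y0 r" and e: "e > 0"
    show "\<exists>d>0. \<forall>x'\<in>cball y0 r. dist x' x < d \<longrightarrow> dist (F x') (F x) < e"
    proof (intro exI[of _ "e / K"] conjI ballI impI)
      fix x' assume x': "x' \<in> cball y0 r" "dist x' x < e / K"
      have "dist (F x') (F x) \<le> K * dist x' x" using lip[OF x'(1) x] by (simp add: dist_norm)
      also have "\<dots> < e" using x'(2) K by (simp add: field_simps)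
      finally show "dist (F x') (F x) < e" .
    qed (use e K in auto)
  qed
  \<comment> \<open>the integral from 0 to \<open>t\<close>, for \<open>t\<close> of either sign\<close>
  define I where "I \<phi> t = integral {-a..t} (\<lambda>s. F (\<phi> s)) - integral {-a..0} (\<lambda>s. F (\<phi> s))"
    for \<phi> :: "real \<Rightarrow> 'a" and t
  have I_der: "(I \<phi> has_vector_derivative F (\<phi> t)) (at t within {-a..a})"
    if "continuous_on {-a..a} \<phi>" "\<And>s. \<phi> s \<in> cball y0 r" "t \<in> {-a..a}" for \<phi> t
  proof -
    have "continuous_on {-a..a} (\<lambda>s. F (\<phi> s))"
      using continuous_on_compose2[OF contF that(1)] that(2) by blast
    from integral_has_vector_derivative[OF this that(3)]
    show ?thesis unfolding I_def by (rule has_vector_derivative_diff_const[THEN iffD2])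
  qed
  have I0: "I \<phi> 0 = 0" for \<phi> by (simp add: I_def)
  define cl where "cl t = max (-a) (min a t)" for t :: real
  have cl: "cl t \<in> {-a..a}" "\<bar>cl t\<bar> \<le> a" for t using a by (auto simp: cl_def)
  have cl_id: "t \<in> {-a..a} \<Longrightarrow> cl t = t" for t by (auto simp: cl_def)
  have cont_cl: "continuous_on UNIV cl" unfolding cl_def by (intro continuous_intros)
  define S :: "(real \<Rightarrow>\<^sub>C 'a) set" where "S = PiC UNIV (\<lambda>_. cball y0 r)"
  have S_iff: "\<phi> \<in> S \<longleftrightarrow> (\<forall>t. apply_bcontfun \<phi> t \<in> cball y0 r)" for \<phi>
    by (auto simp: S_def mem_PiC_iff)
  have S_der: "(I (apply_bcontfun \<phi>) has_vector_derivative F (apply_bcontfun \<phi> t)) (at t within {-a..a})"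
    if "\<phi> \<in> S" "t \<in> {-a..a}" for \<phi> t
    using that(1) by (intro I_der that(2)) (simp_all add: S_iff del: mem_cball)
  define Q where "Q \<phi> t = y0 + I (apply_bcontfun \<phi>) (cl t)" for \<phi> t
  have Q_ball: "Q \<phi> t \<in> cball y0 r" if "\<phi> \<in> S" for \<phi> t
  proof -
    have "norm (I (apply_bcontfun \<phi>) (cl t)) \<le> M * \<bar>cl t\<bar>"
    proof (rule norm_le_of_derivative_bound[OF S_der[OF that] _ I0 cl(1)])
      show "norm (F (apply_bcontfun \<phi> t)) \<le> M" for t using FM that S_iff by blast
    qed
    also have "\<dots> \<le> M * a" using cl M by simp
    finally show ?thesis using a(2) by (simp add: Q_def dist_norm)
  qed
  have Q_cont: "continuous_on UNIV (Q \<phi>)" if "\<phi> \<in> S" for \<phi>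
  proof -
    have "continuous_on {-a..a} (I (apply_bcontfun \<phi>))"
      by (rule continuous_on_vector_derivative[OF S_der[OF that]])
    from continuous_on_compose2[OF this cont_cl] show ?thesis
      unfolding Q_def using cl(1) by (intro continuous_on_add continuous_on_const) blast
  qed
  have Q_bc: "Q \<phi> \<in> bcontfun" if "\<phi> \<in> S" for \<phi>
  proof -
    have "bounded (range (Q \<phi>))"
      using Q_ball[OF that] by (intro bounded_subset[OF bounded_cball[of y0 r]]) blast
    then show ?thesis using Q_cont[OF that] by (simp add: bcontfun_def)
  qed
  define P where "P \<phi> = Bcontfun (Q \<phi>)" for \<phi>
  have P_app: "apply_bcontfun (P \<phi>) = Q \<phi>" if "\<phi> \<in> S" for \<phi>
    unfolding P_def using Q_bc[OF that] by (simp add: Bcontfun_inverse)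
  have "\<exists>!\<phi>\<in>S. P \<phi> = \<phi>"
  proof (rule Banach_fix[where c="1/2"])
    have "closed S" unfolding S_def by (intro closed_PiC) auto
    then show "complete S" by (simp add: complete_eq_closed)
    have "const_bcontfun y0 \<in> S" using r by (simp add: S_iff const_bcontfun.rep_eq)
    then show "S \<noteq> {}" by blast
    show "P ` S \<subseteq> S"
    proof
      fix f assume "f \<in> P ` S"
      then obtain \<phi> where "\<phi> \<in> S" "f = P \<phi>" by blast
      then show "f \<in> S" using Q_ball by (simp add: S_iff[of "P _"] P_app del: mem_cball)
    qed
    fix \<phi> \<psi> assume \<phi>: "\<phi> \<in> S" and \<psi>: "\<psi> \<in> S"
    show "dist (P \<phi>) (P \<psi>) \<le> 1/2 * dist \<phi> \<psi>"
    proof (rule dist_bound)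
      fix t
      have "norm (I (apply_bcontfun \<phi>) (cl t) - I (apply_bcontfun \<psi>) (cl t)) \<le> (K * dist \<phi> \<psi>) * \<bar>cl t\<bar>"
      proof (rule norm_le_of_derivative_bound[where u="\<lambda>t. I (apply_bcontfun \<phi>) t - I (apply_bcontfun \<psi>) t"])
        fix t assume t: "t \<in> {-a..a}"
        show "((\<lambda>t. I (apply_bcontfun \<phi>) t - I (apply_bcontfun \<psi>) t) has_vector_derivative
            F (apply_bcontfun \<phi> t) - F (apply_bcontfun \<psi> t)) (at t within {-a..a})"
          by (intro has_vector_derivative_diff S_der \<phi> \<psi> t)
        have "norm (F (apply_bcontfun \<phi> t) - F (apply_bcontfun \<psi> t))
            \<le> K * norm (apply_bcontfun \<phi> t - apply_bcontfun \<psi> t)"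
          using \<phi> \<psi> by (intro lip) (simp_all add: S_iff del: mem_cball)
        also have "\<dots> \<le> K * dist \<phi> \<psi>"
          using K dist_bounded[of \<phi> t \<psi>] by (simp add: dist_norm)
        finally show "norm (F (apply_bcontfun \<phi> t) - F (apply_bcontfun \<psi> t)) \<le> K * dist \<phi> \<psi>" .
      qed (simp_all add: cl I0 del: atLeastAtMost_iff)
      also have "\<dots> \<le> (K * dist \<phi> \<psi>) * a" using cl K by (intro mult_left_mono) auto
      also have "\<dots> = (K * a) * dist \<phi> \<psi>" by simp
      also have "\<dots> \<le> 1/2 * dist \<phi> \<psi>" using a(3) by (intro mult_right_mono) auto
      finally show "dist (apply_bcontfun (P \<phi>) t) (apply_bcontfun (P \<psi>) t) \<le> 1/2 * dist \<phi> \<psi>"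
        using \<phi> \<psi> by (simp add: P_app Q_def dist_norm)
    qed
  qed auto
  then obtain \<phi> where \<phi>: "\<phi> \<in> S" "P \<phi> = \<phi>" by (elim ex1E conjE)
  define y where "y = apply_bcontfun \<phi>"
  have y_eq: "y t = y0 + I y (cl t)" for t
    using P_app[OF \<phi>(1)] unfolding \<phi>(2) by (simp add: y_def Q_def fun_eq_iff)
  have yball: "y t \<in> cball y0 r" for t using \<phi>(1) by (auto simp: S_iff y_def simp del: mem_cball)
  have ycont: "continuous_on T y" for T by (simp add: y_def)
  show ?thesis
  proof (rule that[OF a(1)])
    show "y 0 = y0" using y_eq[of 0] a by (simp add: cl_id I0)
    show "y t \<in> cball y0 r" for t by (rule yball)
    fix t assume t: "t \<in> {-a<..<a}"
    have "(I y has_vector_derivative F (y t)) (at t within {-a..a})"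
      using t by (intro I_der ycont yball) auto
    then have "(I y has_vector_derivative F (y t)) (at t within {-a<..<a})"
      by (rule has_vector_derivative_within_subset) auto
    then have "((\<lambda>t. y0 + I y t) has_vector_derivative F (y t)) (at t within {-a<..<a})"
      by (auto intro!: derivative_eq_intros)
    then have "(y has_vector_derivative F (y t)) (at t within {-a<..<a})"
      by (rule has_vector_derivative_transform[OF t, rotated])
         (use y_eq cl_id in \<open>auto simp: \<close>)
    then show "(y has_vector_derivative F (y t)) (at t)"
      using t by (simp add: at_within_open[of t "{-a<..<a}"])
  qed
qed

text \<open>If \<open>S\<close> is the maximal distance of the two solutions on \<open>[-a, a]\<close>, then their difference has
  derivative at most \<open>K S\<close> and vanishes at \<open>0\<close>, so \<open>S \<le> K a S\<close>.\<close>

lemma ode_local_uniqueness: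
  fixes y z :: "real \<Rightarrow> 'a::real_normed_vector"
  assumes lip: "\<And>y z. y \<in> D \<Longrightarrow> z \<in> D \<Longrightarrow> norm (F y - F z) \<le> K * norm (y - z)"
    and a: "K * a < 1" and K: "K > 0"
    and y: "\<And>t. t \<in> {-a..a} \<Longrightarrow> y t \<in> D \<and> (y has_vector_derivative F (y t)) (at t)"
    and z: "\<And>t. t \<in> {-a..a} \<Longrightarrow> z t \<in> D \<and> (z has_vector_derivative F (z t)) (at t)"
    and init: "y 0 = z 0" and t: "t \<in> {-a..a}"
  shows "y t = z t"
proof -
  let ?d = "\<lambda>t. norm (y t - z t)"
  have der: "((\<lambda>t. y t - z t) has_vector_derivative F (y t) - F (z t)) (at t within {-a..a})"
    if "t \<in> {-a..a}" for t
    using y[OF that] z[OF that]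
    by (intro has_vector_derivative_diff) (auto intro: has_vector_derivative_at_within)
  have "continuous_on {-a..a} ?d"
    by (intro continuous_intros continuous_on_vector_derivative[OF der])
  moreover have "{-a..a} \<noteq> {}" using t by auto
  ultimately obtain m where m: "m \<in> {-a..a}" "\<And>s. s \<in> {-a..a} \<Longrightarrow> ?d s \<le> ?d m"
    using continuous_attains_sup[of "{-a..a}" ?d] by auto
  have "?d m \<le> (K * ?d m) * \<bar>m\<bar>"
  proof (rule norm_le_of_derivative_bound[OF der])
    fix s assume s: "s \<in> {-a..a}"
    have "norm (F (y s) - F (z s)) \<le> K * ?d s" using lip y[OF s] z[OF s] by blast
    also have "\<dots> \<le> K * ?d m" using m(2)[OF s] K by simp
    finally show "norm (F (y s) - F (z s)) \<le> K * ?d m" .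
  qed (use m init in auto)
  also have "\<dots> \<le> (K * ?d m) * a" using m(1) K by (intro mult_left_mono) auto
  finally have "?d m * (1 - K * a) \<le> 0" by (simp add: algebra_simps)
  then have "?d m \<le> 0" using a by (simp add: mult_le_0_iff)
  then show ?thesis using m(2)[OF t] by simp
qed

text \<open>If \<open>y\<close> is \<open>k\<close> times differentiable, then so is \<open>F \<circ> y\<close>, which is the derivative of \<open>y\<close>.\<close>

lemma ode_solution_smooth:
  fixes F :: "'a::finite_dim_normed \<Rightarrow> 'a"
  assumes "open I" "open T" "y ` I \<subseteq> T" "smooth_on T F"
    and der: "\<And>t. t \<in> I \<Longrightarrow> (y has_vector_derivative F (y t)) (at t)"
  shows "smooth_on I y"
proof -
  have "higher_differentiable_on k I y" for k
  proof (induction k)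
    case 0
    have "isCont y t" if "t \<in> I" for t
      using has_vector_derivative_continuous[OF der[OF that]] .
    then show ?case by (simp add: continuous_at_imp_continuous_on)
  next
    case (Suc k)
    have d: "(y has_derivative (\<lambda>h. h *\<^sub>R F (y t))) (at t)" if "t \<in> I" for t
      using der[OF that] by (simp add: has_vector_derivative_def)
    have "higher_differentiable_on k I (dir_deriv y v)" for v
    proof (rule higher_differentiable_on_cong[OF assms(1)])
      have "higher_differentiable_on k T F" using assms(4) by (simp add: smooth_on_def)
      from higher_differentiable_on_compose[OF assms(1-3) this Suc]
      show "higher_differentiable_on k I (\<lambda>t. v *\<^sub>R F (y t))"
        by (rule higher_differentiable_on_scaleR[OF assms(1) higher_differentiable_on_const])
      show "v *\<^sub>R F (y t) = dir_deriv y v t" if "t \<in> I" for t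
        using frechet_derivative_at[OF d[OF that]] by metis
    qed
    then show ?case using d by (auto simp: differentiable_def)
  qed
  then show ?thesis by (simp add: smooth_on_def)
qed

section \<open>Lebesgue measure and Gram determinants in coordinates\<close>

lemma of_vec_borel: "of_vec \<in> borel_measurable borel"
  by (intro borel_measurable_continuous_onI bounded_linear.continuous_on[OF bounded_linear_of_vec] continuous_on_id)

lemma prod_Basis_cart:
  fixes h :: "real ^ 'n \<Rightarrow> 'b::comm_monoid_mult"
  shows "(\<Prod>b\<in>Basis. h b) = (\<Prod>i\<in>UNIV. h (axis i 1))"
proof -
  have 1: "(Basis :: (real ^ 'n) set) = range (\<lambda>i. axis i 1)" by (auto simp: Basis_vec_def)
  have 2: "inj (\<lambda>i :: 'n. axis i (1::real))" by (auto simp: inj_def axis_eq_axis)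
  show ?thesis unfolding 1 using prod.reindex[OF 2, of h] by simp
qed

text \<open>Both sides are images of the product of Lebesgue measures over the standard basis, and the measure
  of boxes identifies the intermediate image with the Lebesgue measure of the Euclidean space.\<close>

lemma std_lborel_eq_distr:
  assumes ne: "(std_basis :: 'e::finite_dim_normed set) \<noteq> {}"
  shows "(std_lborel :: 'e measure) = distr lborel borel of_vec"
proof -
  define P where "P = (\<Pi>\<^sub>M b\<in>(std_basis :: 'e set). (lborel :: real measure))"
  define w where "w c = (\<chi> i. c (basis_elem i))" for c :: "'e \<Rightarrow> real"
  have be: "basis_elem i \<in> (std_basis :: 'e set)" for i
    using range_basis_elem[OF ne] by blast
  interpret product_sigma_finite "\<lambda>b :: 'e. lborel :: real measure"
    by standard
  have w: "w \<in> measurable P borel"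
  proof (subst borel_measurable_euclidean_space, intro ballI)
    fix b :: "real ^ 'e basis_index" assume "b \<in> Basis"
    then obtain i where b: "b = axis i 1" by (auto simp: Basis_vec_def)
    have "(\<lambda>c. c (basis_elem i)) \<in> borel_measurable P"
      using measurable_component_singleton[OF be[of i], of "\<lambda>_. lborel :: real measure"] unfolding P_def
      by simp
    then show "(\<lambda>c. w c \<bullet> b) \<in> borel_measurable P" by (simp add: b inner_axis w_def)
  qed
  have "lborel = distr P borel w"
  proof (rule lborel_eqI)
    fix l u :: "real ^ 'e basis_index" assume lu: "\<And>b. b \<in> Basis \<Longrightarrow> l \<bullet> b \<le> u \<bullet> b"
    have lu': "l $ i \<le> u $ i" for i using lu[of "axis i 1"] by (simp add: inner_axis axis_in_Basis_iff)
    define j where "j = inv_into UNIV (basis_elem :: 'e basis_index \<Rightarrow> 'e)"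
    have j: "j (basis_elem i) = i" for i unfolding j_def by (simp add: inj_basis_elem)
    have vim: "w -` box l u \<inter> space P = (\<Pi>\<^sub>E b\<in>std_basis. {l $ j b <..< u $ j b})"
    proof -
      have "w c \<in> box l u \<longleftrightarrow> (\<forall>b\<in>std_basis. c b \<in> {l $ j b <..< u $ j b})" for c
        unfolding mem_box_cart w_def range_basis_elem[OF ne, symmetric] by (auto simp: j)
      then show ?thesis by (auto simp: P_def space_PiM PiE_iff)
    qed
    have "emeasure (distr P borel w) (box l u) = emeasure P (\<Pi>\<^sub>E b\<in>std_basis. {l $ j b <..< u $ j b})"
      using w by (simp add: emeasure_distr vim)
    also have "\<dots> = (\<Prod>b\<in>std_basis. emeasure lborel {l $ j b <..< u $ j b})"
      unfolding P_def by (rule emeasure_PiM) (auto simp: std_basis)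
    also have "\<dots> = (\<Prod>i\<in>UNIV. emeasure lborel {l $ i <..< u $ i})"
      using prod.reindex[OF inj_basis_elem, of "\<lambda>b. emeasure lborel {l $ j b <..< u $ j b}"]
      by (simp add: range_basis_elem[OF ne] j)
    also have "\<dots> = (\<Prod>b\<in>Basis. (u - l) \<bullet> b)"
      using lu' by (simp add: prod_ennreal prod_Basis_cart inner_axis)
    finally show "emeasure (distr P borel w) (box l u) = ennreal (\<Prod>b\<in>Basis. (u - l) \<bullet> b)" .
  qed simp
  moreover have "std_lborel = distr P borel (of_vec \<circ> w)"
  proof -
    have "(\<Sum>b\<in>std_basis. c b *\<^sub>R b) = (of_vec \<circ> w) c" for c
      using sum_basis_elem[OF ne, of "\<lambda>b. c b *\<^sub>R b"] by (simp add: of_vec_def w_def)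
    then show ?thesis unfolding std_lborel_def P_def by (simp add: comp_def)
  qed
  moreover have "distr (distr P borel w) borel of_vec = distr P borel (of_vec \<circ> w)"
    by (rule distr_distr[OF of_vec_borel w])
  ultimately show ?thesis by simp
qed

lemma sets_std_lborel [simp]: "sets std_lborel = sets borel"
  by (simp add: std_lborel_def)

lemma nn_integral_std_lborel:
  assumes "(std_basis :: 'e::finite_dim_normed set) \<noteq> {}" "f \<in> borel_measurable borel"
  shows "(\<integral>\<^sup>+y. f y \<partial>(std_lborel :: 'e measure)) = (\<integral>\<^sup>+c. f (of_vec c) \<partial>lborel)"
  unfolding std_lborel_eq_distr[OF assms(1)]
  by (subst nn_integral_distr) (use assms(2) of_vec_borel in \<open>auto simp: measurable_distr_eq1\<close>)

lemma emeasure_std_lborel_open_pos: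
  fixes T :: "'e::finite_dim_normed set"
  assumes "(std_basis :: 'e set) \<noteq> {}" "open T" "T \<noteq> {}"
  shows "emeasure std_lborel T \<noteq> 0"
proof -
  have op: "open (of_vec -` T)"
    by (rule open_vimage[OF assms(2) linear_continuous_on[OF bounded_linear_of_vec]])
  obtain y where "y \<in> T" using assms(3) by blast
  then have "to_vec y \<in> of_vec -` T" by (simp add: of_vec_to_vec)
  then have "of_vec -` T \<noteq> {}" by blast
  then have nn: "\<not> negligible (of_vec -` T)" using open_not_negligible[OF op] by simp
  have "emeasure lborel (of_vec -` T) \<noteq> 0"
  proof
    assume "emeasure lborel (of_vec -` T) = 0"
    then have "of_vec -` T \<in> null_sets lborel" using op by (intro null_setsI) auto
    from null_sets_completionI[OF this] show False using nn by (simp add: negligible_iff_null_sets)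
  qed
  moreover have "(of_vec :: _ \<Rightarrow> 'e) \<in> measurable lborel borel" using of_vec_borel by simp
  ultimately show ?thesis
    unfolding std_lborel_eq_distr[OF assms(1)]
    using emeasure_distr[of of_vec lborel borel T] assms(2) by simp
qed

definition gram_matrix :: "('e::finite_dim_normed \<Rightarrow> 'e \<Rightarrow> real) \<Rightarrow> real ^ ('e basis_index) ^ ('e basis_index)" where
  "gram_matrix h = (\<chi> i j. h (basis_elem i) (basis_elem j))"

text \<open>Conjugation with the enumeration of the basis is a sign-preserving bijection between the
  permutations of the index type and those of the basis.\<close>

lemma gram_det_eq_det:
  fixes h :: "'e::finite_dim_normed \<Rightarrow> 'e \<Rightarrow> real"
  assumes ne: "(std_basis :: 'e set) \<noteq> {}"
  shows "gram_det h = det (gram_matrix h)"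
proof -
  let ?be = "basis_elem :: 'e basis_index \<Rightarrow> 'e"
  have bij: "bij_betw ?be UNIV std_basis"
    using inj_basis_elem range_basis_elem[OF ne] by (simp add: bij_betw_def)
  let ?m = "\<lambda>q. map_permutation UNIV ?be q"
  have m: "?m q = (\<lambda>x. if x \<in> std_basis then ?be (q (inv_into UNIV ?be x)) else x)" for q
    by (auto simp: map_permutation_def restrict_id_def range_basis_elem[OF ne])
  have m_be: "?m q (?be i) = ?be (q i)" for q i
  proof -
    have "?be i \<in> std_basis" unfolding range_basis_elem[OF ne, symmetric] by (rule rangeI)
    then show ?thesis unfolding m by (simp add: inv_into_f_f[OF inj_basis_elem])
  qed
  have bb: "bij_betw ?m {q. q permutes UNIV} {p. p permutes std_basis}"
    unfolding m by (rule bij_betw_permutations[OF bij])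
  have "gram_det h = (\<Sum>q | q permutes UNIV. of_int (sign (?m q)) * (\<Prod>b\<in>std_basis. h b (?m q b)))"
    unfolding gram_det_def by (rule sum.reindex_bij_betw[OF bb, symmetric])
  also have "\<dots> = (\<Sum>q | q permutes UNIV. of_int (sign q) * (\<Prod>i\<in>UNIV. h (?be i) (?be (q i))))"
  proof (rule sum.cong[OF refl])
    fix q assume q: "q \<in> {q :: 'e basis_index \<Rightarrow> 'e basis_index. q permutes UNIV}"
    have "sign (?m q) = sign q"
      using q by (intro sign_map_permutation inj_basis_elem) auto
    moreover have "(\<Prod>b\<in>std_basis. h b (?m q b)) = (\<Prod>i\<in>UNIV. h (?be i) (?be (q i)))"
      using prod.reindex[OF inj_basis_elem, of "\<lambda>b. h b (?m q b)"]
      by (simp add: range_basis_elem[OF ne] m_be)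
    ultimately show "of_int (sign (?m q)) * (\<Prod>b\<in>std_basis. h b (?m q b)) =
        of_int (sign q) * (\<Prod>i\<in>UNIV. h (?be i) (?be (q i)))" by simp
  qed
  also have "\<dots> = det (gram_matrix h)" by (simp add: det_def gram_matrix_def)
  finally show ?thesis .
qed

lemma bilinear_gram_matrix:
  fixes h :: "'e::finite_dim_normed \<Rightarrow> 'e \<Rightarrow> real"
  assumes "bilinear h"
  shows "h (of_vec c) (of_vec d) = (\<Sum>i\<in>UNIV. \<Sum>j\<in>UNIV. c $ i * d $ j * gram_matrix h $ i $ j)"
proof -
  have l: "linear (\<lambda>v. h v w)" and r: "linear (h v)" for v w
    using assms by (auto simp: bilinear_def)
  have "h (of_vec c) (of_vec d) = (\<Sum>i\<in>UNIV. c $ i * h (basis_elem i) (of_vec d))"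
    unfolding of_vec_def[of c] by (simp add: linear_sum[OF l] linear_scale[OF l])
  also have "\<dots> = (\<Sum>i\<in>UNIV. c $ i * (\<Sum>j\<in>UNIV. d $ j * h (basis_elem i) (basis_elem j)))"
    unfolding of_vec_def[of d] by (simp add: linear_sum[OF r] linear_scale[OF r])
  also have "\<dots> = (\<Sum>i\<in>UNIV. \<Sum>j\<in>UNIV. c $ i * d $ j * gram_matrix h $ i $ j)"
    by (simp add: gram_matrix_def sum_distrib_left mult.assoc)
  finally show ?thesis .
qed

text \<open>The absolute value of the determinant of an endomorphism.\<close>

definition abs_det :: "('e::finite_dim_normed \<Rightarrow> 'e) \<Rightarrow> real" where
  "abs_det L = \<bar>det (matrix (\<lambda>c. to_vec (L (of_vec c))))\<bar>"

text \<open>If \<open>M\<close> is the matrix of \<open>L\<close> and \<open>H\<close> that of \<open>h\<close>, then the pulled back form has the matrix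
  \<open>M\<^sup>T H M\<close>.  This identity is why the metric volume is invariant under isometries.\<close>

lemma gram_det_pullback:
  fixes h k :: "'e::finite_dim_normed \<Rightarrow> 'e \<Rightarrow> real"
  assumes ne: "(std_basis :: 'e set) \<noteq> {}" and h: "bilinear h" 
    and k: "\<And>v w. k v w = h (L v) (L w)"
  shows "sqrt \<bar>gram_det k\<bar> = abs_det L * sqrt \<bar>gram_det h\<bar>"
proof -
  let ?M = "matrix (\<lambda>c. to_vec (L (of_vec c)))"
  have col: "L (basis_elem j) = of_vec (\<chi> i. ?M $ i $ j)" for j
  proof -
    have "of_vec (axis j 1) = basis_elem j"
      by (simp add: of_vec_def axis_def if_distrib[of "\<lambda>r. r *\<^sub>R _"] cong: if_cong)
    then have "(\<chi> i. ?M $ i $ j) = to_vec (L (basis_elem j))"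
      by (simp add: matrix_def vec_eq_iff)
    then show ?thesis by (simp add: of_vec_to_vec)
  qed
  have "gram_matrix k = transpose ?M ** (gram_matrix h ** ?M)"
  proof -
    have "gram_matrix k $ p $ q = (transpose ?M ** (gram_matrix h ** ?M)) $ p $ q" for p q
    proof -
      have "gram_matrix k $ p $ q = h (L (basis_elem p)) (L (basis_elem q))"
        by (simp add: gram_matrix_def k)
      also have "\<dots> = (\<Sum>i\<in>UNIV. \<Sum>j\<in>UNIV. ?M $ i $ p * ?M $ j $ q * gram_matrix h $ i $ j)"
        unfolding col bilinear_gram_matrix[OF h] by simp
      also have "\<dots> = (\<Sum>i\<in>UNIV. ?M $ i $ p * (\<Sum>j\<in>UNIV. gram_matrix h $ i $ j * ?M $ j $ q))"
        by (simp add: sum_distrib_left mult_ac)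
      also have "\<dots> = (transpose ?M ** (gram_matrix h ** ?M)) $ p $ q"
        by (simp add: matrix_matrix_mult_def transpose_def)
      finally show ?thesis .
    qed
    then show ?thesis by (simp add: vec_eq_iff)
  qed
  then have "det (gram_matrix k) = (det ?M)\<^sup>2 * det (gram_matrix h)"
    by (simp add: det_mul power2_eq_square)
  then show ?thesis
    by (simp add: gram_det_eq_det[OF ne] abs_det_def abs_mult real_sqrt_mult)
qed

text \<open>A kernel vector of the transposed Gram matrix is orthogonal to everything.\<close>

lemma gram_det_nonzero:
  fixes h :: "'e::finite_dim_normed \<Rightarrow> 'e \<Rightarrow> real"
  assumes ne: "(std_basis :: 'e set) \<noteq> {}" and h: "bilinear h"
    and nd: "\<And>v. (\<And>w. h v w = 0) \<Longrightarrow> v = 0"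
  shows "gram_det h \<noteq> 0"
proof
  assume "gram_det h = 0"
  then have "det (transpose (gram_matrix h)) = 0" by (simp add: gram_det_eq_det[OF ne])
  then have "\<not> invertible (transpose (gram_matrix h))" by (simp add: invertible_det_nz)
  then obtain c where c: "c \<noteq> 0" "transpose (gram_matrix h) *v c = 0"
    using matrix_left_invertible_ker[of "transpose (gram_matrix h)"] invertible_left_inverse by blast
  have "h (of_vec c) w = 0" for w
  proof -
    have z: "(\<Sum>i\<in>UNIV. gram_matrix h $ i $ j * c $ i) = 0" for j
    proof -
      have "(transpose (gram_matrix h) *v c) $ j = 0" using c(2) by simp
      then show ?thesis by (simp add: matrix_vector_mult_def transpose_def)
    qed
    have "h (of_vec c) (of_vec (to_vec w))
        = (\<Sum>j\<in>UNIV. \<Sum>i\<in>UNIV. c $ i * to_vec w $ j * gram_matrix h $ i $ j)"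
      unfolding bilinear_gram_matrix[OF h] by (rule sum.swap)
    also have "\<dots> = (\<Sum>j\<in>UNIV. to_vec w $ j * (\<Sum>i\<in>UNIV. gram_matrix h $ i $ j * c $ i))"
      by (simp add: sum_distrib_left mult_ac)
    also have "\<dots> = 0" by (simp add: z)
    finally show ?thesis by (simp add: of_vec_to_vec)
  qed
  then have "of_vec c = 0" by (rule nd)
  then have "to_vec (of_vec c) = to_vec 0" by simp
  then show False using c(1) by (simp add: to_vec_of_vec[OF ne] linear_0[OF linear_to_vec])
qed

section \<open>Change of variables\<close>

text \<open>The theorem for vector-valued functions, applied to values in \<^typ>\<open>real ^ 1\<close>.\<close>

lemma change_of_variables_real:
  fixes f :: "real ^ 'n::{finite,wellorder} \<Rightarrow> real" and \<phi> :: "real ^ 'n::_ \<Rightarrow> real ^ 'n::_"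
  assumes "S \<in> sets lebesgue"
    and "\<And>x. x \<in> S \<Longrightarrow> (\<phi> has_derivative \<phi>' x) (at x within S)"
    and "inj_on \<phi> S"
  shows "(\<lambda>x. \<bar>det (matrix (\<phi>' x))\<bar> * f (\<phi> x)) absolutely_integrable_on S \<and>
           integral S (\<lambda>x. \<bar>det (matrix (\<phi>' x))\<bar> * f (\<phi> x)) = b
     \<longleftrightarrow> f absolutely_integrable_on (\<phi> ` S) \<and> integral (\<phi> ` S) f = b"
  using has_absolute_integral_change_of_variables[OF assms, of "\<lambda>x. vec (f x) :: real ^ 1" "vec b"]
  unfolding absolutely_integrable_on_1_iff integral_on_1_eq
  by (simp add: vec_eq_iff o_def)

lemma nn_integral_eq_iff_absolutely_integrable:
  fixes f :: "real ^ 'n::finite \<Rightarrow> real"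
  assumes "(\<lambda>x. indicator S x * f x) \<in> borel_measurable borel"
    and "\<And>x. x \<in> S \<Longrightarrow> 0 \<le> f x" and "0 \<le> b"
  shows "(\<integral>\<^sup>+x. ennreal (indicator S x * f x) \<partial>lborel) = ennreal b \<longleftrightarrow>
    f absolutely_integrable_on S \<and> integral S f = b"
proof -
  let ?g = "\<lambda>x. indicator S x * f x"
  have "?g \<in> borel_measurable lebesgue"
    using assms(1) by (intro measurable_completion) simp
  then have "(\<integral>\<^sup>+x. ennreal (?g x) \<partial>lborel) = ennreal b \<longleftrightarrow> integrable lebesgue ?g \<and> integral\<^sup>L lebesgue ?g = b"
    using nn_integral_eq_integrable[of ?g lebesgue b] assms(2,3)
    by (simp add: nn_integral_completion indicator_def)
  also have "\<dots> \<longleftrightarrow> f absolutely_integrable_on S \<and> integral S f = b"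
  proof (cases "f absolutely_integrable_on S")
    case True
    then show ?thesis
      using set_lebesgue_integral_eq_integral(2)[OF True]
      by (simp add: set_integrable_def set_lebesgue_integral_def)
  qed (simp add: set_integrable_def)
  finally show ?thesis .
qed

text \<open>The Euclidean theorem speaks about absolutely integrable functions.  A finite integral of a
  non-negative density is of that kind, and then so is the transformed one.\<close>

lemma nn_integral_change_of_variables:
  fixes \<psi> :: "'e::finite_dim_normed \<Rightarrow> 'e" and \<rho> \<sigma> :: "'e \<Rightarrow> real"
  assumes ne: "(std_basis :: 'e set) \<noteq> {}" and T: "T \<in> sets borel"
    and der: "\<And>y. y \<in> T \<Longrightarrow> (\<psi> has_derivative D y) (at y)" and inj: "inj_on \<psi> T"
    and mR: "(\<lambda>z. indicator (\<psi> ` T) z * \<rho> z) \<in> borel_measurable borel"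
    and mS: "(\<lambda>y. indicator T y * \<sigma> y) \<in> borel_measurable borel"
    and nonneg: "\<And>z. z \<in> \<psi> ` T \<Longrightarrow> 0 \<le> \<rho> z"
    and \<sigma>: "\<And>y. y \<in> T \<Longrightarrow> \<sigma> y = abs_det (D y) * \<rho> (\<psi> y)"
    and fin: "(\<integral>\<^sup>+z. ennreal (\<rho> z) * indicator (\<psi> ` T) z \<partial>std_lborel) \<noteq> \<infinity>"
  shows "(\<integral>\<^sup>+z. ennreal (\<rho> z) * indicator (\<psi> ` T) z \<partial>std_lborel) =
    (\<integral>\<^sup>+y. ennreal (\<sigma> y) * indicator T y \<partial>std_lborel)"
proof -
  define S where "S = of_vec -` T"
  define \<phi> where "\<phi> c = to_vec (\<psi> (of_vec c))" for c
  define \<phi>' where "\<phi>' c = (\<lambda>d. to_vec (D (of_vec c) (of_vec d)))" for c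
  have ov: "of_vec x = y \<longleftrightarrow> x = to_vec y" for x and y :: 'e
    using of_vec_to_vec to_vec_of_vec[OF ne] by metis
  have S: "S \<in> sets borel"
    using measurable_sets[OF of_vec_borel T] by (simp add: S_def)
  then have S': "S \<in> sets lebesgue" by simp
  have image: "c \<in> \<phi> ` S \<longleftrightarrow> of_vec c \<in> \<psi> ` T" for c
  proof
    assume "c \<in> \<phi> ` S"
    then show "of_vec c \<in> \<psi> ` T" by (auto simp: \<phi>_def S_def of_vec_to_vec)
  next
    assume "of_vec c \<in> \<psi> ` T"
    then obtain y where y: "y \<in> T" "of_vec c = \<psi> y" by blast
    then have "c = \<phi> (to_vec y)" "to_vec y \<in> S"
      by (auto simp: \<phi>_def S_def ov of_vec_to_vec)
    then show "c \<in> \<phi> ` S" by blast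
  qed
  have der': "(\<phi> has_derivative \<phi>' c) (at c within S)" if "c \<in> S" for c
  proof -
    have "(of_vec has_derivative of_vec) (at c)"
      using bounded_linear_imp_has_derivative[OF bounded_linear_of_vec] .
    moreover have "(\<psi> has_derivative D (of_vec c)) (at (of_vec c))"
      using der that by (simp add: S_def)
    ultimately have "((\<lambda>c. \<psi> (of_vec c)) has_derivative (\<lambda>d. D (of_vec c) (of_vec d))) (at c)"
      using diff_chain_at by (fastforce simp: comp_def)
    then have "((\<lambda>c. to_vec (\<psi> (of_vec c))) has_derivative (\<lambda>d. to_vec (D (of_vec c) (of_vec d)))) (at c)"
      by (rule bounded_linear.has_derivative[OF bounded_linear_to_vec])
    then show ?thesis unfolding \<phi>_def \<phi>'_def by (rule has_derivative_at_withinI)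
  qed
  have inj': "inj_on \<phi> S"
  proof (rule inj_onI)
    fix c d assume "c \<in> S" "d \<in> S" "\<phi> c = \<phi> d"
    then have "\<psi> (of_vec c) = \<psi> (of_vec d)" unfolding \<phi>_def by (metis of_vec_to_vec)
    then have "of_vec c = of_vec d" using inj \<open>c \<in> S\<close> \<open>d \<in> S\<close> by (auto simp: S_def inj_on_def)
    then show "c = d" by (metis to_vec_of_vec[OF ne])
  qed
  have e: "ennreal r * indicator A x = ennreal (indicator A x * r)" for r and A :: "'b set" and x
    by (simp add: indicator_def)
  define R where "R c = \<rho> (of_vec c)" for c
  define Q where "Q c = \<bar>det (matrix (\<phi>' c))\<bar> * R (\<phi> c)" for c
  have Q: "Q c = \<sigma> (of_vec c)" if "c \<in> S" for c
    using \<sigma>[of "of_vec c"] that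
    by (simp add: Q_def R_def \<phi>_def \<phi>'_def abs_det_def S_def of_vec_to_vec)
  have iR: "indicator (\<phi> ` S) c = (indicator (\<psi> ` T) (of_vec c) :: real)" for c
    using image[of c] by (simp add: indicator_def)
  have iS: "indicator S c = (indicator T (of_vec c) :: real)" for c
    by (simp add: indicator_def S_def)
  have mR': "(\<lambda>c. indicator (\<phi> ` S) c * R c) \<in> borel_measurable borel"
    using measurable_compose[OF of_vec_borel mR] by (simp add: iR R_def)
  have Q_eq: "indicator S c * Q c = indicator T (of_vec c) * \<sigma> (of_vec c)" for c
    using Q[of c] by (auto simp: indicator_def S_def)
  have mQ': "(\<lambda>c. indicator S c * Q c) \<in> borel_measurable borel"
    using measurable_compose[OF of_vec_borel mS] by (simp add: Q_eq)
  have 1: "(\<integral>\<^sup>+z. ennreal (\<rho> z) * indicator (\<psi> ` T) z \<partial>std_lborel)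
      = (\<integral>\<^sup>+c. ennreal (indicator (\<phi> ` S) c * R c) \<partial>lborel)"
    unfolding e using mR by (subst nn_integral_std_lborel[OF ne]) (simp_all add: iR R_def)
  have 2: "(\<integral>\<^sup>+y. ennreal (\<sigma> y) * indicator T y \<partial>std_lborel)
      = (\<integral>\<^sup>+c. ennreal (indicator S c * Q c) \<partial>lborel)"
    unfolding e using mS by (subst nn_integral_std_lborel[OF ne]) (simp_all add: Q_eq)
  have R0: "0 \<le> R c" if "c \<in> \<phi> ` S" for c using nonneg that by (simp add: image R_def)
  have Q0: "0 \<le> Q c" if "c \<in> S" for c unfolding Q_def using R0 that by simp
  obtain b where b: "0 \<le> b" "(\<integral>\<^sup>+c. ennreal (indicator (\<phi> ` S) c * R c) \<partial>lborel) = ennreal b"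
    using fin unfolding 1 by (cases rule: ennreal_cases) auto
  have "R absolutely_integrable_on \<phi> ` S \<and> integral (\<phi> ` S) R = b"
    using nn_integral_eq_iff_absolutely_integrable[OF mR' R0 b(1)] b(2) by simp
  then have "Q absolutely_integrable_on S \<and> integral S Q = b"
    using change_of_variables_real[OF S' der' inj', of R b] unfolding Q_def by simp
  then have "(\<integral>\<^sup>+c. ennreal (indicator S c * Q c) \<partial>lborel) = ennreal b"
    using nn_integral_eq_iff_absolutely_integrable[OF mQ' Q0 b(1)] by simp
  then show ?thesis using 1 2 b(2) by simp
qed

section \<open>Charts and differentials\<close>

context smooth_manifold
begin

lemma chart_inv_left: "c \<in> A \<Longrightarrow> p \<in> fst c \<Longrightarrow> chart_inv c (snd c p) = p"
  using chart_homeomorphism homeomorphism_apply1 by blast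

lemma chart_inv_right: "c \<in> A \<Longrightarrow> y \<in> snd c ` fst c \<Longrightarrow> snd c (chart_inv c y) = y"
  using chart_homeomorphism homeomorphism_apply2 by blast

lemma chart_inv_in: "c \<in> A \<Longrightarrow> y \<in> snd c ` fst c \<Longrightarrow> chart_inv c y \<in> fst c"
  by (erule imageE) (simp add: chart_inv_left)

lemma continuous_on_chart: "c \<in> A \<Longrightarrow> continuous_on (fst c) (snd c)"
  using chart_homeomorphism homeomorphism_cont1 by blast

lemma continuous_on_chart_inv: "c \<in> A \<Longrightarrow> continuous_on (snd c ` fst c) (chart_inv c)"
  using chart_homeomorphism homeomorphism_cont2 by blast

lemma isCont_chart: "c \<in> A \<Longrightarrow> p \<in> fst c \<Longrightarrow> isCont (snd c) p"
  using continuous_on_chart open_domain continuous_on_eq_continuous_at by blast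

lemma isCont_chart_inv: "c \<in> A \<Longrightarrow> p \<in> fst c \<Longrightarrow> isCont (chart_inv c) (snd c p)"
  using continuous_on_chart_inv open_range continuous_on_eq_continuous_at by blast

lemma ex_chart: "\<exists>c\<in>A. p \<in> fst c"
  using charts_cover by blast

lemma chart_image_eq: 
  assumes "c \<in> A" "U \<subseteq> fst c"
  shows "snd c ` U = snd c ` fst c \<inter> chart_inv c -` U"
  using assms chart_inv_left[OF assms(1)] by (auto simp: image_iff subset_iff) 

lemma open_chart_image:
  assumes "c \<in> A" "open U" "U \<subseteq> fst c"
  shows "open (snd c ` U)"
  unfolding chart_image_eq[OF assms(1,3)]
  using continuous_on_chart_inv[OF assms(1)] assms(2)
  by (simp add: continuous_on_open_vimage[OF open_range[OF assms(1)]] Int_commute)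

end

text \<open>The chain rule, for a map into a manifold followed by a map out of it.\<close>

lemma (in smooth_manifold) chart_chain:
  fixes u :: "'x::real_normed_vector \<Rightarrow> 'm" and \<phi> :: "'m \<Rightarrow> 'y::real_normed_vector"
  assumes d: "d \<in> A" "u x \<in> fst d" and u: "isCont u x"
    and 1: "(snd d \<circ> u has_derivative D1) (at x)"
    and 2: "(\<phi> \<circ> chart_inv d has_derivative D2) (at (snd d (u x)))"
  shows "(\<phi> \<circ> u has_derivative D2 \<circ> D1) (at x)"
proof -
  have "(\<phi> \<circ> chart_inv d \<circ> (snd d \<circ> u) has_derivative D2 \<circ> D1) (at x)"
    using diff_chain_at[OF 1] 2 by simp
  moreover have "eventually (\<lambda>y. (\<phi> \<circ> chart_inv d \<circ> (snd d \<circ> u)) y = (\<phi> \<circ> u) y) (at x)"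
  proof -
    have "eventually (\<lambda>y. u y \<in> fst d) (at x)"
      using topological_tendstoD[OF u[unfolded isCont_def] open_domain[OF d(1)] d(2)] .
    then show ?thesis
      by (rule eventually_mono) (simp add: chart_inv_left[OF d(1)])
  qed
  ultimately show ?thesis
    by (rule has_derivative_transform_eventually) (simp_all add: chart_inv_left d)
qed

abbreviation (input) local_derivative ::
  "('m, 'e::real_normed_vector) chart \<Rightarrow> ('n, 'f::real_normed_vector) chart \<Rightarrow>
   ('m \<Rightarrow> 'n) \<Rightarrow> 'm \<Rightarrow> 'e \<Rightarrow> 'f" where
  "local_derivative c d f p \<equiv> frechet_derivative (snd d \<circ> f \<circ> chart_inv c) (at (snd c p))"

abbreviation (input) transition_derivative ::
  "('m, 'e::real_normed_vector) chart \<Rightarrow> ('m, 'e) chart \<Rightarrow> 'm \<Rightarrow> 'e \<Rightarrow> 'e" where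
  "transition_derivative c d p \<equiv> frechet_derivative (snd d \<circ> chart_inv c) (at (snd c p))"

lemma (in smooth_manifold) chart_change_differentiable:
  assumes "c \<in> A" "d \<in> A" "p \<in> fst c" "p \<in> fst d"
  shows "(snd d \<circ> chart_inv c) differentiable (at (snd c p))"
  by (rule smooth_on_differentiable[OF charts_compatible[OF assms(1,2)]]) (use assms in auto)

lemmas (in smooth_manifold) chart_change_has_derivative =
  frechet_derivative_works[THEN iffD1, OF chart_change_differentiable]

text \<open>The calculus of differentials only needs differentiability at a point, which, unlike smoothness of
  maps of manifolds, composes by the pointwise chain rule alone.\<close>

definition differentiable_map_at ::
  "('m::t2_space, 'e::real_normed_vector) chart set \<Rightarrow>
   ('n::topological_space, 'f::real_normed_vector) chart set \<Rightarrow> ('m \<Rightarrow> 'n) \<Rightarrow> 'm \<Rightarrow> bool" where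
  "differentiable_map_at A B f p \<longleftrightarrow> isCont f p \<and>
     (\<forall>c\<in>A. \<forall>d\<in>B. p \<in> fst c \<longrightarrow> f p \<in> fst d \<longrightarrow>
        (snd d \<circ> f \<circ> chart_inv c) differentiable (at (snd c p)))"

lemma smooth_map_differentiable_at:
  assumes "smooth_map A B f"
  shows "differentiable_map_at A B f p"
proof -
  have "isCont f p" using assms by (simp add: smooth_map_def continuous_on_eq_continuous_at)
  moreover have "(snd d \<circ> f \<circ> chart_inv c) differentiable (at (snd c p))"
    if "c \<in> A" "d \<in> B" "p \<in> fst c" "f p \<in> fst d" for c d
    using assms that by (intro smooth_on_differentiable[of "snd c ` (fst c \<inter> f -` fst d)"])
      (auto simp: smooth_map_def)
  ultimately show ?thesis by (auto simp: differentiable_map_at_def)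
qed

lemma differentiable_map_at_has_derivative:
  assumes "differentiable_map_at A B f p" "c \<in> A" "d \<in> B" "p \<in> fst c" "f p \<in> fst d"
  shows "(snd d \<circ> f \<circ> chart_inv c has_derivative
    local_derivative c d f p) (at (snd c p))"
proof -
  have "(snd d \<circ> f \<circ> chart_inv c) differentiable (at (snd c p))"
    using assms by (simp add: differentiable_map_at_def)
  then show ?thesis by (rule frechet_derivative_works[THEN iffD1])
qed

text \<open>The differential is defined with a selected chart around \<open>p\<close>; the coordinates of a tangent vector
  in that chart and in \<open>c\<close> are related by the derivative of the chart change.\<close>

lemma (in smooth_manifold) differential_in_chart:
  fixes f :: "'m \<Rightarrow> 'n::topological_space" and B :: "('n, 'f::real_normed_vector) chart set"
  assumes f: "differentiable_map_at A B f p" and X: "X \<in> tangent_space A p"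
    and c: "c \<in> A" "p \<in> fst c" and d: "d \<in> B" "f p \<in> fst d"
  shows "differential A B f p X d = local_derivative c d f p (X c)"
proof -
  define k where "k = (SOME c. c \<in> A \<and> p \<in> fst c)"
  have k: "k \<in> A" "p \<in> fst k"
    using someI_ex[of "\<lambda>c. c \<in> A \<and> p \<in> fst c"] ex_chart[of p] unfolding k_def by blast+
  have Xk: "X k = transition_derivative c k p (X c)"
    using X c k unfolding tangent_space_def by blast
  have p: "chart_inv c (snd c p) = p" using chart_inv_left c by blast
  have "((snd d \<circ> f) \<circ> chart_inv c has_derivative
      local_derivative k d f p \<circ>
      transition_derivative c k p) (at (snd c p))"
  proof (rule chart_chain[OF k(1)])
    show "(snd k \<circ> chart_inv c has_derivative transition_derivative c k p)
        (at (snd c p))"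
      by (rule chart_change_has_derivative[OF c(1) k(1) c(2) k(2)])
    show "((snd d \<circ> f) \<circ> chart_inv k has_derivative
        local_derivative k d f p) (at (snd k (chart_inv c (snd c p))))"
      using differentiable_map_at_has_derivative[OF f k(1) d(1) k(2) d(2)] by (simp add: p)
  qed (use k p isCont_chart_inv c in auto)
  from fun_cong[OF frechet_derivative_at[OF this], of "X c"]
  have "local_derivative k d f p (X k) =
      local_derivative c d f p (X c)"
    unfolding Xk by simp
  then show ?thesis using d by (simp add: differential_def Let_def k_def)
qed

lemma differential_outside: "\<not> (d \<in> B \<and> f p \<in> fst d) \<Longrightarrow> differential A B f p X d = 0"
  by (auto simp: differential_def)

lemma differential_in_tangent_space:
  fixes A :: "('m::{t2_space,second_countable_topology}, 'e::finite_dim_normed) chart set"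
    and B :: "('n::{t2_space,second_countable_topology}, 'f::finite_dim_normed) chart set"
  assumes "smooth_manifold A" "smooth_manifold B"
    and f: "differentiable_map_at A B f p" and X: "X \<in> tangent_space A p"
  shows "differential A B f p X \<in> tangent_space B (f p)"
proof -
  interpret A: smooth_manifold A by fact
  interpret B: smooth_manifold B by fact
  obtain c where c: "c \<in> A" "p \<in> fst c" using A.ex_chart by blast
  have p: "chart_inv c (snd c p) = p" using A.chart_inv_left c by blast
  have "differential A B f p X d' =
      transition_derivative d d' (f p) (differential A B f p X d)"
    if d: "d \<in> B" "d' \<in> B" "f p \<in> fst d \<inter> fst d'" for d d'
  proof -
    have fd: "f p \<in> fst d" "f p \<in> fst d'" using d by auto
    have "(snd d' \<circ> (f \<circ> chart_inv c) has_derivative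
      transition_derivative d d' (f p) \<circ>
      local_derivative c d f p) (at (snd c p))"
    proof (rule B.chart_chain[OF d(1)])
      show "(snd d' \<circ> chart_inv d has_derivative transition_derivative d d' (f p))
          (at (snd d ((f \<circ> chart_inv c) (snd c p))))"
        using B.chart_change_has_derivative[OF d(1,2) fd] by (simp add: p)
      show "(snd d \<circ> (f \<circ> chart_inv c) has_derivative
        local_derivative c d f p) (at (snd c p))"
        using differentiable_map_at_has_derivative[OF f c(1) d(1) c(2) fd(1)] by (simp add: comp_assoc)
      show "isCont (f \<circ> chart_inv c) (snd c p)"
        using f A.isCont_chart_inv[OF c] by (intro continuous_at_compose) (simp_all add: differentiable_map_at_def p)
    qed (use fd p in auto)
    from fun_cong[OF frechet_derivative_at[OF this], of "X c"]
    show ?thesis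
      unfolding A.differential_in_chart[OF f X c d(1) fd(1)] A.differential_in_chart[OF f X c d(2) fd(2)]
      by (simp add: comp_assoc)
  qed
  moreover have "\<forall>d. \<not> (d \<in> B \<and> f p \<in> fst d) \<longrightarrow> differential A B f p X d = 0"
    by (auto simp: differential_def)
  ultimately show ?thesis unfolding tangent_space_def by blast
qed

lemma differential_chain:
  fixes A :: "('m::{t2_space,second_countable_topology}, 'e::finite_dim_normed) chart set"
    and B :: "('n::{t2_space,second_countable_topology}, 'f::finite_dim_normed) chart set"
    and C :: "('k::{t2_space,second_countable_topology}, 'h::finite_dim_normed) chart set"
  assumes mf: "smooth_manifold A" "smooth_manifold B" "smooth_manifold C"
    and f: "differentiable_map_at A B f p" and h: "differentiable_map_at B C h (f p)"
  shows "differentiable_map_at A C (h \<circ> f) p"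
    and "X \<in> tangent_space A p \<Longrightarrow>
      differential A C (h \<circ> f) p X = differential B C h (f p) (differential A B f p X)"
proof -
  interpret A: smooth_manifold A by fact
  interpret B: smooth_manifold B by fact
  interpret C: smooth_manifold C by fact
  obtain d where d: "d \<in> B" "f p \<in> fst d" using B.ex_chart by blast
  have fp: "isCont f p" and hp: "isCont h (f p)" using f h by (auto simp: differentiable_map_at_def)
  have der: "(snd k \<circ> (h \<circ> f) \<circ> chart_inv c has_derivative
      local_derivative d k h (f p) \<circ>
      local_derivative c d f p) (at (snd c p))"
    if c: "c \<in> A" "p \<in> fst c" and k: "k \<in> C" "h (f p) \<in> fst k" for c k
  proof -
    have p: "chart_inv c (snd c p) = p" using A.chart_inv_left c by blast
    have "((snd k \<circ> h) \<circ> (f \<circ> chart_inv c) has_derivative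
      local_derivative d k h (f p) \<circ>
      local_derivative c d f p) (at (snd c p))"
    proof (rule B.chart_chain[OF d(1)])
      show "((snd k \<circ> h) \<circ> chart_inv d has_derivative
          local_derivative d k h (f p))
          (at (snd d ((f \<circ> chart_inv c) (snd c p))))"
        using differentiable_map_at_has_derivative[OF h d(1) k(1) d(2) k(2)] by (simp add: p)
      show "(snd d \<circ> (f \<circ> chart_inv c) has_derivative
        local_derivative c d f p) (at (snd c p))"
        using differentiable_map_at_has_derivative[OF f c(1) d(1) c(2) d(2)] by (simp add: comp_assoc)
      show "isCont (f \<circ> chart_inv c) (snd c p)"
        using fp A.isCont_chart_inv[OF c] by (intro continuous_at_compose) (simp_all add: p)
    qed (use d p in auto)
    then show ?thesis by (simp add: comp_assoc)
  qed
  show *: "differentiable_map_at A C (h \<circ> f) p"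
    unfolding differentiable_map_at_def
  proof (intro conjI ballI impI)
    show "isCont (h \<circ> f) p" using fp hp by (rule continuous_at_compose)
  next
    fix c k assume "c \<in> A" "k \<in> C" "p \<in> fst c" "(h \<circ> f) p \<in> fst k"
    then show "(snd k \<circ> (h \<circ> f) \<circ> chart_inv c) differentiable (at (snd c p))"
      using der[of c k] unfolding differentiable_def comp_apply by blast
  qed
  assume X: "X \<in> tangent_space A p"
  obtain c where c: "c \<in> A" "p \<in> fst c" using A.ex_chart by blast
  have Y: "differential A B f p X \<in> tangent_space B (f p)"
    by (rule differential_in_tangent_space[OF mf(1,2) f X])
  show "differential A C (h \<circ> f) p X = differential B C h (f p) (differential A B f p X)"
  proof
    fix k
    show "differential A C (h \<circ> f) p X k = differential B C h (f p) (differential A B f p X) k"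
    proof (cases "k \<in> C \<and> h (f p) \<in> fst k")
      case True
      then have k: "k \<in> C" "h (f p) \<in> fst k" "(h \<circ> f) p \<in> fst k" by auto
      show ?thesis
        unfolding A.differential_in_chart[OF * X c k(1,3)]
          B.differential_in_chart[OF h Y d k(1,2)] A.differential_in_chart[OF f X c d]
        using fun_cong[OF frechet_derivative_at[OF der[OF c k(1,2)]], of "X c"] by simp
    next
      case False
      then show ?thesis by (simp add: differential_outside)
    qed
  qed
qed

context smooth_manifold
begin

lemma coord_vector_same:
  assumes "c \<in> A" "p \<in> fst c"
  shows "coord_vector A c p v c = v"
proof -
  have "transition_derivative c c p = frechet_derivative (\<lambda>x. x) (at (snd c p))"
    using assms by (intro frechet_derivative_cong_open[OF open_range[OF assms(1)]])
      (auto simp: chart_inv_right)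
  then show ?thesis using assms by (simp add: coord_vector_def frechet_derivative_ident)
qed

lemma coord_vector_of_tangent:
  assumes "c \<in> A" "p \<in> fst c" "X \<in> tangent_space A p"
  shows "coord_vector A c p (X c) = X"
proof
  fix d
  show "coord_vector A c p (X c) d = X d"
  proof (cases "d \<in> A \<and> p \<in> fst d")
    case True
    then have "X d = transition_derivative c d p (X c)"
      using assms unfolding tangent_space_def by blast
    then show ?thesis using True by (simp add: coord_vector_def)
  next
    case False
    then have "X d = 0" using assms(3) unfolding tangent_space_def by blast
    then show ?thesis using False by (auto simp: coord_vector_def)
  qed
qed

lemma coord_vector_in_tangent_space:
  assumes c: "c \<in> A" "p \<in> fst c"
  shows "coord_vector A c p v \<in> tangent_space A p"
proof -
  have p: "chart_inv c (snd c p) = p" using chart_inv_left c by blast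
  have "coord_vector A c p v d' =
      transition_derivative d d' p (coord_vector A c p v d)"
    if d: "d \<in> A" "d' \<in> A" "p \<in> fst d" "p \<in> fst d'" for d d'
  proof -
    have "(snd d' \<circ> chart_inv c has_derivative
      transition_derivative d d' p \<circ>
      transition_derivative c d p) (at (snd c p))"
    proof (rule chart_chain[OF d(1)])
      show "(snd d' \<circ> chart_inv d has_derivative transition_derivative d d' p)
          (at (snd d (chart_inv c (snd c p))))"
        using chart_change_has_derivative[OF d(1,2,3,4)] by (simp add: p)
      show "(snd d \<circ> chart_inv c has_derivative
        transition_derivative c d p) (at (snd c p))"
        by (rule chart_change_has_derivative[OF c(1) d(1) c(2) d(3)])
    qed (use d p isCont_chart_inv[OF c] in auto)
    from fun_cong[OF frechet_derivative_at[OF this], of v]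
    show ?thesis using d by (simp add: coord_vector_def)
  qed
  then have "\<forall>d\<in>A. \<forall>d'\<in>A. p \<in> fst d \<inter> fst d' \<longrightarrow> coord_vector A c p v d' =
      transition_derivative d d' p (coord_vector A c p v d)" by blast
  moreover have "\<forall>d. \<not> (d \<in> A \<and> p \<in> fst d) \<longrightarrow> coord_vector A c p v d = 0"
    by (simp add: coord_vector_def)
  ultimately show ?thesis unfolding tangent_space_def by blast
qed

lemma tangent_space_scale:
  assumes "X \<in> tangent_space A p"
  shows "(\<lambda>c. t *\<^sub>R X c) \<in> tangent_space A p"
proof -
  have "t *\<^sub>R X d = transition_derivative c d p (t *\<^sub>R X c)"
    if "c \<in> A" "d \<in> A" "p \<in> fst c" "p \<in> fst d" for c d
  proof -
    have "linear (transition_derivative c d p)"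
      using chart_change_differentiable that by (intro linear_frechet_derivative) auto
    moreover have "X d = transition_derivative c d p (X c)"
      using assms that unfolding tangent_space_def by blast
    ultimately show ?thesis by (simp only: linear_scale)
  qed
  moreover have "\<forall>d. \<not> (d \<in> A \<and> p \<in> fst d) \<longrightarrow> t *\<^sub>R X d = 0"
    using assms unfolding tangent_space_def by simp
  ultimately show ?thesis unfolding tangent_space_def by blast
qed

lemma velocity_eq_coord_vector:
  assumes c: "c \<in> A" "\<gamma> t \<in> fst c" and cont: "isCont \<gamma> t"
    and der: "(snd c \<circ> \<gamma> has_vector_derivative v) (at t)"
  shows "velocity A \<gamma> t = coord_vector A c (\<gamma> t) v"
proof
  fix d
  show "velocity A \<gamma> t d = coord_vector A c (\<gamma> t) v d"
  proof (cases "d \<in> A \<and> \<gamma> t \<in> fst d")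
    case True
    have "(snd d \<circ> \<gamma> has_derivative
        transition_derivative c d (\<gamma> t) \<circ> (\<lambda>h. h *\<^sub>R v)) (at t)"
    proof (rule chart_chain[OF c cont])
      show "(snd c \<circ> \<gamma> has_derivative (\<lambda>h. h *\<^sub>R v)) (at t)"
        using der by (simp add: has_vector_derivative_def)
    qed (use True c in \<open>intro chart_change_has_derivative, simp_all\<close>)
    moreover have "linear (transition_derivative c d (\<gamma> t))"
      using True c by (intro linear_frechet_derivative chart_change_differentiable) auto
    ultimately have "(snd d \<circ> \<gamma> has_vector_derivative
        transition_derivative c d (\<gamma> t) v) (at t)"
      by (simp add: has_vector_derivative_def comp_def linear_scale)
    then show ?thesis using True by (simp add: velocity_def coord_vector_def vector_derivative_at)
  qed (auto simp: velocity_def coord_vector_def)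
qed

end

lemma velocity_compose:
  fixes A :: "('m::{t2_space,second_countable_topology}, 'e::finite_dim_normed) chart set"
    and B :: "('n::{t2_space,second_countable_topology}, 'f::finite_dim_normed) chart set"
  assumes mf: "smooth_manifold A" "smooth_manifold B"
    and f: "differentiable_map_at A B f (\<gamma> t)"
    and c: "c \<in> A" "\<gamma> t \<in> fst c" and cont: "isCont \<gamma> t"
    and der: "(snd c \<circ> \<gamma> has_vector_derivative v) (at t)"
  shows "velocity B (f \<circ> \<gamma>) t = differential A B f (\<gamma> t) (velocity A \<gamma> t)"
proof -
  interpret A: smooth_manifold A by fact
  interpret B: smooth_manifold B by fact
  obtain d where d: "d \<in> B" "f (\<gamma> t) \<in> fst d" using B.ex_chart by blast
  let ?L = "local_derivative c d f (\<gamma> t)"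
  have L: "(snd d \<circ> f \<circ> chart_inv c has_derivative ?L) (at (snd c (\<gamma> t)))"
    by (rule differentiable_map_at_has_derivative[OF f c(1) d(1) c(2) d(2)])
  have "((snd d \<circ> f) \<circ> \<gamma> has_derivative ?L \<circ> (\<lambda>h. h *\<^sub>R v)) (at t)"
    using der by (intro A.chart_chain[OF c cont _ L]) (simp add: has_vector_derivative_def)
  moreover have "linear ?L" by (rule has_derivative_linear[OF L])
  ultimately have "(snd d \<circ> (f \<circ> \<gamma>) has_vector_derivative ?L v) (at t)"
    by (simp add: has_vector_derivative_def comp_def linear_scale)
  moreover have "isCont (f \<circ> \<gamma>) t"
    using cont f by (intro continuous_at_compose) (auto simp: differentiable_map_at_def)
  ultimately have "velocity B (f \<circ> \<gamma>) t = coord_vector B d (f (\<gamma> t)) (?L v)"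
    using B.velocity_eq_coord_vector[of d "f \<circ> \<gamma>" t] d by simp
  moreover have v: "velocity A \<gamma> t = coord_vector A c (\<gamma> t) v"
    by (rule A.velocity_eq_coord_vector[OF c cont der])
  moreover have T: "velocity A \<gamma> t \<in> tangent_space A (\<gamma> t)"
    unfolding v by (rule A.coord_vector_in_tangent_space[OF c])
  moreover have "differential A B f (\<gamma> t) (velocity A \<gamma> t) d = ?L v"
    using A.differential_in_chart[OF f T c d] by (simp add: v A.coord_vector_same[OF c])
  ultimately show ?thesis
    using B.coord_vector_of_tangent[OF d differential_in_tangent_space[OF mf f T]] by simp
qed

lemma metric_of_tangent_vectors:
  assumes "smooth_manifold A" "c \<in> A" "p \<in> fst c" "X \<in> tangent_space A p" "Y \<in> tangent_space A p"
  shows "g p X Y = metric_coords A g c p (X c) (Y c)"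
proof -
  interpret smooth_manifold A by fact
  show ?thesis using assms by (simp add: metric_coords_def coord_vector_of_tangent)
qed

text \<open>The form of the isometry condition to which \<open>gram_det_pullback\<close> applies.\<close>

lemma isometry_metric_coords:
  fixes A :: "('m::{t2_space,second_countable_topology}, 'e::finite_dim_normed) chart set"
  assumes mf: "smooth_manifold A" and iso: "isometry A g f"
    and c: "c \<in> A" "p \<in> fst c" and d: "d \<in> A" "f p \<in> fst d"
  defines "L \<equiv> local_derivative c d f p"
  shows "metric_coords A g c p v w = metric_coords A g d (f p) (L v) (L w)"
proof -
  interpret smooth_manifold A by fact
  have f: "differentiable_map_at A A f p"
    using iso smooth_map_differentiable_at by (auto simp: isometry_def)
  let ?X = "\<lambda>v. coord_vector A c p v"
  have T: "?X v \<in> tangent_space A p" for v by (rule coord_vector_in_tangent_space[OF c])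
  have T': "differential A A f p (?X v) \<in> tangent_space A (f p)" for v
    by (rule differential_in_tangent_space[OF mf mf f T])
  have "metric_coords A g c p v w = g p (?X v) (?X w)" by (simp add: metric_coords_def)
  also have "\<dots> = g (f p) (differential A A f p (?X v)) (differential A A f p (?X w))"
    using iso T by (simp add: isometry_def)
  also have "\<dots> = metric_coords A g d (f p) (L v) (L w)"
    unfolding metric_of_tangent_vectors[OF mf d T' T'] L_def
      differential_in_chart[OF f T c d] coord_vector_same[OF c] ..
  finally show ?thesis .
qed

section \<open>The volume of a semi-Riemannian manifold\<close>

definition volume_density ::
  "('m, 'e::finite_dim_normed) chart set \<Rightarrow> ('m, 'e) metric_field \<Rightarrow> ('m, 'e) chart \<Rightarrow> 'e \<Rightarrow> real" where
  "volume_density A g c y = sqrt \<bar>gram_det (metric_coords A g c (chart_inv c y))\<bar>"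

lemma (in smooth_manifold) borel_chart_image:
  assumes c: "c \<in> A" and S: "S \<in> sets borel" "S \<subseteq> fst c"
  shows "snd c ` S \<in> sets borel"
proof -
  let ?R = "restrict_space borel (snd c ` fst c)"
  have "chart_inv c \<in> borel_measurable ?R"
    by (rule borel_measurable_continuous_on_restrict[OF continuous_on_chart_inv[OF c]])
  then have "chart_inv c -` S \<inter> space ?R \<in> sets ?R" by (rule measurable_sets[OF _ S(1)])
  then have "snd c ` fst c \<inter> chart_inv c -` S \<in> sets borel"
    using open_range[OF c] by (simp add: sets_restrict_space_iff space_restrict_space Int_commute)
  then show ?thesis by (simp add: chart_image_eq[OF c S(2)])
qed

context semi_riemannian_manifold
begin

lemma volume_density_borel:
  assumes c: "c \<in> A" and T: "T \<in> sets borel" "T \<subseteq> snd c ` fst c"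
  shows "(\<lambda>y. indicator T y * volume_density A g c y) \<in> borel_measurable borel"
proof -
  have "continuous_on T (\<lambda>y. metric_coords A g c (chart_inv c y) v w)" for v w
    using smooth_on_continuous[OF metric_smooth[OF c]] T(2) by (rule continuous_on_subset)
  then have "continuous_on T (volume_density A g c)"
    unfolding volume_density_def gram_det_def by (intro continuous_intros) 
  from borel_measurable_continuous_on_indicator[OF T(1) this]
  show ?thesis by simp
qed

lemma volume_density_pos:
  assumes ne: "(std_basis :: 'e set) \<noteq> {}" and c: "c \<in> A" "y \<in> snd c ` fst c"
  shows "volume_density A g c y > 0"
proof -
  have p: "chart_inv c y \<in> fst c" by (rule chart_inv_in[OF c])
  have "gram_det (metric_coords A g c (chart_inv c y)) \<noteq> 0"
    using metric_nondegenerate[OF c(1) p] by (intro gram_det_nonzero[OF ne metric_bilinear[OF c(1) p]]) blast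
  then show ?thesis by (simp add: volume_density_def)
qed

end

lemma isometry_homeomorphism:
  assumes "isometry A g f"
  shows "continuous_on UNIV f" "continuous_on UNIV (inv_into UNIV f)" "bij f"
  using assms by (auto simp: isometry_def smooth_map_def)

lemma isometry_image_eq:
  assumes "isometry A g f"
  shows "f ` S = inv_into UNIV f -` S"
proof -
  have "inj f" "surj f" using isometry_homeomorphism(3)[OF assms] by (auto simp: bij_def)
  then show ?thesis by (auto simp: surj_f_inv_f intro: image_eqI[of _ f, OF surj_f_inv_f[symmetric]])
qed

text \<open>Dimension zero is left out because the index type of an empty basis has one element.  There all
  tangent vectors vanish.\<close>

locale finite_volume_manifold = semi_riemannian_manifold A g
  for A :: "('m::{t2_space,second_countable_topology}, 'e::finite_dim_normed) chart set" and g +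
  fixes \<mu> :: "'m measure"
  assumes volume: "is_metric_volume A g \<mu>"
    and finite_volume: "finite_measure \<mu>"
    and positive_dim: "(std_basis :: 'e set) \<noteq> {}"
begin

sublocale finite_measure \<mu> by (rule finite_volume)

lemma sets_volume: "sets \<mu> = sets borel"
  using volume by (simp add: is_metric_volume_def)

lemma emeasure_volume_chart:
  assumes "c \<in> A" "S \<in> sets borel" "S \<subseteq> fst c"
  shows "emeasure \<mu> S = (\<integral>\<^sup>+y. ennreal (volume_density A g c y) * indicator (snd c ` S) y \<partial>std_lborel)"
  using volume assms by (simp add: is_metric_volume_def volume_density_def)

text \<open>The density of the volume is positive, so every non-empty open set has positive volume.\<close>

lemma volume_open_pos:
  assumes "open S" "S \<noteq> {}"
  shows "emeasure \<mu> S \<noteq> 0"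
proof
  assume 0: "emeasure \<mu> S = 0"
  obtain p where p: "p \<in> S" using assms(2) by blast
  obtain c where c: "c \<in> A" "p \<in> fst c" using ex_chart by blast
  define T where "T = snd c ` (S \<inter> fst c)"
  have opn: "open (S \<inter> fst c)" using assms(1) open_domain[OF c(1)] by blast
  have T: "open T" unfolding T_def by (rule open_chart_image[OF c(1) opn]) auto
  have T_ne: "T \<noteq> {}" using p c by (auto simp: T_def)
  have T_sub: "T \<subseteq> snd c ` fst c" by (auto simp: T_def)
  have e: "ennreal (volume_density A g c y) * indicator T y = ennreal (indicator T y * volume_density A g c y)" for y
    by (simp add: indicator_def)
  have "emeasure \<mu> (S \<inter> fst c) \<le> emeasure \<mu> S"
    using assms(1) by (intro emeasure_mono) (auto simp: sets_volume)
  then have "(\<integral>\<^sup>+y. ennreal (indicator T y * volume_density A g c y) \<partial>std_lborel) = 0"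
    using emeasure_volume_chart[OF c(1), of "S \<inter> fst c"] opn 0 by (simp add: T_def[symmetric] e)
  moreover have "(\<lambda>y. ennreal (indicator T y * volume_density A g c y)) \<in> borel_measurable std_lborel"
    using volume_density_borel[OF c(1) _ T_sub] T by (simp cong: measurable_cong_sets)
  ultimately have "AE y in std_lborel. ennreal (indicator T y * volume_density A g c y) = 0"
    by (simp add: nn_integral_0_iff_AE)
  then have "AE y in std_lborel. y \<notin> T"
  proof (rule eventually_mono)
    fix y assume *: "ennreal (indicator T y * volume_density A g c y) = 0"
    show "y \<notin> T"
    proof
      assume "y \<in> T"
      then have "volume_density A g c y > 0" using volume_density_pos[OF positive_dim c(1)] T_sub by blast
      then show False using * \<open>y \<in> T\<close> by (simp add: ennreal_eq_0_iff)
    qed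
  qed
  moreover have "{y \<in> space std_lborel. \<not> y \<notin> T} = T" by (auto simp: std_lborel_def)
  ultimately have "emeasure (std_lborel :: 'e measure) T = 0"
    using T AE_iff_measurable[of T std_lborel "\<lambda>y. y \<notin> T"] by simp
  then show False using emeasure_std_lborel_open_pos[OF positive_dim T T_ne] by simp
qed

lemma borel_isometry_image:
  assumes "isometry A g f" "S \<in> sets borel"
  shows "f ` S \<in> sets borel"
proof -
  have "inv_into UNIV f \<in> borel_measurable borel"
    by (rule borel_measurable_continuous_onI[OF isometry_homeomorphism(2)[OF assms(1)]])
  from measurable_sets[OF this assms(2)] show ?thesis by (simp add: isometry_image_eq[OF assms(1)])
qed

text \<open>In charts \<open>f\<close> is a diffeomorphism between open sets of the model space, and the density at a point
  is the density at its image times the absolute value of the Jacobian determinant.  Finiteness of the volume makes the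
  densities integrable.\<close>

lemma volume_isometry_image_in_charts:
  assumes iso: "isometry A g f" and c: "c \<in> A" and d: "d \<in> A"
    and S: "S \<in> sets borel" "S \<subseteq> fst c" "f ` S \<subseteq> fst d"
  shows "emeasure \<mu> (f ` S) = emeasure \<mu> S"
proof -
  define T where "T = snd c ` S"
  define \<psi> where "\<psi> = snd d \<circ> f \<circ> chart_inv c"
  have chS: "y \<in> T \<Longrightarrow> chart_inv c y \<in> S" for y using S(2) by (auto simp: T_def chart_inv_left[OF c])
  have \<psi>T: "\<psi> ` T = snd d ` (f ` S)"
    unfolding T_def \<psi>_def image_comp[symmetric] image_image
    using S(2) by (intro image_cong refl) (auto simp: chart_inv_left[OF c])
  have fS: "f ` S \<in> sets borel" by (rule borel_isometry_image[OF iso S(1)])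
  have fin: "emeasure \<mu> (f ` S) \<noteq> \<infinity>" by (simp add: emeasure_finite)
  have "(\<integral>\<^sup>+z. ennreal (volume_density A g d z) * indicator (\<psi> ` T) z \<partial>std_lborel) =
    (\<integral>\<^sup>+y. ennreal (volume_density A g c y) * indicator T y \<partial>std_lborel)"
  proof (rule nn_integral_change_of_variables[OF positive_dim])
    show "T \<in> sets borel" unfolding T_def by (rule borel_chart_image[OF c S(1,2)])
    then show "(\<lambda>y. indicator T y * volume_density A g c y) \<in> borel_measurable borel"
      using S(2) by (intro volume_density_borel[OF c]) (auto simp: T_def)
    show "(\<lambda>z. indicator (\<psi> ` T) z * volume_density A g d z) \<in> borel_measurable borel"
      unfolding \<psi>T using S(3) by (intro volume_density_borel[OF d] borel_chart_image[OF d fS]) auto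
    show "0 \<le> volume_density A g d z" for z by (simp add: volume_density_def)
    show "(\<integral>\<^sup>+z. ennreal (volume_density A g d z) * indicator (\<psi> ` T) z \<partial>std_lborel) \<noteq> \<infinity>"
      using fin emeasure_volume_chart[OF d fS S(3)] by (simp add: \<psi>T)
    have f: "differentiable_map_at A A f p" for p
      using iso smooth_map_differentiable_at by (auto simp: isometry_def)
    fix y assume y: "y \<in> T"
    define p where "p = chart_inv c y"
    have p: "p \<in> S" "p \<in> fst c" "f p \<in> fst d" "snd c p = y"
      using chS[OF y] S y by (auto simp: p_def T_def chart_inv_left[OF c])
    show "(\<psi> has_derivative frechet_derivative \<psi> (at y)) (at y)"
      using differentiable_map_at_has_derivative[OF f c d p(2,3)] by (simp add: p(4) \<psi>_def)
    have "chart_inv d (\<psi> y) = f p"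
      using chart_inv_left[OF d p(3)] by (simp add: \<psi>_def p_def)
    moreover have "sqrt \<bar>gram_det (metric_coords A g c p)\<bar>
        = abs_det (frechet_derivative \<psi> (at y)) * sqrt \<bar>gram_det (metric_coords A g d (f p))\<bar>"
      using isometry_metric_coords[OF smooth_manifold_axioms iso c p(2) d p(3)]
      unfolding p(4) \<psi>_def[symmetric]
      by (intro gram_det_pullback[OF positive_dim metric_bilinear[OF d p(3)]])
    ultimately show "volume_density A g c y = abs_det (frechet_derivative \<psi> (at y)) * volume_density A g d (\<psi> y)"
      by (simp add: volume_density_def p_def)
  next
    show "inj_on \<psi> T"
    proof (rule inj_onI)
      fix y z assume yz: "y \<in> T" "z \<in> T" "\<psi> y = \<psi> z"
      have "f (chart_inv c y) \<in> fst d" "f (chart_inv c z) \<in> fst d" using chS yz S(3) by auto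
      then have "f (chart_inv c y) = f (chart_inv c z)"
        using yz(3) chart_inv_left[OF d] unfolding \<psi>_def comp_apply by metis
      then have "chart_inv c y = chart_inv c z"
        using isometry_homeomorphism(3)[OF iso] by (simp add: bij_def inj_eq)
      then show "y = z"
        using yz(1,2) S(2) chart_inv_right[OF c] unfolding T_def by (metis image_mono subsetD)
    qed
  qed
  then show ?thesis
    using emeasure_volume_chart[OF c S(1,2)] emeasure_volume_chart[OF d fS S(3)]
    by (simp add: \<psi>T T_def[symmetric])
qed

text \<open>By the Lindelof property a set is a countable disjoint union of pieces that, together with their
  images, lie in charts.\<close>

lemma volume_isometry_image:
  assumes iso: "isometry A g f" and S: "S \<in> sets borel"
  shows "emeasure \<mu> (f ` S) = emeasure \<mu> S"
proof -
  define F where "F = {fst c \<inter> f -` fst d | c d. c \<in> A \<and> d \<in> A}"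
  have inj: "inj f" using isometry_homeomorphism(3)[OF iso] by (simp add: bij_def)
  have opn: "open U" if U: "U \<in> F" for U
  proof -
    obtain c d where "c \<in> A" "d \<in> A" "U = fst c \<inter> f -` fst d" using U by (auto simp: F_def)
    then show ?thesis
      by (simp add: open_Int open_domain open_vimage[OF _ isometry_homeomorphism(1)[OF iso]])
  qed
  obtain F' where F': "F' \<subseteq> F" "countable F'" "\<Union>F' = \<Union>F" by (rule Lindelof[OF opn])
  have cover: "\<Union>F = UNIV"
  proof -
    have "p \<in> \<Union>F" for p
    proof -
      obtain c where "c \<in> A" "p \<in> fst c" using ex_chart by blast
      moreover obtain d where "d \<in> A" "f p \<in> fst d" using ex_chart by blast
      ultimately show ?thesis unfolding F_def by blast
    qed
    then show ?thesis by blast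
  qed
  then have "F' \<noteq> {}" using F'(3) by auto
  define U where "U = from_nat_into F'"
  have U: "U n \<in> F" for n using from_nat_into[OF \<open>F' \<noteq> {}\<close>, of n] F'(1) by (auto simp: U_def)
  have U_cover: "(\<Union>n. U n) = UNIV"
    using range_from_nat_into[OF \<open>F' \<noteq> {}\<close> F'(2)] F'(3) cover by (simp add: U_def)
  define P where "P n = S \<inter> disjointed U n" for n
  have UB: "U n \<in> sets borel" for n using opn[OF U] by simp
  have P: "P n \<in> sets borel" for n
    using sets.range_disjointed_sets[of U borel] UB S unfolding P_def by blast
  have fP: "f ` P n \<in> sets borel" for n by (rule borel_isometry_image[OF iso P])
  have disj: "disjoint_family P"
    using disjoint_family_disjointed[of U] by (auto simp: P_def disjoint_family_on_def)
  have disj': "disjoint_family (\<lambda>n. f ` P n)"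
    using disj inj unfolding disjoint_family_on_def by (simp add: image_Int[symmetric])
  have un: "(\<Union>n. P n) = S" using UN_disjointed_eq[of U] U_cover by (auto simp: P_def)
  have eq: "emeasure \<mu> (f ` P n) = emeasure \<mu> (P n)" for n
  proof -
    obtain c d where cd: "c \<in> A" "d \<in> A" "U n = fst c \<inter> f -` fst d" using U[of n] by (auto simp: F_def)
    moreover have "P n \<subseteq> U n" using disjointed_subset[of U n] by (auto simp: P_def)
    ultimately show ?thesis by (intro volume_isometry_image_in_charts[OF iso cd(1,2) P]) auto
  qed
  have "emeasure \<mu> (f ` S) = emeasure \<mu> (\<Union>n. f ` P n)" by (simp add: un[symmetric] image_UN)
  also have "\<dots> = (\<Sum>n. emeasure \<mu> (f ` P n))"
    using fP disj' by (intro suminf_emeasure[symmetric]) (auto simp: sets_volume)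
  also have "\<dots> = (\<Sum>n. emeasure \<mu> (P n))" by (simp add: eq)
  also have "\<dots> = emeasure \<mu> (\<Union>n. P n)"
    using P disj by (intro suminf_emeasure) (auto simp: sets_volume)
  finally show ?thesis by (simp add: un)
qed

lemma volume_isometry_vimage:
  assumes iso: "isometry A g f" and S: "open S"
  shows "emeasure \<mu> (f -` S) = emeasure \<mu> S"
proof -
  have "f ` (f -` S) = S"
    using isometry_homeomorphism(3)[OF iso] by (simp add: bij_def surj_image_vimage_eq)
  moreover have "open (f -` S)" by (rule open_vimage[OF S isometry_homeomorphism(1)[OF iso]])
  ultimately show ?thesis using volume_isometry_image[OF iso, of "f -` S"] by simp
qed

end

section \<open>Smooth maps on products\<close>

text \<open>The product of charts is a chart of the product atlas with the expected inverse, so smoothness on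
  a product can be used in coordinates of the factors.\<close>

lemma smooth_map_prod_chart_rep:
  fixes A :: "('m::{t2_space,second_countable_topology}, 'e::finite_dim_normed) chart set"
    and B :: "('n::{t2_space,second_countable_topology}, 'f::finite_dim_normed) chart set"
    and C :: "('k::{t2_space,second_countable_topology}, 'h::finite_dim_normed) chart set"
  assumes mf: "smooth_manifold A" "smooth_manifold B"
    and F: "smooth_map (prod_atlas A B) C F"
    and a: "a \<in> A" and b: "b \<in> B" and c: "c \<in> C" and oc: "open (fst c)"
  defines "\<Omega> \<equiv> {(u, v). u \<in> snd a ` fst a \<and> v \<in> snd b ` fst b \<and> F (chart_inv a u, chart_inv b v) \<in> fst c}"
  shows "open \<Omega>" and "smooth_on \<Omega> (\<lambda>(u, v). snd c (F (chart_inv a u, chart_inv b v)))"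
proof -
  interpret A: smooth_manifold A by fact
  interpret B: smooth_manifold B by fact
  define R where "R = (snd a ` fst a) \<times> (snd b ` fst b)"
  define k where "k = (fst a \<times> fst b, map_prod (snd a) (snd b))"
  have R: "open R" unfolding R_def by (intro open_Times A.open_range[OF a] B.open_range[OF b])
  have contF: "continuous_on UNIV F" using F by (simp add: smooth_map_def)
  have "continuous_on R (\<lambda>z. F (chart_inv a (fst z), chart_inv b (snd z)))"
    unfolding R_def
    by (intro continuous_on_compose2[OF contF] continuous_on_Pair subset_UNIV
        continuous_on_compose2[OF A.continuous_on_chart_inv[OF a]]
        continuous_on_compose2[OF B.continuous_on_chart_inv[OF b]] continuous_on_fst continuous_on_snd
        continuous_on_id) auto
  then have "open ((\<lambda>z. F (chart_inv a (fst z), chart_inv b (snd z))) -` fst c \<inter> R)"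
    using continuous_on_open_vimage[OF R] oc by blast
  moreover have "(\<lambda>z. F (chart_inv a (fst z), chart_inv b (snd z))) -` fst c \<inter> R = \<Omega>"
    by (auto simp: \<Omega>_def R_def)
  ultimately show op: "open \<Omega>" by simp
  have inj: "inj_on (snd k) (fst k)"
  proof (rule inj_onI)
    fix p q assume "p \<in> fst k" "q \<in> fst k" "snd k p = snd k q"
    then show "p = q" using A.chart_inv_left[OF a] B.chart_inv_left[OF b]
      unfolding k_def by (metis fst_conv snd_conv mem_Times_iff fst_map_prod snd_map_prod prod_eqI)
  qed
  have inv: "chart_inv k (u, v) = (chart_inv a u, chart_inv b v)"
    if "u \<in> snd a ` fst a" "v \<in> snd b ` fst b" for u v
    unfolding chart_inv_def[of k]
  proof (rule inv_into_f_eq[OF inj])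
    show "(chart_inv a u, chart_inv b v) \<in> fst k"
      using A.chart_inv_in[OF a that(1)] B.chart_inv_in[OF b that(2)] by (simp add: k_def)
    show "snd k (chart_inv a u, chart_inv b v) = (u, v)"
      using A.chart_inv_right[OF a that(1)] B.chart_inv_right[OF b that(2)] by (simp add: k_def)
  qed
  have "k \<in> prod_atlas A B" unfolding k_def prod_atlas_def using a b by blast
  then have sm: "smooth_on (snd k ` (fst k \<inter> F -` fst c)) (snd c \<circ> F \<circ> chart_inv k)"
    using F c by (simp add: smooth_map_def)
  have sub: "\<Omega> \<subseteq> snd k ` (fst k \<inter> F -` fst c)"
  proof
    fix z assume z: "z \<in> \<Omega>"
    obtain u v where uv: "z = (u, v)" by fastforce
    with z have u: "u \<in> snd a ` fst a" and v: "v \<in> snd b ` fst b"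
      and "F (chart_inv a u, chart_inv b v) \<in> fst c" by (auto simp: \<Omega>_def)
    then have "(chart_inv a u, chart_inv b v) \<in> fst k \<inter> F -` fst c"
      using A.chart_inv_in[OF a u] B.chart_inv_in[OF b v] by (simp add: k_def)
    moreover have "snd k (chart_inv a u, chart_inv b v) = z"
      using A.chart_inv_right[OF a u] B.chart_inv_right[OF b v] by (simp add: k_def uv)
    ultimately show "z \<in> snd k ` (fst k \<inter> F -` fst c)" by (metis imageI)
  qed
  show "smooth_on \<Omega> (\<lambda>(u, v). snd c (F (chart_inv a u, chart_inv b v)))"
  proof (rule smooth_on_cong[OF op _ smooth_on_subset[OF sm sub]])
    fix z assume "z \<in> \<Omega>"
    then show "(snd c \<circ> F \<circ> chart_inv k) z = (case z of (u, v) \<Rightarrow> snd c (F (chart_inv a u, chart_inv b v)))"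
      by (auto simp: \<Omega>_def inv)
  qed
qed

lemma smooth_map_slice:
  fixes A :: "('m::{t2_space,second_countable_topology}, 'e::finite_dim_normed) chart set"
    and B :: "('n::{t2_space,second_countable_topology}, 'f::finite_dim_normed) chart set"
    and C :: "('k::{t2_space,second_countable_topology}, 'h::finite_dim_normed) chart set"
  assumes mf: "smooth_manifold A" "smooth_manifold B" "smooth_manifold C"
    and F: "smooth_map (prod_atlas A B) C F"
  shows "smooth_map B C (\<lambda>y. F (x, y))" and "smooth_map A C (\<lambda>x. F (x, y))"
proof -
  interpret A: smooth_manifold A by fact
  interpret B: smooth_manifold B by fact
  interpret C: smooth_manifold C by fact
  have contF: "continuous_on UNIV F" using F by (simp add: smooth_map_def)
  have cont1: "continuous_on UNIV (\<lambda>y. F (x, y))"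
    by (intro continuous_on_compose2[OF contF] continuous_intros subset_UNIV)
  have cont2: "continuous_on UNIV (\<lambda>x. F (x, y))"
    by (intro continuous_on_compose2[OF contF] continuous_intros subset_UNIV)
  show "smooth_map B C (\<lambda>y. F (x, y))"
    unfolding smooth_map_def
  proof (intro conjI cont1 ballI)
    fix b c assume b: "b \<in> B" and c: "c \<in> C"
    obtain a where a: "a \<in> A" "x \<in> fst a" using A.ex_chart by blast
    let ?S = "snd b ` (fst b \<inter> (\<lambda>y. F (x, y)) -` fst c)"
    have oS: "open ?S"
      using B.open_domain[OF b] open_vimage[OF C.open_domain[OF c] cont1]
      by (intro B.open_chart_image[OF b]) auto
    note rep = smooth_map_prod_chart_rep[OF mf(1,2) F a(1) b c C.open_domain[OF c]]
    have "smooth_on ?S (\<lambda>v. (\<lambda>(u, v). snd c (F (chart_inv a u, chart_inv b v))) (snd a x, v))"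
    proof (rule smooth_on_compose[OF oS rep(1) _ rep(2)])
      show "smooth_on ?S (\<lambda>v. (snd a x, v))"
        by (intro smooth_on_Pair smooth_on_const smooth_on_id oS)
    qed (use a in \<open>auto simp: A.chart_inv_left B.chart_inv_left b\<close>)
    then show "smooth_on ?S (snd c \<circ> (\<lambda>y. F (x, y)) \<circ> chart_inv b)"
      by (simp add: A.chart_inv_left[OF a] comp_def)
  qed
  show "smooth_map A C (\<lambda>x. F (x, y))"
    unfolding smooth_map_def
  proof (intro conjI cont2 ballI)
    fix a c assume a: "a \<in> A" and c: "c \<in> C"
    obtain b where b: "b \<in> B" "y \<in> fst b" using B.ex_chart by blast
    let ?S = "snd a ` (fst a \<inter> (\<lambda>x. F (x, y)) -` fst c)"
    have oS: "open ?S"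
      using A.open_domain[OF a] open_vimage[OF C.open_domain[OF c] cont2]
      by (intro A.open_chart_image[OF a]) auto
    note rep = smooth_map_prod_chart_rep[OF mf(1,2) F a b(1) c C.open_domain[OF c]]
    have "smooth_on ?S (\<lambda>u. (\<lambda>(u, v). snd c (F (chart_inv a u, chart_inv b v))) (u, snd b y))"
    proof (rule smooth_on_compose[OF oS rep(1) _ rep(2)])
      show "smooth_on ?S (\<lambda>u. (u, snd b y))"
        by (intro smooth_on_Pair smooth_on_const smooth_on_id oS)
    qed (use b in \<open>auto simp: A.chart_inv_left B.chart_inv_left a\<close>)
    then show "smooth_on ?S (snd c \<circ> (\<lambda>x. F (x, y)) \<circ> chart_inv a)"
      by (simp add: B.chart_inv_left[OF b] comp_def)
  qed
qed

section \<open>Extending local one-parameter subgroups\<close>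

text \<open>The extension is \<open>\<beta> t = \<gamma> (t / n)\<^sup>n\<close>, which does not depend on the choice of a large \<open>n\<close>, as a
  common refinement of two subdivisions shows.  It is a homomorphism because \<open>\<gamma> (s / n)\<close> and
  \<open>\<gamma> (t / n)\<close> commute.\<close>

lemma (in group) local_hom_extends:
  fixes \<gamma> :: "real \<Rightarrow> 'a"
  assumes UNIV: "carrier G = UNIV" and \<epsilon>: "\<epsilon> > 0"
    and hom: "\<And>s t. \<bar>s\<bar> \<le> \<epsilon> \<Longrightarrow> \<bar>t\<bar> \<le> \<epsilon> \<Longrightarrow> \<gamma> (s + t) = \<gamma> s \<otimes> \<gamma> t"
  obtains \<beta> where "\<And>s t. \<beta> (s + t) = \<beta> s \<otimes> \<beta> t" "\<And>t. \<bar>t\<bar> \<le> \<epsilon> \<Longrightarrow> \<beta> t = \<gamma> t"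
proof -
  have cG [simp]: "x \<in> carrier G" for x using UNIV by simp
  have g0: "\<gamma> 0 = \<one>"
    using hom[of 0 0] \<epsilon> r_cancel_one'[of "\<gamma> 0" "\<gamma> 0"] by simp
  have pow: "\<gamma> (real n * t) = \<gamma> t [^] n" if "\<bar>real n * t\<bar> \<le> \<epsilon>" for n t
    using that
  proof (induction n)
    case 0
    then show ?case by (simp add: g0)
  next
    case (Suc n)
    have le: "real n * \<bar>t\<bar> \<le> real (Suc n) * \<bar>t\<bar>" "\<bar>t\<bar> \<le> real (Suc n) * \<bar>t\<bar>"
      by (simp_all add: distrib_right)
    have 1: "\<bar>real n * t\<bar> \<le> \<epsilon>" "\<bar>t\<bar> \<le> \<epsilon>" using le Suc.prems by (auto simp: abs_mult)
    have "\<gamma> (real (Suc n) * t) = \<gamma> (real n * t + t)" by (simp add: distrib_right add.commute)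
    also have "\<dots> = \<gamma> (real n * t) \<otimes> \<gamma> t" by (rule hom[OF 1])
    finally show ?case using Suc.IH[OF 1(1)] by simp
  qed
  define N where "N t = Suc (nat \<lceil>\<bar>t\<bar> / \<epsilon>\<rceil>)" for t
  have N: "\<bar>t / real (N t)\<bar> \<le> \<epsilon>" for t
  proof -
    have "\<bar>t\<bar> / \<epsilon> \<le> real (N t)" unfolding N_def using real_nat_ceiling_ge[of "\<bar>t\<bar> / \<epsilon>"] by linarith
    then have "\<bar>t\<bar> \<le> \<epsilon> * real (N t)" using \<epsilon> by (simp add: field_simps)
    moreover have "real (N t) > 0" by (simp add: N_def)
    ultimately show ?thesis by (simp add: field_simps)
  qed
  define \<beta> where "\<beta> t = \<gamma> (t / real (N t)) [^] N t" for t
  have indep: "\<beta> t = \<gamma> (t / real n) [^] n" if n: "n > 0" "\<bar>t / real n\<bar> \<le> \<epsilon>" for t n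
  proof -
    have refine: "\<gamma> (t / real i) [^] i = \<gamma> (t / (real i * real j)) [^] (j * i)"
      if "i > 0" "j > 0" "\<bar>t / real i\<bar> \<le> \<epsilon>" for i j :: nat
    proof -
      have "t / real i = real j * (t / (real i * real j))" using that by (simp add: field_simps)
      then have "\<gamma> (t / real i) = \<gamma> (t / (real i * real j)) [^] j"
        using pow[of j "t / (real i * real j)"] that(3) by simp
      then show ?thesis by (simp add: nat_pow_pow)
    qed
    have Np: "N t > 0" by (simp add: N_def)
    have "\<beta> t = \<gamma> (t / (real (N t) * real n)) [^] (n * N t)"
      unfolding \<beta>_def by (rule refine[OF Np n(1) N])
    also have "\<dots> = \<gamma> (t / (real n * real (N t))) [^] (N t * n)" by (simp add: mult.commute)
    also have "\<dots> = \<gamma> (t / real n) [^] n" by (rule refine[OF n(1) Np n(2), symmetric])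
    finally show ?thesis .
  qed
  show ?thesis
  proof (rule that[of \<beta>])
    fix t assume "\<bar>t\<bar> \<le> \<epsilon>"
    then show "\<beta> t = \<gamma> t" using indep[of 1 t] by simp
  next
    fix s t
    define n where "n = N (\<bar>s\<bar> + \<bar>t\<bar>)"
    have n: "n > 0" by (simp add: n_def N_def)
    have le: "(\<bar>s\<bar> + \<bar>t\<bar>) / real n \<le> \<epsilon>" using N[of "\<bar>s\<bar> + \<bar>t\<bar>"] n by (simp add: n_def)
    have sn: "\<bar>s / real n\<bar> \<le> \<epsilon>" and tn: "\<bar>t / real n\<bar> \<le> \<epsilon>" and stn: "\<bar>(s + t) / real n\<bar> \<le> \<epsilon>"
      using n by (auto simp: abs_divide intro!: order_trans[OF divide_right_mono le])
    have com: "\<gamma> (s / real n) \<otimes> \<gamma> (t / real n) = \<gamma> (t / real n) \<otimes> \<gamma> (s / real n)"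
      using hom[OF sn tn] hom[OF tn sn] by (simp add: add.commute)
    have "\<beta> (s + t) = \<gamma> (s / real n + t / real n) [^] n"
      using indep[OF n stn] by (simp add: add_divide_distrib)
    also have "\<dots> = (\<gamma> (s / real n) \<otimes> \<gamma> (t / real n)) [^] n" by (simp add: hom[OF sn tn])
    also have "\<dots> = \<gamma> (s / real n) [^] n \<otimes> \<gamma> (t / real n) [^] n"
      by (rule pow_mult_distrib[OF com]) simp_all
    also have "\<dots> = \<beta> s \<otimes> \<beta> t" using indep[OF n sn] indep[OF n tn] by simp
    finally show "\<beta> (s + t) = \<beta> s \<otimes> \<beta> t" .
  qed
qed

lemma (in group) homs_agree_near_zero_imp_eq:
  fixes \<beta> \<gamma> :: "real \<Rightarrow> 'a"
  assumes UNIV: "carrier G = UNIV" and \<epsilon>: "\<epsilon> > 0"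
    and \<beta>: "\<And>s t. \<beta> (s + t) = \<beta> s \<otimes> \<beta> t" and \<gamma>: "\<And>s t. \<gamma> (s + t) = \<gamma> s \<otimes> \<gamma> t"
    and eq: "\<And>t. \<bar>t\<bar> \<le> \<epsilon> \<Longrightarrow> \<beta> t = \<gamma> t"
  shows "\<beta> = \<gamma>"
proof
  have cG [simp]: "x \<in> carrier G" for x using UNIV by simp
  have pow: "\<alpha> (real n * t) = \<alpha> t [^] n" if \<alpha>: "\<And>s t. \<alpha> (s + t) = \<alpha> s \<otimes> \<alpha> t" for \<alpha> :: "real \<Rightarrow> 'a" and n t
  proof (induction n)
    case 0
    have "\<alpha> 0 = \<one>" using \<alpha>[of 0 0] r_cancel_one'[of "\<alpha> 0" "\<alpha> 0"] by simp
    then show ?case by simp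
  next
    case (Suc n)
    have "\<alpha> (real (Suc n) * t) = \<alpha> (real n * t + t)" by (simp add: distrib_right add.commute)
    then show ?case using Suc by (simp add: \<alpha>)
  qed
  fix t
  obtain n :: nat where n: "real n > \<bar>t\<bar> / \<epsilon>" "n > 0"
    using reals_Archimedean2[of "\<bar>t\<bar> / \<epsilon>"] \<epsilon> by (metis divide_nonneg_pos abs_ge_zero le_less_trans of_nat_0_less_iff)
  then have "\<bar>t / real n\<bar> \<le> \<epsilon>" using \<epsilon> by (simp add: field_simps)
  from eq[OF this] have "\<beta> (real n * (t / real n)) = \<gamma> (real n * (t / real n))"
    by (simp only: pow[OF \<beta>] pow[OF \<gamma>])
  then show "\<beta> t = \<gamma> t" using n by simp
qed

section \<open>One-parameter subgroups\<close>

lemma isCont_eventually_in: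
  assumes "isCont f x" "open S" "f x \<in> S"
  shows "eventually (\<lambda>t. f t \<in> S) (nhds x)"
proof -
  have "eventually (\<lambda>t. f t \<in> S) (at x)"
    using topological_tendstoD[OF assms(1)[unfolded isCont_def] assms(2,3)] .
  then have "eventually (\<lambda>t. t \<noteq> x \<longrightarrow> f t \<in> S) (nhds x)" by (simp add: eventually_at_filter)
  then show ?thesis by (rule eventually_mono) (use assms(3) in blast)
qed

lemma smooth_map_real_atlas:
  assumes "smooth_map real_atlas A \<gamma>"
  shows "continuous_on UNIV \<gamma>" and "d \<in> A \<Longrightarrow> smooth_on (\<gamma> -` fst d) (snd d \<circ> \<gamma>)"
proof -
  have inv: "chart_inv (UNIV, id) = (id :: real \<Rightarrow> real)" by (simp add: chart_inv_def inv_id)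
  show "continuous_on UNIV \<gamma>" using assms by (simp add: smooth_map_def)
  show "smooth_on (\<gamma> -` fst d) (snd d \<circ> \<gamma>)" if "d \<in> A"
    using assms that by (simp add: smooth_map_def real_atlas_def inv)
qed

lemma smooth_map_real_atlasI:
  assumes "continuous_on UNIV \<gamma>" "\<And>d. d \<in> A \<Longrightarrow> smooth_on (\<gamma> -` fst d) (snd d \<circ> \<gamma>)"
  shows "smooth_map real_atlas A \<gamma>"
proof -
  have inv: "chart_inv (UNIV, id) = (id :: real \<Rightarrow> real)" by (simp add: chart_inv_def inv_id)
  show ?thesis using assms by (simp add: smooth_map_def real_atlas_def inv)
qed

context lie_group
begin

lemma manifold: "smooth_manifold A" ..

lemma in_carrier [simp]: "x \<in> carrier G" by (simp add: carrier_UNIV)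

lemma left_mult_smooth: "smooth_map A A (\<lambda>k. h \<otimes> k)"
  using smooth_map_slice(1)[OF manifold manifold manifold mult_smooth, of h] by simp

lemma right_mult_smooth: "smooth_map A A (\<lambda>k. k \<otimes> h)"
  using smooth_map_slice(2)[OF manifold manifold manifold mult_smooth, of h] by simp

definition unit_chart :: "('g, 'e) chart" where
  "unit_chart = (SOME c. c \<in> A \<and> \<one> \<in> fst c)"

lemma unit_chart: "unit_chart \<in> A" "\<one> \<in> fst unit_chart"
  using someI_ex[of "\<lambda>c. c \<in> A \<and> \<one> \<in> fst c"] ex_chart[of "\<one>"] unfolding unit_chart_def by blast+

text \<open>Coordinate map, inverse and range of the chart around the identity.\<close>

abbreviation cc :: "'g \<Rightarrow> 'e" where "cc \<equiv> snd unit_chart"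
abbreviation ci :: "'e \<Rightarrow> 'g" where "ci \<equiv> chart_inv unit_chart"
abbreviation cr :: "'e set" where "cr \<equiv> cc ` fst unit_chart"

lemma ci_cc: "p \<in> fst unit_chart \<Longrightarrow> ci (cc p) = p"
  by (rule chart_inv_left[OF unit_chart(1)])

lemma cc_ci: "y \<in> cr \<Longrightarrow> cc (ci y) = y"
  by (rule chart_inv_right[OF unit_chart(1)])

lemma ci_in: "y \<in> cr \<Longrightarrow> ci y \<in> fst unit_chart"
  by (rule chart_inv_in[OF unit_chart(1)])

lemma cc_one_in: "cc \<one> \<in> cr" using unit_chart(2) by blast

lemma open_cr: "open cr" by (rule open_range[OF unit_chart(1)])

lemma ci_one: "ci (cc \<one>) = \<one>" by (rule ci_cc[OF unit_chart(2)])

text \<open>The multiplication, and the left-invariant vector field with value \<open>v\<close> at the identity, in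
  the chart around the identity.\<close>

definition chart_mult :: "'e \<times> 'e \<Rightarrow> 'e" where
  "chart_mult = (\<lambda>(u, w). cc (ci u \<otimes> ci w))"

definition mult_domain :: "('e \<times> 'e) set" where
  "mult_domain = {(u, w). u \<in> cr \<and> w \<in> cr \<and> ci u \<otimes> ci w \<in> fst unit_chart}"

definition left_field :: "'e \<Rightarrow> 'e \<Rightarrow> 'e" where
  "left_field v y = frechet_derivative chart_mult (at (y, cc \<one>)) (0, v)"

lemma open_mult_domain: "open mult_domain"
  using smooth_map_prod_chart_rep(1)[OF manifold manifold mult_smooth unit_chart(1) unit_chart(1) unit_chart(1)
      open_domain[OF unit_chart(1)]] by (simp add: mult_domain_def)

lemma smooth_chart_mult: "smooth_on mult_domain chart_mult"
  using smooth_map_prod_chart_rep(2)[OF manifold manifold mult_smooth unit_chart(1) unit_chart(1) unit_chart(1)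
      open_domain[OF unit_chart(1)]] by (simp add: mult_domain_def chart_mult_def)

lemma unit_in_mult_domain: "y \<in> cr \<Longrightarrow> (y, cc \<one>) \<in> mult_domain"
  using cc_one_in ci_in by (simp add: mult_domain_def ci_one)

lemma left_field_smooth: "smooth_on cr (left_field v)"
proof -
  have "smooth_on cr (\<lambda>y. (\<lambda>z. frechet_derivative chart_mult (at z) (0, v)) (y, cc \<one>))"
    by (rule smooth_on_compose[OF open_cr open_mult_domain _ smooth_on_derivative[OF smooth_chart_mult]])
       (use unit_in_mult_domain smooth_on_Pair[OF open_cr smooth_on_id[OF open_cr] smooth_on_const] in auto)
  then show ?thesis by (simp add: left_field_def[abs_def])
qed

lemma left_field_has_derivative:
  assumes "y \<in> cr"
  shows "((\<lambda>w. chart_mult (y, w)) has_derivative (\<lambda>v. left_field v y)) (at (cc \<one>))"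
proof -
  have "((\<lambda>w. (y, w)) has_derivative (\<lambda>v. (0, v))) (at (cc \<one>))"
    by (intro has_derivative_Pair has_derivative_const has_derivative_ident)
  moreover have "(chart_mult has_derivative frechet_derivative chart_mult (at (y, cc \<one>))) (at (y, cc \<one>))"
    by (rule smooth_on_has_derivative[OF smooth_chart_mult unit_in_mult_domain[OF assms]])
  ultimately have "(chart_mult \<circ> (\<lambda>w. (y, w)) has_derivative
      frechet_derivative chart_mult (at (y, cc \<one>)) \<circ> (\<lambda>v. (0, v))) (at (cc \<one>))"
    by (rule diff_chain_at)
  then show ?thesis by (simp add: comp_def left_field_def[abs_def])
qed

lemma left_field_unit: "left_field v (cc \<one>) = v"
proof -
  have "((\<lambda>w. w) has_derivative (\<lambda>v. left_field v (cc \<one>))) (at (cc \<one>))"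
  proof (rule has_derivative_transform_within_open[OF left_field_has_derivative[OF cc_one_in] open_cr cc_one_in])
    fix w assume "w \<in> cr"
    then show "chart_mult (cc \<one>, w) = w" by (simp add: chart_mult_def ci_one cc_ci)
  qed
  from has_derivative_unique[OF this has_derivative_ident] show ?thesis by meson
qed

text \<open>Differentiating \<open>h (y w) = (h y) w\<close> in \<open>w\<close> at the identity.\<close>

lemma left_field_invariant:
  assumes y: "y \<in> cr" and h: "h \<otimes> ci y \<in> fst unit_chart"
  shows "frechet_derivative (cc \<circ> (\<lambda>k. h \<otimes> k) \<circ> ci) (at y) (left_field v y) = left_field v (cc (h \<otimes> ci y))"
proof -
  let ?L = "cc \<circ> (\<lambda>k. h \<otimes> k) \<circ> ci"
  have Ly: "cc (h \<otimes> ci y) \<in> cr" using h by blast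
  have L: "(?L has_derivative frechet_derivative ?L (at y)) (at y)"
    using differentiable_map_at_has_derivative[OF smooth_map_differentiable_at[OF left_mult_smooth[of h]]
        unit_chart(1) unit_chart(1) ci_in[OF y]] h by (simp add: cc_ci[OF y])
  have my: "chart_mult (y, cc \<one>) = y" using y by (simp add: chart_mult_def ci_one cc_ci)
  have "(?L \<circ> (\<lambda>w. chart_mult (y, w)) has_derivative frechet_derivative ?L (at y) \<circ> (\<lambda>v. left_field v y))
      (at (cc \<one>))"
    using diff_chain_at[OF left_field_has_derivative[OF y]] L by (simp add: my)
  moreover define W where "W = {w \<in> cr. (y, w) \<in> mult_domain}"
  have "W = (\<lambda>w. (y, w)) -` mult_domain" using y by (auto simp: W_def mult_domain_def)
  then have "open W" by (simp add: open_vimage[OF open_mult_domain] continuous_on_Pair)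
  moreover have "cc \<one> \<in> W" using cc_one_in unit_in_mult_domain[OF y] by (simp add: W_def)
  moreover have "(?L \<circ> (\<lambda>w. chart_mult (y, w))) w = chart_mult (cc (h \<otimes> ci y), w)" if "w \<in> W" for w
    using that ci_cc[OF h] by (simp add: W_def mult_domain_def chart_mult_def ci_cc m_assoc)
  ultimately have "((\<lambda>w. chart_mult (cc (h \<otimes> ci y), w)) has_derivative
      frechet_derivative ?L (at y) \<circ> (\<lambda>v. left_field v y)) (at (cc \<one>))"
    by (rule has_derivative_transform_within_open)
  from fun_cong[OF has_derivative_unique[OF this left_field_has_derivative[OF Ly]], of v]
  show ?thesis by simp
qed

lemma one_parameter_subgroup_zero:
  assumes "\<And>s t. \<gamma> (s + t) = \<gamma> s \<otimes> \<gamma> t"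
  shows "\<gamma> (0::real) = \<one>"
  using assms[of 0 0] r_cancel_one'[of "\<gamma> 0" "\<gamma> 0"] by simp

text \<open>Differentiating \<open>\<gamma> (t + s) = \<gamma> t \<gamma> s\<close> in \<open>s\<close> at \<open>0\<close>.\<close>

lemma one_parameter_subgroup_ode:
  assumes \<gamma>: "one_parameter_subgroup G A \<gamma>" and t: "\<gamma> t \<in> fst unit_chart"
  shows "(cc \<circ> \<gamma> has_vector_derivative left_field (velocity A \<gamma> 0 unit_chart) (cc (\<gamma> t))) (at t)"
proof -
  let ?v = "velocity A \<gamma> 0 unit_chart"
  have sm: "smooth_map real_atlas A \<gamma>" and hom: "\<And>s t. \<gamma> (s + t) = \<gamma> s \<otimes> \<gamma> t"
    using \<gamma> by (auto simp: one_parameter_subgroup_def)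
  have cont: "continuous_on UNIV \<gamma>" by (rule smooth_map_real_atlas(1)[OF sm])
  have g0: "\<gamma> 0 = \<one>" by (rule one_parameter_subgroup_zero[OF hom])
  have "(cc \<circ> \<gamma>) differentiable (at 0)"
    by (rule smooth_on_differentiable[OF smooth_map_real_atlas(2)[OF sm unit_chart(1)]])
       (simp add: g0 unit_chart)
  then have "(cc \<circ> \<gamma> has_vector_derivative vector_derivative (cc \<circ> \<gamma>) (at 0)) (at 0)"
    by (rule vector_derivative_works[THEN iffD1])
  then have z: "(cc \<circ> \<gamma> has_derivative (\<lambda>h. h *\<^sub>R ?v)) (at 0)"
    by (simp add: velocity_def g0 unit_chart has_vector_derivative_def)
  have y: "cc (\<gamma> t) \<in> cr" using t by blast
  define W where "W = \<gamma> -` fst unit_chart"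
  have W: "open W" unfolding W_def by (rule open_vimage[OF open_domain[OF unit_chart(1)] cont])
  have comp: "((\<lambda>w. chart_mult (cc (\<gamma> t), w)) \<circ> (cc \<circ> \<gamma>) has_derivative
      (\<lambda>v. left_field v (cc (\<gamma> t))) \<circ> (\<lambda>h. h *\<^sub>R ?v)) (at 0)"
    using left_field_has_derivative[OF y] by (intro diff_chain_at[OF z]) (simp add: g0)
  have lin: "(\<lambda>v. left_field v (cc (\<gamma> t))) \<circ> (\<lambda>h. h *\<^sub>R ?v) = (\<lambda>h. h *\<^sub>R left_field ?v (cc (\<gamma> t)))"
    by (simp add: comp_def linear_scale[OF has_derivative_linear[OF left_field_has_derivative[OF y]]])
  have "0 \<in> W" by (simp add: W_def g0 unit_chart)
  moreover have "((\<lambda>w. chart_mult (cc (\<gamma> t), w)) \<circ> (cc \<circ> \<gamma>)) s = (cc \<circ> \<gamma>) (t + s)" if "s \<in> W" for s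
    using that t by (simp add: W_def chart_mult_def ci_cc hom)
  ultimately have "((\<lambda>s. (cc \<circ> \<gamma>) (t + s)) has_derivative (\<lambda>h. h *\<^sub>R left_field ?v (cc (\<gamma> t)))) (at 0)"
    by (rule has_derivative_transform_within_open[OF comp[unfolded lin] W])
  then have shifted: "((\<lambda>s. (cc \<circ> \<gamma>) (t + s)) has_derivative (\<lambda>h. h *\<^sub>R left_field ?v (cc (\<gamma> t)))) (at (t - t))"
    by simp
  have "((\<lambda>s. s - t) has_derivative (\<lambda>h. h)) (at t)"
    by (auto intro!: derivative_eq_intros)
  from diff_chain_at[OF this shifted]
  show ?thesis by (simp add: has_vector_derivative_def comp_def)
qed

text \<open>Near \<open>0\<close> both are integral curves of the same Lipschitz field with the same initial value; a
  homomorphism is determined by its values near \<open>0\<close>.\<close>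

lemma one_parameter_subgroup_unique:
  assumes \<beta>: "one_parameter_subgroup G A \<beta>" and \<gamma>: "one_parameter_subgroup G A \<gamma>"
    and v: "velocity A \<beta> 0 = velocity A \<gamma> 0"
  shows "\<beta> = \<gamma>"
proof -
  let ?F = "left_field (velocity A \<gamma> 0 unit_chart)"
  obtain r K where r: "r > 0" and K: "K > 0" and ball: "cball (cc \<one>) r \<subseteq> cr"
    and lip: "\<And>y z. y \<in> cball (cc \<one>) r \<Longrightarrow> z \<in> cball (cc \<one>) r \<Longrightarrow> norm (?F y - ?F z) \<le> K * norm (y - z)"
    using smooth_on_locally_lipschitz[OF open_cr left_field_smooth cc_one_in] by metis
  have near: "\<exists>a>0. \<forall>t. \<bar>t\<bar> < a \<longrightarrow> \<alpha> t \<in> fst unit_chart \<and> cc (\<alpha> t) \<in> cball (cc \<one>) r"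
    if "one_parameter_subgroup G A \<alpha>" for \<alpha>
  proof -
    have sm: "smooth_map real_atlas A \<alpha>" and hom: "\<And>s t. \<alpha> (s + t) = \<alpha> s \<otimes> \<alpha> t"
      using that by (auto simp: one_parameter_subgroup_def)
    have g0: "\<alpha> 0 = \<one>" by (rule one_parameter_subgroup_zero[OF hom])
    have cont: "isCont \<alpha> 0"
      using smooth_map_real_atlas(1)[OF sm] by (simp add: continuous_on_eq_continuous_at)
    have 1: "eventually (\<lambda>t. \<alpha> t \<in> fst unit_chart) (nhds 0)"
      using unit_chart(2) by (intro isCont_eventually_in[OF cont open_domain[OF unit_chart(1)]]) (simp add: g0)
    have "isCont (\<lambda>t. cc (\<alpha> t)) 0"
      using continuous_at_compose[OF cont] isCont_chart[OF unit_chart] by (simp add: g0 comp_def)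
    then have 2: "eventually (\<lambda>t. cc (\<alpha> t) \<in> ball (cc \<one>) r) (nhds 0)"
      using r by (intro isCont_eventually_in[OF _ open_ball]) (simp_all add: g0)
    from eventually_conj[OF 1 2] obtain d where "d > 0"
      "\<And>t. dist t 0 < d \<Longrightarrow> \<alpha> t \<in> fst unit_chart \<and> cc (\<alpha> t) \<in> ball (cc \<one>) r"
      unfolding eventually_nhds_metric by blast
    then show ?thesis using ball_subset_cball by (intro exI[of _ d]) (auto simp: dist_norm less_imp_le)
  qed
  obtain a1 where a1: "a1 > 0" "\<And>t. \<bar>t\<bar> < a1 \<Longrightarrow> \<beta> t \<in> fst unit_chart \<and> cc (\<beta> t) \<in> cball (cc \<one>) r"
    using near[OF \<beta>] by blast
  obtain a2 where a2: "a2 > 0" "\<And>t. \<bar>t\<bar> < a2 \<Longrightarrow> \<gamma> t \<in> fst unit_chart \<and> cc (\<gamma> t) \<in> cball (cc \<one>) r"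
    using near[OF \<gamma>] by blast
  define a where "a = min (min a1 a2 / 2) (1 / (2 * K))"
  have "K * (1 / (2 * K)) = 1 / 2" using K by simp
  moreover have "a \<le> 1 / (2 * K)" by (simp add: a_def)
  ultimately have "K * a \<le> 1/2" using K by (metis mult_left_mono less_imp_le)
  then have a: "a > 0" "a < a1" "a < a2" "K * a < 1"
    using a1(1) a2(1) K by (auto simp: a_def)
  have b0: "\<beta> 0 = \<one>" and c0: "\<gamma> 0 = \<one>"
    using \<beta> \<gamma> one_parameter_subgroup_zero by (auto simp: one_parameter_subgroup_def)
  have "\<beta> t = \<gamma> t" if t: "\<bar>t\<bar> \<le> a" for t
  proof -
    have "(cc \<circ> \<beta>) t = (cc \<circ> \<gamma>) t"
    proof (rule ode_local_uniqueness[OF lip a(4) K])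
      fix s assume s: "s \<in> {-a..a}"
      then have sb: "\<beta> s \<in> fst unit_chart \<and> cc (\<beta> s) \<in> cball (cc \<one>) r"
        and sc: "\<gamma> s \<in> fst unit_chart \<and> cc (\<gamma> s) \<in> cball (cc \<one>) r"
        using a1(2)[of s] a2(2)[of s] a by auto
      show "(cc \<circ> \<beta>) s \<in> cball (cc \<one>) r \<and> (cc \<circ> \<beta> has_vector_derivative ?F ((cc \<circ> \<beta>) s)) (at s)"
        using sb one_parameter_subgroup_ode[OF \<beta>, of s] by (simp add: v)
      show "(cc \<circ> \<gamma>) s \<in> cball (cc \<one>) r \<and> (cc \<circ> \<gamma> has_vector_derivative ?F ((cc \<circ> \<gamma>) s)) (at s)"
        using sc one_parameter_subgroup_ode[OF \<gamma>, of s] by simp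
    qed (use t b0 c0 in auto)
    then show ?thesis using a1(2)[of t] a2(2)[of t] t a ci_cc unfolding comp_apply by (metis le_less_trans)
  qed
  then show ?thesis
    using \<beta> \<gamma> by (intro homs_agree_near_zero_imp_eq[OF carrier_UNIV a(1)])
      (auto simp: one_parameter_subgroup_def)
qed

text \<open>Let \<open>y\<close> be the local integral curve of the left-invariant field through the identity.  For small
  fixed \<open>s\<close> the curves \<open>t \<mapsto> y (s + t)\<close> and \<open>t \<mapsto> y s \<cdot> y t\<close> are integral curves with the same
  initial value, the second by left invariance, so they agree.  Hence \<open>y\<close> is a local homomorphism.
  It extends to the whole line, and the extension is smooth because near \<open>t\<^sub>0\<close> it is a left translate
  of \<open>y\<close>.\<close>

lemma one_parameter_subgroup_exists:
  assumes X: "X \<in> lie_algebra G A"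
  shows "\<exists>\<gamma>. one_parameter_subgroup G A \<gamma> \<and> velocity A \<gamma> 0 = X"
proof -
  define v where "v = X unit_chart"
  let ?F = "left_field v"
  obtain r K where r: "r > 0" and K: "K > 0" and ball: "cball (cc \<one>) r \<subseteq> cr"
    and lip: "\<And>y z. y \<in> cball (cc \<one>) r \<Longrightarrow> z \<in> cball (cc \<one>) r \<Longrightarrow> norm (?F y - ?F z) \<le> K * norm (y - z)"
    using smooth_on_locally_lipschitz[OF open_cr left_field_smooth cc_one_in] by metis
  obtain a y where a: "a > 0" and y0: "y 0 = cc \<one>" and yb: "\<And>t. t \<in> {-a..a} \<Longrightarrow> y t \<in> cball (cc \<one>) r"
    and yd: "\<And>t. t \<in> {-a<..<a} \<Longrightarrow> (y has_vector_derivative ?F (y t)) (at t)"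
    using picard_local_solution[OF r K lip] by metis
  have ycr: "y t \<in> cr" if "\<bar>t\<bar> < a" for t
    using that by (intro subsetD[OF ball] yb) auto
  have ysm: "smooth_on {-a<..<a} y"
    by (rule ode_solution_smooth[OF _ open_cr _ left_field_smooth yd]) (use ycr in auto)
  have ycont: "isCont y t" if "\<bar>t\<bar> < a" for t
    by (rule has_vector_derivative_continuous[OF yd]) (use that in auto)
  define \<gamma>0 where "\<gamma>0 t = ci (y t)" for t
  have g0: "\<gamma>0 0 = \<one>" by (simp add: \<gamma>0_def y0 ci_one)
  have g_in: "\<gamma>0 t \<in> fst unit_chart" if "\<bar>t\<bar> < a" for t
    unfolding \<gamma>0_def by (rule ci_in[OF ycr[OF that]])
  have cc_g: "cc (\<gamma>0 t) = y t" if "\<bar>t\<bar> < a" for t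
    unfolding \<gamma>0_def by (rule cc_ci[OF ycr[OF that]])
  \<comment> \<open>close to the identity, products stay in the ball where the Lipschitz estimate holds\<close>
  have "\<exists>\<delta>>0. \<forall>s t. \<bar>s\<bar> < \<delta> \<longrightarrow> \<bar>t\<bar> < \<delta> \<longrightarrow>
      (y s, y t) \<in> mult_domain \<and> chart_mult (y s, y t) \<in> cball (cc \<one>) r"
  proof -
    define V where "V = chart_mult -` ball (cc \<one>) r \<inter> mult_domain"
    have V: "open V"
      unfolding V_def using smooth_on_continuous[OF smooth_chart_mult] continuous_on_open_vimage[OF open_mult_domain]
      by blast
    have "(cc \<one>, cc \<one>) \<in> V"
      using r unit_in_mult_domain[OF cc_one_in] by (simp add: V_def chart_mult_def ci_one)
    then obtain U1 U2 where U: "open U1" "open U2" "cc \<one> \<in> U1" "cc \<one> \<in> U2" "U1 \<times> U2 \<subseteq> V"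
      using V by (metis open_prod_elim mem_Sigma_iff)
    have "eventually (\<lambda>t. y t \<in> U1 \<inter> U2) (nhds 0)"
      using ycont[of 0] a U by (intro isCont_eventually_in) (simp_all add: y0 open_Int)
    then obtain \<delta> where "\<delta> > 0" "\<And>t. \<bar>t\<bar> < \<delta> \<Longrightarrow> y t \<in> U1 \<inter> U2"
      unfolding eventually_nhds_metric by (auto simp: dist_norm)
    then have "(y s, y t) \<in> V" if "\<bar>s\<bar> < \<delta>" "\<bar>t\<bar> < \<delta>" for s t using that U(5) by blast
    then have "(y s, y t) \<in> mult_domain \<and> chart_mult (y s, y t) \<in> cball (cc \<one>) r"
      if "\<bar>s\<bar> < \<delta>" "\<bar>t\<bar> < \<delta>" for s t
      using that ball_subset_cball[of "cc \<one>" r] unfolding V_def by blast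
    then show ?thesis using \<open>\<delta> > 0\<close> by blast
  qed
  then obtain \<delta> where \<delta>: "\<delta> > 0"
    and md: "\<And>s t. \<bar>s\<bar> < \<delta> \<Longrightarrow> \<bar>t\<bar> < \<delta> \<Longrightarrow> (y s, y t) \<in> mult_domain"
    and mb: "\<And>s t. \<bar>s\<bar> < \<delta> \<Longrightarrow> \<bar>t\<bar> < \<delta> \<Longrightarrow> chart_mult (y s, y t) \<in> cball (cc \<one>) r"
    by blast
  define \<epsilon> where "\<epsilon> = min (min \<delta> a / 3) (1 / (2 * K))"
  have "K * (1 / (2 * K)) = 1 / 2" using K by simp
  moreover have "\<epsilon> \<le> 1 / (2 * K)" by (simp add: \<epsilon>_def)
  ultimately have "K * \<epsilon> \<le> 1/2" using K by (metis mult_left_mono less_imp_le)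
  then have \<epsilon>: "\<epsilon> > 0" "\<epsilon> < \<delta>" "2 * \<epsilon> < a" "K * \<epsilon> < 1"
    using \<delta> a K by (auto simp: \<epsilon>_def)
  have hom: "\<gamma>0 (s + t) = \<gamma>0 s \<otimes> \<gamma>0 t" if s: "\<bar>s\<bar> \<le> \<epsilon>" and t: "\<bar>t\<bar> \<le> \<epsilon>" for s t
  proof -
    have prod_in: "\<gamma>0 s \<otimes> \<gamma>0 u \<in> fst unit_chart" if "\<bar>u\<bar> \<le> \<epsilon>" for u
      using md[of s u] s that \<epsilon> by (simp add: mult_domain_def \<gamma>0_def)
    have "y (s + t) = cc (\<gamma>0 s \<otimes> \<gamma>0 t)"
    proof (rule ode_local_uniqueness[OF lip \<epsilon>(4) K, where y="\<lambda>t. y (s + t)"])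
      fix u assume u: "u \<in> {-\<epsilon>..\<epsilon>}"
      have su: "s + u \<in> {-a<..<a}" "u \<in> {-a<..<a}" "\<bar>u\<bar> < a" "\<bar>u\<bar> \<le> \<epsilon>" "\<bar>s + u\<bar> < a" "\<bar>u\<bar> < \<delta>" "\<bar>s\<bar> < \<delta>"
        using s u \<epsilon> by auto
      have "((\<lambda>u. s + u) has_vector_derivative 1) (at u)"
        by (auto intro!: derivative_eq_intros)
      then have "(y \<circ> (\<lambda>u. s + u) has_vector_derivative 1 *\<^sub>R ?F (y (s + u))) (at u)"
        using yd[OF su(1)] by (rule vector_diff_chain_at)
      then show "y (s + u) \<in> cball (cc \<one>) r \<and> ((\<lambda>u. y (s + u)) has_vector_derivative ?F (y (s + u))) (at u)"
        using yb[of "s + u"] su by (simp add: comp_def)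
      let ?L = "cc \<circ> (\<lambda>k. \<gamma>0 s \<otimes> k) \<circ> ci"
      have pin: "\<gamma>0 s \<otimes> ci (y u) \<in> fst unit_chart" using prod_in[OF su(4)] by (simp add: \<gamma>0_def)
      have "(?L has_derivative frechet_derivative ?L (at (y u))) (at (y u))"
        using differentiable_map_at_has_derivative[OF smooth_map_differentiable_at[OF left_mult_smooth[of "\<gamma>0 s"]]
          unit_chart(1) unit_chart(1) ci_in[OF ycr[OF su(3)]]] pin by (simp add: cc_ci[OF ycr[OF su(3)]])
      moreover have "(y has_derivative (\<lambda>h. h *\<^sub>R ?F (y u))) (at u)"
        using yd[OF su(2)] by (simp add: has_vector_derivative_def)
      ultimately have "(?L \<circ> y has_derivative frechet_derivative ?L (at (y u)) \<circ> (\<lambda>h. h *\<^sub>R ?F (y u))) (at u)"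
        by (rule diff_chain_at[rotated])
      moreover have "linear (frechet_derivative ?L (at (y u)))"
        using \<open>(?L has_derivative frechet_derivative ?L (at (y u))) (at (y u))\<close> by (rule has_derivative_linear)
      ultimately have "(?L \<circ> y has_vector_derivative ?F (cc (\<gamma>0 s \<otimes> \<gamma>0 u))) (at u)"
        using left_field_invariant[OF ycr[OF su(3)] pin, of v]
        by (simp add: has_vector_derivative_def comp_def linear_scale \<gamma>0_def)
      then show "cc (\<gamma>0 s \<otimes> \<gamma>0 u) \<in> cball (cc \<one>) r \<and>
          ((\<lambda>u. cc (\<gamma>0 s \<otimes> \<gamma>0 u)) has_vector_derivative ?F (cc (\<gamma>0 s \<otimes> \<gamma>0 u))) (at u)"
        using mb[of s u] su by (simp add: comp_def chart_mult_def \<gamma>0_def)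
    next
      show "y (s + 0) = cc (\<gamma>0 s \<otimes> \<gamma>0 0)" using cc_g[of s] s \<epsilon> by (simp add: g0)
      show "t \<in> {-\<epsilon>..\<epsilon>}" using t by auto
    qed
    then show ?thesis unfolding \<gamma>0_def[of "s + t"] using prod_in[OF t] by (simp add: ci_cc)
  qed
  obtain \<gamma> where ghom: "\<And>s t. \<gamma> (s + t) = \<gamma> s \<otimes> \<gamma> t" and geq: "\<And>t. \<bar>t\<bar> \<le> \<epsilon> \<Longrightarrow> \<gamma> t = \<gamma>0 t"
    using local_hom_extends[OF carrier_UNIV \<epsilon>(1) hom] by metis
  have g_shift: "\<gamma> t = \<gamma> t0 \<otimes> ci (y (t - t0))" if "\<bar>t - t0\<bar> \<le> \<epsilon>" for t t0
    using ghom[of t0 "t - t0"] geq[OF that] by (simp add: \<gamma>0_def)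
  have gcont: "continuous_on UNIV \<gamma>"
  proof -
    have "isCont \<gamma> t0" for t0
    proof -
      have "isCont (\<lambda>k. \<gamma> t0 \<otimes> k) \<one>"
        using left_mult_smooth[of "\<gamma> t0"] by (simp add: smooth_map_def continuous_on_eq_continuous_at)
      moreover have "isCont (\<lambda>t. ci (y (t - t0))) t0"
      proof -
        have "isCont (\<lambda>t. y (t - t0)) t0"
          by (rule continuous_at_compose[of t0 "\<lambda>t. t - t0" y, unfolded comp_def])
             (use ycont[of 0] a in \<open>auto intro!: continuous_intros\<close>)
        moreover have "isCont ci (y (t0 - t0))"
          using isCont_chart_inv[OF unit_chart] by (simp add: y0)
        ultimately show ?thesis using continuous_at_compose[of t0 "\<lambda>t. y (t - t0)" ci] by (simp add: comp_def)
      qed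
      ultimately have "isCont (\<lambda>t. \<gamma> t0 \<otimes> ci (y (t - t0))) t0"
        using continuous_at_compose[of t0 "\<lambda>t. ci (y (t - t0))" "\<lambda>k. \<gamma> t0 \<otimes> k"] by (simp add: comp_def y0 ci_one)
      moreover have "eventually (\<lambda>t. \<gamma> t = \<gamma> t0 \<otimes> ci (y (t - t0))) (nhds t0)"
        unfolding eventually_nhds_metric using g_shift \<epsilon>(1) by (intro exI[of _ \<epsilon>]) (simp add: dist_norm)
      ultimately show ?thesis using isCont_cong[of \<gamma> "\<lambda>t. \<gamma> t0 \<otimes> ci (y (t - t0))" t0] by blast
    qed
    then show ?thesis by (simp add: continuous_at_imp_continuous_on)
  qed
  have "smooth_map real_atlas A \<gamma>"
  proof (rule smooth_map_real_atlasI[OF gcont])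
    fix d assume d: "d \<in> A"
    show "smooth_on (\<gamma> -` fst d) (snd d \<circ> \<gamma>)"
    proof (rule smooth_on_local)
      fix t0 assume "t0 \<in> \<gamma> -` fst d"
      then have t0: "\<gamma> t0 \<in> fst d" by simp
      define L where "L k = \<gamma> t0 \<otimes> k" for k
      define D where "D = cc ` (fst unit_chart \<inter> L -` fst d)"
      have L: "smooth_map A A L" using left_mult_smooth[of "\<gamma> t0"] by (simp add: L_def[abs_def])
      have oD: "open D"
        unfolding D_def using L open_domain[OF unit_chart(1)] open_domain[OF d]
        by (intro open_chart_image[OF unit_chart(1)] open_Int open_vimage) (auto simp: smooth_map_def)
      have smL: "smooth_on D (snd d \<circ> L \<circ> ci)" using L d unit_chart(1) by (simp add: smooth_map_def D_def)
      define I where "I = {t0 - \<epsilon><..<t0 + \<epsilon>} \<inter> \<gamma> -` fst d"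
      have oI: "open I" unfolding I_def by (intro open_Int open_vimage[OF open_domain[OF d] gcont]) simp
      have sub: "(\<lambda>t. t - t0) ` I \<subseteq> {-a<..<a}" using \<epsilon> by (auto simp: I_def)
      have "smooth_on I (\<lambda>t. t + (- t0))"
        by (intro smooth_on_add smooth_on_id smooth_on_const oI)
      then have smy: "smooth_on I (\<lambda>t. y (t - t0))"
        using smooth_on_compose[OF oI _ sub ysm] by simp
      have img: "(\<lambda>t. y (t - t0)) ` I \<subseteq> D"
      proof
        fix z assume "z \<in> (\<lambda>t. y (t - t0)) ` I"
        then obtain t where t: "t \<in> I" "z = y (t - t0)" by blast
        have tt: "\<bar>t - t0\<bar> \<le> \<epsilon>" "\<bar>t - t0\<bar> < a" using t(1) \<epsilon> by (auto simp: I_def)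
        have "L (ci z) \<in> fst d" using g_shift[OF tt(1)] t by (simp add: L_def I_def)
        then have "ci z \<in> fst unit_chart \<inter> L -` fst d" using ci_in[OF ycr[OF tt(2)]] t(2) by simp
        then have "cc (ci z) \<in> D" unfolding D_def by blast
        then show "z \<in> D" using cc_ci[OF ycr[OF tt(2)]] t(2) by simp
      qed
      have "smooth_on I (\<lambda>t. (snd d \<circ> L \<circ> ci) (y (t - t0)))"
        by (rule smooth_on_compose[OF oI oD img smL smy])
      then have "smooth_on I (snd d \<circ> \<gamma>)"
      proof (rule smooth_on_cong[OF oI, rotated])
        fix t assume "t \<in> I"
        then have "\<bar>t - t0\<bar> \<le> \<epsilon>" by (auto simp: I_def)
        from g_shift[OF this] show "(snd d \<circ> L \<circ> ci) (y (t - t0)) = (snd d \<circ> \<gamma>) t" by (simp add: L_def)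
      qed
      moreover have "t0 \<in> I" using t0 \<epsilon> by (simp add: I_def)
      ultimately show "\<exists>T. open T \<and> t0 \<in> T \<and> smooth_on T (snd d \<circ> \<gamma>)" using oI by blast
    qed
  qed
  then have "one_parameter_subgroup G A \<gamma>" using ghom by (simp add: one_parameter_subgroup_def)
  moreover have "velocity A \<gamma> 0 = X"
  proof -
    have G0: "\<gamma> 0 = \<one>" using geq[of 0] \<epsilon> g0 by simp
    have "(cc \<circ> \<gamma> has_derivative (\<lambda>h. h *\<^sub>R v)) (at 0)"
    proof (rule has_derivative_transform_within_open[of y _ _ _ "{-\<epsilon><..<\<epsilon>}"])
      show "(y has_derivative (\<lambda>h. h *\<^sub>R v)) (at 0)"
        using yd[of 0] a by (simp add: has_vector_derivative_def y0 left_field_unit)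
      show "y t = (cc \<circ> \<gamma>) t" if "t \<in> {-\<epsilon><..<\<epsilon>}" for t
      proof -
        have "\<bar>t\<bar> \<le> \<epsilon>" "\<bar>t\<bar> < a" using that \<epsilon> by auto
        then show ?thesis using geq[of t] cc_g[of t] by simp
      qed
    qed (use \<epsilon> in auto)
    then have "velocity A \<gamma> 0 = coord_vector A unit_chart (\<gamma> 0) v"
      using gcont unit_chart
      by (intro velocity_eq_coord_vector) (simp_all add: G0 has_vector_derivative_def continuous_on_eq_continuous_at)
    then show ?thesis
      using coord_vector_of_tangent[OF unit_chart] X by (simp add: G0 v_def lie_algebra_def)
  qed
  ultimately show ?thesis by blast
qed

text \<open>The one-parameter subgroup \<open>t \<mapsto> exp (t X)\<close>, from which \<open>lie_exp\<close> takes the value at \<open>1\<close>.\<close>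

definition exp_curve :: "('g, 'e) tangent \<Rightarrow> real \<Rightarrow> 'g" where
  "exp_curve X = (THE \<gamma>. one_parameter_subgroup G A \<gamma> \<and> velocity A \<gamma> 0 = X)"

lemma exp_curve:
  assumes "X \<in> lie_algebra G A"
  shows "one_parameter_subgroup G A (exp_curve X)" "velocity A (exp_curve X) 0 = X"
proof -
  have "\<exists>!\<gamma>. one_parameter_subgroup G A \<gamma> \<and> velocity A \<gamma> 0 = X"
    using one_parameter_subgroup_exists[OF assms] one_parameter_subgroup_unique by blast
  from theI'[OF this] show "one_parameter_subgroup G A (exp_curve X)" "velocity A (exp_curve X) 0 = X"
    by (simp_all add: exp_curve_def)
qed

lemma exp_curve_eqI:
  assumes "one_parameter_subgroup G A \<gamma>" "velocity A \<gamma> 0 = X"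
  shows "exp_curve X = \<gamma>"
  unfolding exp_curve_def using assms one_parameter_subgroup_unique by (intro the_equality) auto

lemma exp_curve_at_zero:
  assumes "X \<in> lie_algebra G A"
  shows "exp_curve X 0 = \<one>" and "isCont (exp_curve X) 0"
    and "(cc \<circ> exp_curve X has_vector_derivative X unit_chart) (at 0)"
proof -
  have sm: "smooth_map real_atlas A (exp_curve X)"
    and hom: "\<And>s t. exp_curve X (s + t) = exp_curve X s \<otimes> exp_curve X t"
    using exp_curve(1)[OF assms] by (auto simp: one_parameter_subgroup_def)
  show 0: "exp_curve X 0 = \<one>" by (rule one_parameter_subgroup_zero[OF hom])
  show "isCont (exp_curve X) 0"
    using smooth_map_real_atlas(1)[OF sm] by (simp add: continuous_on_eq_continuous_at)
  show "(cc \<circ> exp_curve X has_vector_derivative X unit_chart) (at 0)"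
    using one_parameter_subgroup_ode[OF exp_curve(1)[OF assms], of 0] unit_chart
    by (simp add: 0 exp_curve(2)[OF assms] left_field_unit)
qed

lemma lie_exp_scale:
  assumes X: "X \<in> lie_algebra G A"
  shows "lie_exp G A (\<lambda>c. t *\<^sub>R X c) = exp_curve X t"
proof -
  let ?\<gamma> = "\<lambda>s. exp_curve X (t * s)"
  have sm: "smooth_map real_atlas A (exp_curve X)"
    and hom: "\<And>s t. exp_curve X (s + t) = exp_curve X s \<otimes> exp_curve X t"
    using exp_curve(1)[OF X] by (auto simp: one_parameter_subgroup_def)
  have cont: "continuous_on UNIV ?\<gamma>"
    by (rule continuous_on_compose2[OF smooth_map_real_atlas(1)[OF sm]]) (auto intro!: continuous_intros)
  have "smooth_map real_atlas A ?\<gamma>"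
  proof (rule smooth_map_real_atlasI[OF cont])
    fix d assume d: "d \<in> A"
    have o1: "open (?\<gamma> -` fst d)" by (rule open_vimage[OF open_domain[OF d] cont])
    have o2: "open (exp_curve X -` fst d)"
      by (rule open_vimage[OF open_domain[OF d] smooth_map_real_atlas(1)[OF sm]])
    have "smooth_on (?\<gamma> -` fst d) (\<lambda>s. (snd d \<circ> exp_curve X) (t * s))"
      by (rule smooth_on_compose[OF o1 o2 _ smooth_map_real_atlas(2)[OF sm d]
            smooth_on_linear[OF o1 bounded_linear_mult_right]]) auto
    then show "smooth_on (?\<gamma> -` fst d) (snd d \<circ> ?\<gamma>)" by (simp add: comp_def)
  qed
  then have ops: "one_parameter_subgroup G A ?\<gamma>"
    by (simp add: one_parameter_subgroup_def distrib_left hom)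
  have tX: "(\<lambda>c. t *\<^sub>R X c) \<in> lie_algebra G A"
    using tangent_space_scale X by (simp add: lie_algebra_def)
  have "((\<lambda>s. t * s) has_vector_derivative t) (at 0)"
    by (auto intro!: derivative_eq_intros)
  moreover have "(cc \<circ> exp_curve X has_vector_derivative X unit_chart) (at (t * 0))"
    using exp_curve_at_zero(3)[OF X] by simp
  ultimately have "((cc \<circ> exp_curve X) \<circ> (\<lambda>s. t * s) has_vector_derivative t *\<^sub>R X unit_chart) (at 0)"
    by (rule vector_diff_chain_at)
  then have "velocity A ?\<gamma> 0 = coord_vector A unit_chart (?\<gamma> 0) (t *\<^sub>R X unit_chart)"
    using cont unit_chart exp_curve_at_zero(1)[OF X]
    by (intro velocity_eq_coord_vector) (simp_all add: comp_def continuous_on_eq_continuous_at)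
  also have "\<dots> = (\<lambda>c. t *\<^sub>R X c)"
    using coord_vector_of_tangent[OF unit_chart, of "\<lambda>c. t *\<^sub>R X c"] tX exp_curve_at_zero(1)[OF X]
    by (simp add: lie_algebra_def)
  finally have "exp_curve (\<lambda>c. t *\<^sub>R X c) = ?\<gamma>" by (rule exp_curve_eqI[OF ops])
  then show ?thesis by (simp add: lie_exp_def exp_curve_def[symmetric])
qed

end

section \<open>Finite-dimensional invariant spaces of functions\<close>

text \<open>A subfamily of least size that spans is independent, for a non-trivial relation would allow
  dropping one of its members.\<close>

lemma finite_family_spanned_by_independent:
  fixes f :: "'i \<Rightarrow> 'm \<Rightarrow> real"
  assumes "finite I"
  shows "\<exists>J\<subseteq>I. (\<forall>i\<in>I. \<exists>a. \<forall>x. f i x = (\<Sum>j\<in>J. a j * f j x)) \<and>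
    (\<forall>a. (\<forall>x. (\<Sum>j\<in>J. a j * f j x) = 0) \<longrightarrow> (\<forall>j\<in>J. a j = 0))"
proof -
  define spans where "spans J \<longleftrightarrow> J \<subseteq> I \<and> (\<forall>i\<in>I. \<exists>a. \<forall>x. f i x = (\<Sum>j\<in>J. a j * f j x))" for J
  have "spans I"
    unfolding spans_def
  proof (intro conjI ballI subset_refl)
    fix i assume "i \<in> I"
    then have "f i x = (\<Sum>j\<in>I. (if j = i then 1 else 0) * f j x)" for x
      using assms by (simp add: if_distrib[of "\<lambda>r. r * _"] cong: if_cong)
    then show "\<exists>a. \<forall>x. f i x = (\<Sum>j\<in>I. a j * f j x)"
      by (intro exI[of _ "\<lambda>j. if j = i then 1 else 0"] allI)
  qed
  then obtain J where J: "spans J" and minimal: "\<And>K. spans K \<Longrightarrow> card J \<le> card K"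
    using ex_has_least_nat[of spans I card] by blast
  have fin: "finite J" using J assms finite_subset by (auto simp: spans_def)
  have "a k = 0" if dep: "\<And>x. (\<Sum>j\<in>J. a j * f j x) = 0" and k: "k \<in> J" for a k
  proof (rule ccontr)
    assume ak: "a k \<noteq> 0"
    have fk: "f k x = - (\<Sum>j\<in>J - {k}. a j * f j x) / a k" for x
      using dep[of x] ak by (simp add: sum.remove[OF fin k] field_simps eq_neg_iff_add_eq_0)
    have "spans (J - {k})"
      unfolding spans_def
    proof (intro conjI ballI)
      show "J - {k} \<subseteq> I" using J by (auto simp: spans_def)
      fix i assume "i \<in> I"
      then obtain b where b: "\<And>x. f i x = (\<Sum>j\<in>J. b j * f j x)" using J unfolding spans_def by blast
      have "f i x = (\<Sum>j\<in>J - {k}. (b j - b k * a j / a k) * f j x)" for x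
      proof -
        have "(\<Sum>j\<in>J - {k}. (b j - b k * a j / a k) * f j x)
            = (\<Sum>j\<in>J - {k}. b j * f j x) - b k / a k * (\<Sum>j\<in>J - {k}. a j * f j x)"
          unfolding sum_distrib_left sum_subtractf[symmetric] using ak
          by (intro sum.cong refl) (simp add: field_simps)
        also have "\<dots> = (\<Sum>j\<in>J - {k}. b j * f j x) + b k * f k x"
          by (simp add: fk[of x])
        also have "\<dots> = f i x" by (simp add: b sum.remove[OF fin k])
        finally show ?thesis by simp
      qed
      then show "\<exists>a. \<forall>x. f i x = (\<Sum>j\<in>J - {k}. a j * f j x)"
        by (intro exI[of _ "\<lambda>j. b j - b k * a j / a k"] allI)
    qed
    from minimal[OF this] show False using fin k card_Diff1_less[OF fin k] by simp
  qed
  then show ?thesis using J unfolding spans_def by (intro exI[of _ J]) simp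
qed

text \<open>A unit vector of coefficients gives a function that is not identically zero, hence exceeds
  some positive level on an open set; compactness of the unit sphere makes both the level and the
  measure of the set uniform.\<close>

lemma uniformly_large_on_unit_sphere:
  fixes f :: "'i::finite \<Rightarrow> 'm::topological_space \<Rightarrow> real" and \<mu> :: "'m measure"
  assumes sets: "sets \<mu> = sets borel" and pos: "\<And>S. open S \<Longrightarrow> S \<noteq> {} \<Longrightarrow> emeasure \<mu> S \<noteq> 0"
    and cont: "\<And>i. continuous_on UNIV (f i)"
    and indep: "\<forall>a. (\<forall>x. (\<Sum>j\<in>J. a j * f j x) = 0) \<longrightarrow> (\<forall>j\<in>J. a j = 0)"
  shows "\<exists>\<eta>>0. \<exists>\<delta>>0. \<forall>a :: real ^ 'i. norm a = 1 \<longrightarrow> (\<forall>j. j \<notin> J \<longrightarrow> a $ j = 0) \<longrightarrow>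
     \<delta> \<le> emeasure \<mu> {x. \<bar>\<Sum>j\<in>UNIV. a $ j * f j x\<bar> > \<eta>}"
proof -
  define K :: "(real ^ 'i) set" where "K = sphere 0 1 \<inter> (\<Inter>j\<in>-J. {a. a $ j = 0})"
  define u where "u a x = (\<Sum>j\<in>UNIV. a $ j * f j x)" for a :: "real ^ 'i" and x
  have "compact K"
    unfolding K_def by (intro compact_Int_closed compact_sphere closed_INT ballI closed_Collect_eq continuous_intros)
  have uJ: "u a x = (\<Sum>j\<in>J. a $ j * f j x)" if "a \<in> K" for a x
    unfolding u_def using that by (intro sum.mono_neutral_right) (auto simp: K_def)
  have ucont: "continuous_on UNIV (\<lambda>z. u (fst z) (snd z))"
    unfolding u_def
    by (intro continuous_intros continuous_on_compose2[OF cont]) auto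
  define good where "good a \<eta> V W \<longleftrightarrow> \<eta> > 0 \<and> open V \<and> a \<in> V \<and> open W \<and> W \<noteq> {} \<and>
    (\<forall>b\<in>V. \<forall>x\<in>W. \<bar>u b x\<bar> > \<eta>)" for a \<eta> V W
  have "\<exists>\<eta> V W. good a \<eta> V W"
    if a: "a \<in> K" for a
  proof -
    have "\<exists>x. u a x \<noteq> 0"
    proof (rule ccontr)
      assume "\<not> (\<exists>x. u a x \<noteq> 0)"
      then have z: "(\<Sum>j\<in>J. a $ j * f j x) = 0" for x using uJ[OF a] by simp
      have "a $ j = 0" for j
      proof (cases "j \<in> J")
        case True
        then show ?thesis using indep[THEN spec, of "\<lambda>j. a $ j"] z by simp
      next
        case False
        then show ?thesis using a by (simp add: K_def)
      qed
      then have "a = 0" by (simp add: vec_eq_iff)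
      then show False using a by (simp add: K_def)
    qed
    then obtain x where x: "u a x \<noteq> 0" by blast
    define \<eta> where "\<eta> = \<bar>u a x\<bar> / 2"
    have \<eta>: "\<eta> > 0" "\<bar>u a x\<bar> > \<eta>" using x by (auto simp: \<eta>_def)
    have "open {z. \<eta> < \<bar>u (fst z) (snd z)\<bar>}"
      by (rule open_Collect_less[OF continuous_on_const continuous_on_rabs[OF ucont]])
    moreover have "(a, x) \<in> {z. \<eta> < \<bar>u (fst z) (snd z)\<bar>}" using \<eta> by simp
    ultimately obtain V O' where VO: "open V" "open O'" "(a, x) \<in> V \<times> O'"
      "V \<times> O' \<subseteq> {z. \<eta> < \<bar>u (fst z) (snd z)\<bar>}"
      by (rule open_prod_elim)
    have "\<bar>u b y\<bar> > \<eta>" if "b \<in> V" "y \<in> O'" for b y using VO(4) that by auto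
    then have "good a \<eta> V O'" using \<eta>(1) VO(1-3) by (auto simp: good_def)
    then show ?thesis by blast
  qed
  then obtain \<eta> V W where good: "\<And>a. a \<in> K \<Longrightarrow> good a (\<eta> a) (V a) (W a)" by metis
  note W = good[unfolded good_def, THEN conjunct1]
    good[unfolded good_def, THEN conjunct2, THEN conjunct1]
    good[unfolded good_def, THEN conjunct2, THEN conjunct2, THEN conjunct1]
  have W4: "\<And>a. a \<in> K \<Longrightarrow> open (W a)" "\<And>a. a \<in> K \<Longrightarrow> W a \<noteq> {}" 
    and W6: "\<And>a b x. a \<in> K \<Longrightarrow> b \<in> V a \<Longrightarrow> x \<in> W a \<Longrightarrow> \<bar>u b x\<bar> > \<eta> a"
    using good unfolding good_def by blast+
  obtain D where D: "D \<subseteq> K" "finite D" "K \<subseteq> (\<Union>a\<in>D. V a)"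
    using compactE_image[OF \<open>compact K\<close>, of K V] W(2,3) by blast
  define \<eta>0 where "\<eta>0 = Min (insert 1 (\<eta> ` D))"
  define \<delta> where "\<delta> = Min (insert 1 ((\<lambda>a. emeasure \<mu> (W a)) ` D))"
  show ?thesis
  proof (intro exI[of _ \<eta>0] exI[of _ \<delta>] conjI allI impI)
    show "\<eta>0 > 0" unfolding \<eta>0_def using D(1,2) W(1) by (subst Min_gr_iff) auto
    show "\<delta> > 0" unfolding \<delta>_def using D(1,2) W4 pos
      by (subst Min_gr_iff) (auto simp: zero_less_iff_neq_zero)
    fix a :: "real ^ 'i" assume "norm a = 1" "\<forall>j. j \<notin> J \<longrightarrow> a $ j = 0"
    then have "a \<in> K" by (auto simp: K_def)
    then obtain b where b: "b \<in> D" "a \<in> V b" using D(3) by blast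
    have bK: "b \<in> K" using b D(1) by blast
    have "\<eta>0 \<le> \<eta> b" unfolding \<eta>0_def using b D(2) by (intro Min_le) auto
    then have sub: "W b \<subseteq> {x. \<bar>u a x\<bar> > \<eta>0}" using W6[OF bK b(2)] by force
    have "continuous_on UNIV (u a)"
      unfolding u_def by (intro continuous_intros cont)
    then have "open {x. \<bar>u a x\<bar> > \<eta>0}" by (intro open_Collect_less continuous_intros)
    then have "emeasure \<mu> (W b) \<le> emeasure \<mu> {x. \<bar>u a x\<bar> > \<eta>0}"
      using sub by (intro emeasure_mono) (simp_all add: sets)
    moreover have "\<delta> \<le> emeasure \<mu> (W b)" unfolding \<delta>_def using b D(2) by (intro Min_le) auto
    ultimately show "\<delta> \<le> emeasure \<mu> {x. \<bar>\<Sum>j\<in>UNIV. a $ j * f j x\<bar> > \<eta>0}"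
      by (simp add: u_def)
  qed
qed

text \<open>Boundedness of orbits.  Expand the translate \<open>f\<^sub>i \<circ> T\<close> in an independent subfamily and let \<open>c\<close> be its
  coefficients.  The translate exceeds \<open>norm c * \<eta>\<close> on a set of measure at least \<open>\<delta>\<close>, so by
  invariance \<open>f\<^sub>i\<close> does too.  But the measure of \<open>{\<bar>f\<^sub>i\<bar> > R}\<close> tends to \<open>0\<close> for large \<open>R\<close>, because the
  total measure is finite.  This bounds \<open>norm c\<close> uniformly in \<open>T\<close>.\<close>

lemma invariant_function_space_orbit_bound:
  fixes f :: "'i::finite \<Rightarrow> 'm::topological_space \<Rightarrow> real" and \<mu> :: "'m measure"
  assumes fin: "finite_measure \<mu>"
    and sets: "sets \<mu> = sets borel" and pos: "\<And>S. open S \<Longrightarrow> S \<noteq> {} \<Longrightarrow> emeasure \<mu> S \<noteq> 0"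
    and cont: "\<And>i. continuous_on UNIV (f i)"
    and inv: "\<And>T S. T \<in> H \<Longrightarrow> open S \<Longrightarrow> emeasure \<mu> (T -` S) = emeasure \<mu> S"
    and span: "\<And>T i. T \<in> H \<Longrightarrow> \<exists>a. \<forall>x. f i (T x) = (\<Sum>j\<in>UNIV. a j * f j x)"
  shows "\<exists>C\<ge>0. \<forall>T\<in>H. \<forall>x. \<bar>f i (T x)\<bar> \<le> C * (\<Sum>j\<in>UNIV. \<bar>f j x\<bar>)"
proof -
  interpret finite_measure \<mu> by (rule fin)
  obtain J where J: "\<forall>i\<in>UNIV. \<exists>a. \<forall>x. f i x = (\<Sum>j\<in>J. a j * f j x)"
    and indep: "\<forall>a. (\<forall>x. (\<Sum>j\<in>J. a j * f j x) = 0) \<longrightarrow> (\<forall>j\<in>J. a j = 0)"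
    using finite_family_spanned_by_independent[of "UNIV :: 'i set" f] by auto
  obtain \<eta> \<delta> where \<eta>: "\<eta> > 0" and \<delta>: "\<delta> > 0"
    and large: "\<And>a :: real ^ 'i. norm a = 1 \<Longrightarrow> (\<forall>j. j \<notin> J \<longrightarrow> a $ j = 0) \<Longrightarrow>
       \<delta> \<le> emeasure \<mu> {x. \<bar>\<Sum>j\<in>UNIV. a $ j * f j x\<bar> > \<eta>}"
    using uniformly_large_on_unit_sphere[OF sets pos cont indep] by auto
  have "\<exists>R>0. emeasure \<mu> {x. \<bar>f i x\<bar> > R} < \<delta>"
  proof -
    have op: "open {x. \<bar>f i x\<bar> > real n}" for n
      by (intro open_Collect_less continuous_intros cont)
    have "(\<lambda>n. emeasure \<mu> {x. \<bar>f i x\<bar> > real n}) \<longlonglongrightarrow> emeasure \<mu> (\<Inter>n. {x. \<bar>f i x\<bar> > real n})"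
      using op by (intro Lim_emeasure_decseq) (auto simp: sets decseq_def emeasure_finite)
    moreover have "(\<Inter>n. {x. \<bar>f i x\<bar> > real n}) = {}"
    proof -
      have "\<exists>n. \<not> \<bar>f i x\<bar> > real n" for x
        using real_arch_simple[of "\<bar>f i x\<bar>"] by (simp add: not_less)
      then show ?thesis by blast
    qed
    ultimately have "(\<lambda>n. emeasure \<mu> {x. \<bar>f i x\<bar> > real n}) \<longlonglongrightarrow> 0" by simp
    from order_tendstoD(2)[OF this \<delta>] obtain N where "emeasure \<mu> {x. \<bar>f i x\<bar> > real n} < \<delta>" if "n \<ge> N" for n
      unfolding eventually_sequentially by blast
    from this[of "Suc N"] show ?thesis by (intro exI[of _ "real (Suc N)"]) simp
  qed
  then obtain R where R: "R > 0" "emeasure \<mu> {x. \<bar>f i x\<bar> > R} < \<delta>" by blast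
  have "\<bar>f i (T x)\<bar> \<le> R / \<eta> * (\<Sum>j\<in>UNIV. \<bar>f j x\<bar>)" if T: "T \<in> H" for T x
  proof -
    obtain a where a: "\<And>x. f i (T x) = (\<Sum>j\<in>UNIV. a j * f j x)" using span[OF T] by blast
    have "\<forall>i. \<exists>a. \<forall>x. f i x = (\<Sum>j\<in>J. a j * f j x)" using J by simp
    from choice[OF this] obtain b where b: "\<And>j x. f j x = (\<Sum>k\<in>J. b j k * f k x)" by auto
    define c :: "real ^ 'i" where "c = (\<chi> k. if k \<in> J then \<Sum>j\<in>UNIV. a j * b j k else 0)"
    have cJ: "\<forall>k. k \<notin> J \<longrightarrow> c $ k = 0" by (simp add: c_def)
    have fc: "f i (T x) = (\<Sum>k\<in>UNIV. c $ k * f k x)" for x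
    proof -
      have "f i (T x) = (\<Sum>j\<in>UNIV. a j * (\<Sum>k\<in>J. b j k * f k x))"
        by (simp only: a b[symmetric])
      also have "\<dots> = (\<Sum>k\<in>J. \<Sum>j\<in>UNIV. a j * b j k * f k x)"
        unfolding sum_distrib_left by (subst sum.swap) (simp add: mult.assoc)
      also have "\<dots> = (\<Sum>k\<in>J. c $ k * f k x)" by (simp add: c_def sum_distrib_right)
      also have "\<dots> = (\<Sum>k\<in>UNIV. c $ k * f k x)"
        by (rule sum.mono_neutral_left) (auto simp: c_def)
      finally show ?thesis .
    qed
    have norm_c: "norm c \<le> R / \<eta>"
    proof (rule ccontr)
      assume "\<not> norm c \<le> R / \<eta>"
      then have nc: "norm c > R / \<eta>" by simp
      then have c0: "norm c > 0" using R(1) \<eta> by (meson divide_pos_pos less_trans)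
      have "R < norm c * \<eta>" using nc \<eta> by (simp add: field_simps)
      let ?S = "{x. \<bar>f i x\<bar> > norm c * \<eta>}"
      have opn: "open {x. \<bar>f i x\<bar> > r}" for r by (intro open_Collect_less continuous_intros cont)
      have eq: "{x. \<bar>\<Sum>j\<in>UNIV. (c /\<^sub>R norm c) $ j * f j x\<bar> > \<eta>} = T -` ?S"
      proof -
        have "(\<Sum>j\<in>UNIV. (c /\<^sub>R norm c) $ j * f j x) = f i (T x) / norm c" for x
          unfolding fc by (simp add: sum_distrib_left divide_inverse mult_ac)
        moreover have "\<bar>f i (T x) / norm c\<bar> > \<eta> \<longleftrightarrow> \<bar>f i (T x)\<bar> > norm c * \<eta>" for x
          using c0 by (simp add: abs_divide pos_less_divide_eq mult.commute)
        ultimately show ?thesis by (simp add: vimage_def del: vector_scaleR_component)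
      qed
      have "\<delta> \<le> emeasure \<mu> {x. \<bar>\<Sum>j\<in>UNIV. (c /\<^sub>R norm c) $ j * f j x\<bar> > \<eta>}"
        using c0 cJ by (intro large) auto
      also have "\<dots> = emeasure \<mu> ?S" unfolding eq by (rule inv[OF T opn])
      also have "\<dots> \<le> emeasure \<mu> {x. \<bar>f i x\<bar> > R}"
        using \<open>R < norm c * \<eta>\<close> opn by (intro emeasure_mono) (auto simp: sets)
      also have "\<dots> < \<delta>" by (rule R(2))
      finally show False by simp
    qed
    have "\<bar>f i (T x)\<bar> \<le> (\<Sum>k\<in>UNIV. \<bar>c $ k * f k x\<bar>)" unfolding fc by (rule sum_abs)
    also have "\<dots> \<le> (\<Sum>k\<in>UNIV. R / \<eta> * \<bar>f k x\<bar>)"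
    proof (rule sum_mono)
      fix k
      have "\<bar>c $ k\<bar> \<le> R / \<eta>" using component_le_norm_cart[of c k] norm_c by simp
      then show "\<bar>c $ k * f k x\<bar> \<le> R / \<eta> * \<bar>f k x\<bar>"
        unfolding abs_mult by (rule mult_right_mono) simp
    qed
    finally show ?thesis by (simp only: sum_distrib_left)
  qed
  then show ?thesis using R(1) \<eta> by (intro exI[of _ "R / \<eta>"]) auto
qed

section \<open>Isometric actions\<close>

locale isometric_action =
  G: lie_group G B + V: finite_volume_manifold A g \<mu> + act: group_action G UNIV \<Phi>
  for G :: "'g::{t2_space,second_countable_topology} monoid" (structure)
    and B :: "('g, 'f::finite_dim_normed) chart set"
    and A :: "('m::{t2_space,second_countable_topology}, 'e::finite_dim_normed) chart set"
    and g :: "('m, 'e) metric_field" and \<mu> :: "'m measure" and \<Phi> :: "'g \<Rightarrow> 'm \<Rightarrow> 'm" +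
  assumes action_smooth: "smooth_map (prod_atlas B A) A (\<lambda>(h, x). \<Phi> h x)"
    and isometric: "isometry A g (\<Phi> h)"
begin

lemma mfB: "smooth_manifold B" ..

lemma mfA: "smooth_manifold A" ..

lemma action_mult: "\<Phi> (h \<otimes> k) x = \<Phi> h (\<Phi> k x)"
  by (rule act.composition_rule) simp_all

lemma action_one: "\<Phi> \<one> x = x"
  using fun_cong[OF act.id_eq_one, of x] by simp

definition orbit_map :: "'m \<Rightarrow> 'g \<Rightarrow> 'm" where
  "orbit_map x h = \<Phi> h x"

lemma orbit_map_one: "orbit_map x \<one> = x" by (simp add: orbit_map_def action_one)

lemma orbit_map_differentiable: "differentiable_map_at B A (orbit_map x) h"
  using smooth_map_slice(2)[OF mfB mfA mfA action_smooth, of x]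
  by (intro smooth_map_differentiable_at) (simp add: orbit_map_def[abs_def])

lemma translation_differentiable: "differentiable_map_at A A (\<Phi> h) x"
  using isometric by (intro smooth_map_differentiable_at) (simp add: isometry_def)

text \<open>The curve that defines the fundamental field is the image of \<open>exp (t X)\<close> under the orbit map.\<close>

lemma fundamental_field_eq_differential:
  assumes X: "X \<in> lie_algebra G B"
  shows "fundamental_field G B A \<Phi> X x = differential B A (orbit_map x) \<one> X"
proof -
  have "(\<lambda>t. \<Phi> (lie_exp G B (\<lambda>c. t *\<^sub>R X c)) x) = orbit_map x \<circ> G.exp_curve X"
    by (simp add: fun_eq_iff G.lie_exp_scale[OF X] orbit_map_def)
  then have "fundamental_field G B A \<Phi> X x = velocity A (orbit_map x \<circ> G.exp_curve X) 0"
    by (simp add: fundamental_field_def)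
  also have "\<dots> = differential B A (orbit_map x) (G.exp_curve X 0) (velocity B (G.exp_curve X) 0)"
    using G.exp_curve_at_zero[OF X] G.unit_chart
    by (intro velocity_compose[OF mfB mfA orbit_map_differentiable G.unit_chart(1)]) simp_all
  finally show ?thesis by (simp add: G.exp_curve_at_zero(1)[OF X] G.exp_curve(2)[OF X])
qed

text \<open>Elements of the Lie algebra by their coordinates in the chart around the identity.\<close>

definition left_vector :: "'f \<Rightarrow> ('g, 'f) tangent" where
  "left_vector v = coord_vector B G.unit_chart \<one> v"

lemma left_vector_in: "left_vector v \<in> tangent_space B \<one>"
  unfolding left_vector_def by (rule G.coord_vector_in_tangent_space[OF G.unit_chart])

lemma left_vector_coords: "X \<in> tangent_space B \<one> \<Longrightarrow> left_vector (X G.unit_chart) = X"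
  unfolding left_vector_def by (rule G.coord_vector_of_tangent[OF G.unit_chart])

definition field_product :: "'f \<Rightarrow> 'f \<Rightarrow> 'm \<Rightarrow> real" where
  "field_product v w x = g x (differential B A (orbit_map x) \<one> (left_vector v))
                     (differential B A (orbit_map x) \<one> (left_vector w))"

lemma metric_fundamental_fields:
  assumes "X \<in> lie_algebra G B" "Y \<in> lie_algebra G B"
  shows "g x (fundamental_field G B A \<Phi> X x) (fundamental_field G B A \<Phi> Y x)
    = field_product (X G.unit_chart) (Y G.unit_chart) x"
  using assms left_vector_coords
  by (simp add: field_product_def fundamental_field_eq_differential lie_algebra_def)

definition orbit_derivative :: "('m, 'e) chart \<Rightarrow> 'm \<Rightarrow> 'f \<Rightarrow> 'e" where
  "orbit_derivative d x = frechet_derivative (snd d \<circ> orbit_map x \<circ> G.ci) (at (G.cc \<one>))"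

lemma orbit_derivative_has_derivative:
  assumes "d \<in> A" "x \<in> fst d"
  shows "(snd d \<circ> orbit_map x \<circ> G.ci has_derivative orbit_derivative d x) (at (G.cc \<one>))"
  using differentiable_map_at_has_derivative[OF orbit_map_differentiable G.unit_chart(1) assms(1) G.unit_chart(2)]
    assms(2) by (simp add: orbit_derivative_def orbit_map_one)

lemma field_product_in_chart:
  assumes d: "d \<in> A" "x \<in> fst d"
  shows "field_product v w x = metric_coords A g d x (orbit_derivative d x v) (orbit_derivative d x w)"
proof -
  have T: "differential B A (orbit_map x) \<one> (left_vector v) \<in> tangent_space A x" for v
    using differential_in_tangent_space[OF mfB mfA orbit_map_differentiable left_vector_in, of x v]
    by (simp add: orbit_map_one)
  have "differential B A (orbit_map x) \<one> (left_vector v) d = orbit_derivative d x v" for v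
    using G.differential_in_chart[OF orbit_map_differentiable left_vector_in G.unit_chart d(1), of x v] d(2)
    by (simp add: orbit_map_one orbit_derivative_def left_vector_def G.coord_vector_same[OF G.unit_chart])
  then show ?thesis
    unfolding field_product_def metric_of_tangent_vectors[OF mfA d T T] by simp
qed

lemma field_product_bilinear: "bilinear (\<lambda>v w. field_product v w x)"
proof -
  obtain d where d: "d \<in> A" "x \<in> fst d" using V.ex_chart by blast
  have lin: "linear (orbit_derivative d x)"
    by (rule has_derivative_linear[OF orbit_derivative_has_derivative[OF d]])
  have bil: "bilinear (metric_coords A g d x)" by (rule V.metric_bilinear[OF d])
  have l: "linear (\<lambda>v. metric_coords A g d x v w)" and r: "linear (metric_coords A g d x v)" for v w
    using bil by (auto simp: bilinear_def)
  show ?thesis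
    unfolding bilinear_def field_product_in_chart[OF d]
    using linear_compose[OF lin l] linear_compose[OF lin r] by (simp add: comp_def)
qed

text \<open>Finitely many functions, indexed by pairs of basis vectors, span all products of fundamental
  fields.\<close>

lemma field_product_expansion:
  "field_product v w x = (\<Sum>p\<in>UNIV. to_vec v $ fst p * to_vec w $ snd p * field_product (basis_elem (fst p)) (basis_elem (snd p)) x)"
proof -
  have "field_product v w x = field_product (of_vec (to_vec v)) (of_vec (to_vec w)) x" by (simp add: of_vec_to_vec)
  also have "\<dots> = (\<Sum>i\<in>UNIV. \<Sum>j\<in>UNIV. to_vec v $ i * to_vec w $ j * field_product (basis_elem i) (basis_elem j) x)"
    using bilinear_gram_matrix[OF field_product_bilinear, of "to_vec v" "to_vec w" x] by (simp add: gram_matrix_def)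
  also have "\<dots> = (\<Sum>p\<in>UNIV. to_vec v $ fst p * to_vec w $ snd p * field_product (basis_elem (fst p)) (basis_elem (snd p)) x)"
    by (simp add: sum.cartesian_product case_prod_unfold)
  finally show ?thesis .
qed

text \<open>It is a partial derivative of the action in charts, which is smooth in both variables.\<close>

lemma orbit_derivative_continuous:
  assumes d: "d \<in> A"
  shows "continuous_on (fst d) (\<lambda>x. orbit_derivative d x v)"
proof -
  define \<Omega> where "\<Omega> = {(u, y). u \<in> G.cr \<and> y \<in> snd d ` fst d \<and> \<Phi> (G.ci u) (chart_inv d y) \<in> fst d}"
  define P where "P = (\<lambda>(u, y). snd d (\<Phi> (G.ci u) (chart_inv d y)))"
  have P: "smooth_on \<Omega> P"
    using smooth_map_prod_chart_rep(2)[OF mfB mfA action_smooth G.unit_chart(1) d d V.open_domain[OF d]]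
    by (simp add: \<Omega>_def P_def)
  have in\<Omega>: "(G.cc \<one>, snd d x) \<in> \<Omega>" if "x \<in> fst d" for x
    using that G.cc_one_in by (auto simp: \<Omega>_def V.chart_inv_left[OF d] G.ci_one action_one)
  have eq: "orbit_derivative d x v = frechet_derivative P (at (G.cc \<one>, snd d x)) (v, 0)" if x: "x \<in> fst d" for x
  proof -
    have "((\<lambda>u. (u, snd d x)) has_derivative (\<lambda>v. (v, 0))) (at (G.cc \<one>))"
      by (intro has_derivative_Pair has_derivative_const has_derivative_ident)
    from diff_chain_at[OF this smooth_on_has_derivative[OF P in\<Omega>[OF x]]]
    have "(P \<circ> (\<lambda>u. (u, snd d x)) has_derivative
        frechet_derivative P (at (G.cc \<one>, snd d x)) \<circ> (\<lambda>v. (v, 0))) (at (G.cc \<one>))" .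
    moreover have "P \<circ> (\<lambda>u. (u, snd d x)) = snd d \<circ> orbit_map x \<circ> G.ci"
      by (simp add: fun_eq_iff P_def orbit_map_def V.chart_inv_left[OF d x])
    ultimately have "(snd d \<circ> orbit_map x \<circ> G.ci has_derivative
        frechet_derivative P (at (G.cc \<one>, snd d x)) \<circ> (\<lambda>v. (v, 0))) (at (G.cc \<one>))" by simp
    from fun_cong[OF has_derivative_unique[OF orbit_derivative_has_derivative[OF d x] this], of v]
    show ?thesis by simp
  qed
  have "continuous_on \<Omega> (\<lambda>z. frechet_derivative P (at z) (v, 0))"
    by (rule smooth_on_continuous[OF smooth_on_derivative[OF P]])
  then have "continuous_on (fst d) (\<lambda>x. frechet_derivative P (at (G.cc \<one>, snd d x)) (v, 0))"
    by (rule continuous_on_compose2)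
       (use in\<Omega> V.continuous_on_chart[OF d] in \<open>auto intro: continuous_on_Pair continuous_on_const\<close>)
  then show ?thesis by (simp add: eq cong: continuous_on_cong)
qed

lemma field_product_continuous: "continuous_on UNIV (field_product v w)"
proof -
  have "isCont (field_product v w) x" for x
  proof -
    obtain d where d: "d \<in> A" "x \<in> fst d" using V.ex_chart by blast
    have eq: "field_product v w y = (\<Sum>b\<in>std_basis. \<Sum>b'\<in>std_basis. coord b (orbit_derivative d y v) *
        (coord b' (orbit_derivative d y w) * metric_coords A g d y b b'))" if y: "y \<in> fst d" for y
    proof -
      have bil: "bilinear (metric_coords A g d y)" by (rule V.metric_bilinear[OF d(1) y])
      have l: "linear (\<lambda>v. metric_coords A g d y v w)" and r: "linear (metric_coords A g d y v)" for v w
        using bil by (auto simp: bilinear_def)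
      have "metric_coords A g d y a c = (\<Sum>b\<in>std_basis. \<Sum>b'\<in>std_basis. coord b a * (coord b' c * metric_coords A g d y b b'))" for a c
      proof -
        have "metric_coords A g d y a c = metric_coords A g d y (\<Sum>b\<in>std_basis. coord b a *\<^sub>R b) c"
          by (simp add: coord_sum)
        also have "\<dots> = (\<Sum>b\<in>std_basis. coord b a * metric_coords A g d y b c)"
          by (simp add: linear_sum[OF l] linear_scale[OF l])
        also have "\<dots> = (\<Sum>b\<in>std_basis. coord b a * metric_coords A g d y b (\<Sum>b'\<in>std_basis. coord b' c *\<^sub>R b'))"
          by (simp add: coord_sum)
        also have "\<dots> = (\<Sum>b\<in>std_basis. coord b a * (\<Sum>b'\<in>std_basis. coord b' c * metric_coords A g d y b b'))"
          by (simp add: linear_sum[OF r] linear_scale[OF r])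
        finally show ?thesis by (simp add: sum_distrib_left)
      qed
      then show ?thesis unfolding field_product_in_chart[OF d(1) y] .
    qed
    have m: "continuous_on (fst d) (\<lambda>y. metric_coords A g d y b b')" for b b'
    proof -
      have "continuous_on (fst d) (\<lambda>y. (\<lambda>z. metric_coords A g d (chart_inv d z) b b') (snd d y))"
        by (rule continuous_on_compose2[OF smooth_on_continuous[OF V.metric_smooth[OF d(1)]]
              V.continuous_on_chart[OF d(1)]]) simp
      then show ?thesis by (simp add: V.chart_inv_left[OF d(1)] cong: continuous_on_cong)
    qed
    have c: "continuous_on (fst d) (\<lambda>y. coord b (orbit_derivative d y v))" for b v
      by (rule bounded_linear.continuous_on[OF bounded_linear_coord orbit_derivative_continuous[OF d(1)]])
    have "continuous_on (fst d) (\<lambda>y. \<Sum>b\<in>std_basis. \<Sum>b'\<in>std_basis. coord b (orbit_derivative d y v) *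
        (coord b' (orbit_derivative d y w) * metric_coords A g d y b b'))"
      by (intro continuous_on_sum continuous_on_mult m c)
    then have "continuous_on (fst d) (field_product v w)" by (simp add: eq cong: continuous_on_cong)
    then show ?thesis using d V.open_domain[OF d(1)] by (simp add: continuous_on_eq_continuous_at)
  qed
  then show ?thesis by (simp add: continuous_at_imp_continuous_on)
qed

text \<open>The adjoint action of the inverse of \<open>h\<close>, in coordinates.\<close>

definition adjoint_inv :: "'g \<Rightarrow> 'f \<Rightarrow> 'f" where
  "adjoint_inv h v = differential B B (\<lambda>k. inv h \<otimes> (k \<otimes> h)) \<one> (left_vector v) G.unit_chart"

text \<open>Since \<open>k h x = h (h\<^sup>-\<^sup>1 k h) x\<close>, the orbit map at \<open>h x\<close> is the orbit map at \<open>x\<close> preceded by a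
  conjugation and followed by the action of \<open>h\<close>; the latter is an isometry.\<close>

lemma field_product_equivariant: "field_product v w (\<Phi> h x) = field_product (adjoint_inv h v) (adjoint_inv h w) x"
proof -
  let ?R = "\<lambda>k. k \<otimes> h" and ?L = "\<lambda>k. inv h \<otimes> k"
  define conj where "conj = ?L \<circ> ?R"
  have conj_one: "conj \<one> = \<one>" by (simp add: conj_def)
  have dc: "differentiable_map_at B B conj \<one>"
    unfolding conj_def
    by (rule differential_chain(1)[OF mfB mfB mfB])
       (auto intro: smooth_map_differentiable_at G.right_mult_smooth G.left_mult_smooth)
  have do: "differentiable_map_at B A (orbit_map x) (conj \<one>)" by (rule orbit_map_differentiable)
  have oc: "differentiable_map_at B A (orbit_map x \<circ> conj) \<one>"
    by (rule differential_chain(1)[OF mfB mfB mfA dc do])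
  have eq: "orbit_map (\<Phi> h x) = \<Phi> h \<circ> (orbit_map x \<circ> conj)"
  proof
    fix k
    have "h \<otimes> (inv h \<otimes> (k \<otimes> h)) = k \<otimes> h"
      by (simp add: G.m_assoc[symmetric])
    then show "orbit_map (\<Phi> h x) k = (\<Phi> h \<circ> (orbit_map x \<circ> conj)) k"
      by (simp add: orbit_map_def conj_def action_mult[symmetric])
  qed
  let ?D = "\<lambda>v. differential B A (orbit_map x) \<one> (left_vector (adjoint_inv h v))"
  have D: "differential B A (orbit_map (\<Phi> h x)) \<one> (left_vector v) = differential A A (\<Phi> h) x (?D v)"
    and T: "?D v \<in> tangent_space A x" for v
  proof -
    have C: "differential B B conj \<one> (left_vector v) \<in> tangent_space B \<one>"
      using differential_in_tangent_space[OF mfB mfB dc left_vector_in] by (simp add: conj_one)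
    then have ad: "left_vector (adjoint_inv h v) = differential B B conj \<one> (left_vector v)"
      using left_vector_coords[OF C] by (simp add: adjoint_inv_def conj_def comp_def)
    have "differential B A (orbit_map (\<Phi> h x)) \<one> (left_vector v)
        = differential A A (\<Phi> h) ((orbit_map x \<circ> conj) \<one>) (differential B A (orbit_map x \<circ> conj) \<one> (left_vector v))"
      unfolding eq by (rule differential_chain(2)[OF mfB mfA mfA oc translation_differentiable left_vector_in])
    also have "differential B A (orbit_map x \<circ> conj) \<one> (left_vector v)
        = differential B A (orbit_map x) (conj \<one>) (differential B B conj \<one> (left_vector v))"
      by (rule differential_chain(2)[OF mfB mfB mfA dc do left_vector_in])
    finally show "differential B A (orbit_map (\<Phi> h x)) \<one> (left_vector v) = differential A A (\<Phi> h) x (?D v)"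
      by (simp add: conj_one orbit_map_one ad)
    show "?D v \<in> tangent_space A x"
      using differential_in_tangent_space[OF mfB mfA orbit_map_differentiable left_vector_in]
      by (metis orbit_map_one)
  qed
  show ?thesis
    unfolding field_product_def D using isometric[of h] T by (simp add: isometry_def)
qed

lemma field_product_orbit_bound:
  "\<exists>C\<ge>0. \<forall>h x. \<bar>field_product (basis_elem i) (basis_elem j) (\<Phi> h x)\<bar>
     \<le> C * (\<Sum>p\<in>UNIV. \<bar>field_product (basis_elem (fst p)) (basis_elem (snd p)) x\<bar>)"
proof -
  let ?f = "\<lambda>p. field_product (basis_elem (fst p)) (basis_elem (snd p))"
  have "\<exists>C\<ge>0. \<forall>T\<in>range \<Phi>. \<forall>x. \<bar>?f (i, j) (T x)\<bar> \<le> C * (\<Sum>p\<in>UNIV. \<bar>?f p x\<bar>)"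
  proof (rule invariant_function_space_orbit_bound[OF V.finite_volume V.sets_volume])
    show "emeasure \<mu> S \<noteq> 0" if "open S" "S \<noteq> {}" for S using V.volume_open_pos that by blast
    show "continuous_on UNIV (?f p)" for p by (rule field_product_continuous)
    show "emeasure \<mu> (T -` S) = emeasure \<mu> S" if "T \<in> range \<Phi>" "open S" for T S
      using that V.volume_isometry_vimage[OF isometric] by blast
    fix T p assume "T \<in> range \<Phi>"
    then obtain h where h: "T = \<Phi> h" by blast
    show "\<exists>a. \<forall>x. ?f p (T x) = (\<Sum>q\<in>UNIV. a q * ?f q x)"
      unfolding h field_product_equivariant
      by (intro exI[of _ "\<lambda>q. to_vec (adjoint_inv h (basis_elem (fst p))) $ fst q *
          to_vec (adjoint_inv h (basis_elem (snd p))) $ snd q"] allI) (rule field_product_expansion)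
  qed
  then show ?thesis by auto
qed

text \<open>On \<open>W\<close> the sum \<open>s\<close> of the finitely many spanning functions is bounded, and the orbit bound carries
  this over to all translates of \<open>W\<close>.\<close>

lemma invariant_open_set_with_bounded_products:
  "\<exists>U. open U \<and> U \<noteq> {} \<and> (\<forall>h. \<Phi> h ` U \<subseteq> U) \<and> (\<forall>v w. \<exists>C. \<forall>x\<in>U. \<bar>field_product v w x\<bar> \<le> C)"
proof -
  let ?f = "\<lambda>p x. field_product (basis_elem (fst p)) (basis_elem (snd p)) x"
  define s where "s x = (\<Sum>p\<in>UNIV. \<bar>?f p x\<bar>)" for x
  have s: "continuous_on UNIV s"
    unfolding s_def by (intro continuous_on_sum continuous_on_rabs field_product_continuous)
  define x0 :: 'm where "x0 = undefined"
  define W where "W = {x. s x < s x0 + 1}"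
  have W: "open W" unfolding W_def by (rule open_Collect_less[OF s continuous_on_const])
  define U where "U = (\<Union>h. \<Phi> h ` W)"
  have "open (\<Phi> h ` W)" for h
    unfolding isometry_image_eq[OF isometric]
    by (rule open_vimage[OF W isometry_homeomorphism(2)[OF isometric]])
  then have "open U" unfolding U_def by blast
  moreover have "U \<noteq> {}" by (auto simp: U_def W_def intro!: exI[of _ x0])
  moreover have "\<Phi> h ` U \<subseteq> U" for h
  proof
    fix y assume "y \<in> \<Phi> h ` U"
    then obtain k x where "x \<in> W" "y = \<Phi> h (\<Phi> k x)" by (auto simp: U_def)
    then have "y = \<Phi> (h \<otimes> k) x" by (simp add: action_mult)
    with \<open>x \<in> W\<close> show "y \<in> U" by (auto simp: U_def)
  qed
  moreover have "\<exists>C. \<forall>x\<in>U. \<bar>field_product v w x\<bar> \<le> C" for v w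
  proof -
    have "\<exists>C\<ge>0. \<forall>h x. \<bar>?f p (\<Phi> h x)\<bar> \<le> C * s x" for p
      using field_product_orbit_bound[of "fst p" "snd p"] by (simp add: s_def)
    then obtain C where C: "\<And>p. C p \<ge> 0" "\<And>p h x. \<bar>?f p (\<Phi> h x)\<bar> \<le> C p * s x" by metis
    have f_bound: "\<bar>?f p y\<bar> \<le> C p * (s x0 + 1)" if y: "y \<in> U" for p y
    proof -
      obtain h x where hx: "x \<in> W" "y = \<Phi> h x" using y by (auto simp: U_def)
      have "\<bar>?f p y\<bar> \<le> C p * s x" using C(2) hx(2) by simp
      also have "\<dots> \<le> C p * (s x0 + 1)" using C(1) hx(1) by (intro mult_left_mono) (auto simp: W_def)
      finally show ?thesis .
    qed
    have "\<bar>field_product v w y\<bar> \<le> (\<Sum>p\<in>UNIV. \<bar>to_vec v $ fst p * to_vec w $ snd p\<bar> * (C p * (s x0 + 1)))"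
      if y: "y \<in> U" for y
    proof -
      have "\<bar>field_product v w y\<bar> \<le> (\<Sum>p\<in>UNIV. \<bar>to_vec v $ fst p * to_vec w $ snd p * ?f p y\<bar>)"
        unfolding field_product_expansion[of v w y] by (rule sum_abs)
      also have "\<dots> \<le> (\<Sum>p\<in>UNIV. \<bar>to_vec v $ fst p * to_vec w $ snd p\<bar> * (C p * (s x0 + 1)))"
        unfolding abs_mult[of "_ * _"] by (intro sum_mono mult_left_mono f_bound[OF y]) simp
      finally show ?thesis .
    qed
    then show ?thesis by blast
  qed
  ultimately show ?thesis by blast
qed

end

theorem proposition1p16:
  fixes A :: "('m::{t2_space,second_countable_topology}, 'e::finite_dim_normed) chart set"
    and g :: "('m, 'e) metric_field"
    and \<mu> :: "'m measure"
    and G :: "'g::{t2_space,second_countable_topology} monoid"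
    and B :: "('g, 'f::finite_dim_normed) chart set"
    and \<Phi> :: "'g \<Rightarrow> 'm \<Rightarrow> 'm"
  assumes "semi_riemannian_manifold A g"
    and "connected (UNIV :: 'm set)"
    and "is_metric_volume A g \<mu>"
    and "finite_measure \<mu>"
    and "lie_group G B"
    and "connected (UNIV :: 'g set)"
    and "smooth_action G B A \<Phi>"
    and "\<And>h. isometry A g (\<Phi> h)"
    and "locally_effective G \<Phi>"
  shows "\<exists>U :: 'm set. open U \<and> U \<noteq> {} \<and> (\<forall>h. \<Phi> h ` U \<subseteq> U) \<and>
           (\<forall>X\<in>lie_algebra G B. \<forall>Y\<in>lie_algebra G B. \<exists>C. \<forall>x\<in>U.
              \<bar>g x (fundamental_field G B A \<Phi> X x) (fundamental_field G B A \<Phi> Y x)\<bar> \<le> C)"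
proof (cases "(std_basis :: 'e set) = {}")
  \<comment> \<open>in dimension zero all tangent vectors vanish\<close>
  case True
  interpret M: semi_riemannian_manifold A g by fact
  have zero: "(v :: 'e) = 0" for v by (rule trivial_space[OF True])
  have "g x V W = 0" for x and V W :: "('m, 'e) tangent"
  proof -
    obtain c where c: "c \<in> A" "x \<in> fst c" using M.ex_chart by blast
    have eq: "V = coord_vector A c x 0" "W = coord_vector A c x 0"
      using zero by (metis ext)+
    have "linear (\<lambda>v. metric_coords A g c x v 0)"
      using M.metric_bilinear[OF c] by (simp add: bilinear_def)
    then have "metric_coords A g c x 0 0 = 0" by (rule linear_0)
    then show ?thesis by (simp add: metric_coords_def eq)
  qed
  then show ?thesis by (intro exI[of _ UNIV]) auto
next
  case False
  interpret S: smooth_action G B A \<Phi> by fact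
  interpret isometric_action G B A g \<mu> \<Phi>
  proof (intro isometric_action.intro)
    show "lie_group G B" by fact
    show "finite_volume_manifold A g \<mu>"
      using assms(1,3,4) False by (simp add: finite_volume_manifold_def finite_volume_manifold_axioms_def)
    show "group_action G UNIV \<Phi>" ..
    show "isometric_action_axioms B A g \<Phi>"
      using S.action_smooth assms(8) by (simp add: isometric_action_axioms_def)
  qed
  obtain U where U: "open U" "U \<noteq> {}" "\<And>h. \<Phi> h ` U \<subseteq> U"
    and bound: "\<And>v w. \<exists>C. \<forall>x\<in>U. \<bar>field_product v w x\<bar> \<le> C"
    using invariant_open_set_with_bounded_products by blast
  have "\<exists>C. \<forall>x\<in>U. \<bar>g x (fundamental_field G B A \<Phi> X x) (fundamental_field G B A \<Phi> Y x)\<bar> \<le> C"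
    if "X \<in> lie_algebra G B" "Y \<in> lie_algebra G B" for X Y
    unfolding metric_fundamental_fields[OF that] by (rule bound)
  with U show ?thesis by blast
qed

end
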